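(* Let $G$ be the simple Mathieu group $M_{11}$, and let $V(\mathbb{Z}G)$ be the normalized unit group of the integral group ring $\mathbb{Z}G$. Then $\pi(G)=\pi(V(\mathbb{Z}G))$, where $\pi(G)$ and $\pi(V(\mathbb{Z}G))$ are the prime graphs of $G$ and of $V(\mathbb{Z}G)$, respectively.
   Context: $V(\mathbb{Z}G)$ is the group of units $\sum_{g\in G}\alpha_g g$ of $\mathbb{Z}G$ of augmentation $\sum_{g\in G}\alpha_g=1$. The prime graph (Gruenberg-Kegel graph) $\pi(X)$ of a group $X$ is the graph whose vertices are the primes $p$ such that $X$ has an element of order $p$ (for finite $X$, these are exactly the primes dividing the order of $X$), and in which two distinct vertices $p$ and $q$ are adjacent if and only if $X$ has an element of order $pq$. Equality of prime graphs means that they have the same vertex set and the same edges. *)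

theory Defs
  imports "HOL-Algebra.Sym_Groups" "HOL-Algebra.Multiplicative_Group" "HOL-Computational_Algebra.Primes" "HOL-Library.Poly_Mapping"
begin

text \<open>
  The Mathieu group of degree 11, in its natural sharply 4-transitive representation on
  \<open>{1..11}\<close> and with the customary generators
  \<open>(1,2,3,4,5,6,7,8,9,10,11)\<close> and \<open>(3,7,11,8)(4,10,5,6)\<close>.
\<close>

definition M11 :: "(nat \<Rightarrow> nat) monoid" where
  "M11 = subgroup_generated (sym_group 11)
     {cycle_of_list [1,2,3,4,5,6,7,8,9,10,11],
      cycle_of_list [3,7,11,8] \<circ> cycle_of_list [4,10,5,6]}"

text \<open>
  The product of the type \<open>'a \<Rightarrow>\<^sub>0 int\<close> itself comes from an additive type class on \<open>'a\<close>; the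
  product here is instead the convolution over the multiplication of the record \<open>G\<close>.
\<close>

definition integral_group_ring :: "('a, 'b) monoid_scheme \<Rightarrow> ('a \<Rightarrow>\<^sub>0 int) ring" where
  "integral_group_ring G =
    \<lparr> carrier = {u. Poly_Mapping.keys u \<subseteq> carrier G},
      monoid.mult = (\<lambda>u v. \<Sum>g \<in> Poly_Mapping.keys u. \<Sum>h \<in> Poly_Mapping.keys v.
        Poly_Mapping.single (g \<otimes>\<^bsub>G\<^esub> h) (Poly_Mapping.lookup u g * Poly_Mapping.lookup v h)),
      one = Poly_Mapping.single \<one>\<^bsub>G\<^esub> 1,
      zero = 0,
      add = (+) \<rparr>"

definition augmentation :: "('a \<Rightarrow>\<^sub>0 int) \<Rightarrow> int" where
  "augmentation u = (\<Sum>g \<in> Poly_Mapping.keys u. Poly_Mapping.lookup u g)"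

definition normalized_units :: "('a, 'b) monoid_scheme \<Rightarrow> ('a \<Rightarrow>\<^sub>0 int) monoid" where
  "normalized_units G =
    (units_of (integral_group_ring G))
      \<lparr> carrier := {u \<in> Units (integral_group_ring G). augmentation u = 1} \<rparr>"

text \<open>
  A graph is a pair of its vertex set and its set of edges, an edge being a two-element set of
  vertices. Note that \<open>group.ord\<close> is \<open>0\<close> on elements of infinite order.
\<close>

definition prime_graph_vertices :: "('a, 'b) monoid_scheme \<Rightarrow> nat set" where
  "prime_graph_vertices X =
    {p. Factorial_Ring.prime p \<and> (\<exists>x \<in> carrier X. group.ord X x = p)}"

definition prime_graph_edges :: "('a, 'b) monoid_scheme \<Rightarrow> nat set set" where
  "prime_graph_edges X =
    {{p, q} | p q. p \<in> prime_graph_vertices X \<and> q \<in> prime_graph_vertices X \<and> p \<noteq> q \<and>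
       (\<exists>x \<in> carrier X. group.ord X x = p * q)}"

definition prime_graph :: "('a, 'b) monoid_scheme \<Rightarrow> nat set \<times> nat set set" where
  "prime_graph X = (prime_graph_vertices X, prime_graph_edges X)"

end

theory Submission
  imports Defs "HOL-Number_Theory.Number_Theory" "Jordan_Normal_Form.Schur_Decomposition"
begin

text \<open>
  Expanding \<open>u\<^bsup>p\<^sup>m\<^esup>\<close> over words of group elements and rotating the words shows that the coefficient
  sum of a torsion unit \<open>u\<close> over the elements of order \<open>m\<close> vanishes if \<open>m\<close> has a prime factor
  not dividing the order of \<open>u\<close>. Together with the Berman--Higman theorem this determines the trace of
  every unit of order 3, 5 or 11 on the permutation module of degree 11. For units of order 2 one
  also needs that the coefficient sum over the elements of order 8 vanishes; this holds because the
  cyclic group generated by \<open>m \<mapsto> g m u\<close> (with \<open>g\<close> of order 8) acts 2-adically freely on the group ring.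

  If \<open>u\<close> has order \<open>p q\<close>, then the traces of its powers give the multiplicity of 1 as an eigenvalue of
  \<open>u\<close> and of \<open>u\<^sup>p\<close>; with the congruences of \<open>tr u\<close> modulo \<open>p\<close> and \<open>q\<close> this is
  contradictory for the orders 15, 22, 33 and 55, and for order 10 it forces \<open>tr u = 3\<close>, which
  contradicts the parities of the coefficient sums. If \<open>G\<close> has no element of prime order \<open>p\<close>, then a unit of
  order \<open>p\<close> would have coefficient 1 modulo \<open>p\<close> at the identity, against Berman--Higman.

  The orders and fixed points of the elements of \<open>M11\<close> are found by conjugating each of them to one of 18
  representatives, using that the permutations preserving a Steiner system \<open>S(4,5,11)\<close> form a sharply
  4-transitive group.
\<close>

section \<open>Traces of powers in an integral group ring\<close>

text \<open>The vertices 2, 3, 5, 11 and the single edge {2, 3} of the graph of M11 leave the orders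
  10, 15, 22, 33 and 55 to be excluded. A torsion unit is not known to be conjugate to a group
  element, so its trace is reached only through its coefficient sums. Degree 11 works because the
  number of fixed points of an element of M11 is a function of its order: the trace of a unit is
  then a fixed combination of the sums over elements of equal order. Orders 2 and 4 both give three
  fixed points, so for an involution these two sums may stay mixed. Elements of order 8 fix one
  point, however, and the word argument, which needs a prime not dividing the order of the unit,
  cannot separate one power of 2 from another; this is the gap that the 2-adic argument closes.
  Order 10 is the one case where the multiplicities are consistent, hence the extra comparison with
  the square of the unit.\<close>

text \<open>Comparing lengths makes \<open>ys\<close> a prefix of \<open>zs\<close>; stripping it
  leaves a shorter word that still commutes with \<open>ys\<close>.\<close>

lemma commuting_append_concat_replicate:
  assumes "ys @ zs = zs @ ys" "length zs = length ys * q"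
  shows "zs = concat (replicate q ys)"
  using assms
proof (induction q arbitrary: zs)
  case (Suc q)
  then obtain ws where ws: "zs = ys @ ws"
    by (metis append_eq_append_conv_if le_add1 mult_Suc_right append_take_drop_id append_eq_conv_conj)
  with Suc.prems have "ys @ ws = ws @ ys" "length ws = length ys * q"
    by auto
  with Suc.IH ws show ?case by simp
qed simp

lemma rotate_fixed_concat_replicate:
  assumes "rotate r xs = xs" "length xs = r * Suc q"
  shows "xs = concat (replicate (Suc q) (take r xs))"
proof -
  have "r \<le> length xs" using assms(2) by simp
  then have eq: "drop r xs @ take r xs = xs"
    using assms(1) by (cases "r = length xs") (auto simp: rotate_drop_take)
  have "take r xs @ drop r xs = drop r xs @ take r xs"
    using eq by simp
  moreover have "length (drop r xs) = length (take r xs) * q"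
    using assms(2) by (simp add: min_def)
  ultimately have "drop r xs = concat (replicate q (take r xs))"
    by (rule commuting_append_concat_replicate)
  then show ?thesis
    by (metis append_take_drop_id concat.simps(2) replicate_Suc)
qed

text \<open>Every orbit of \<open>\<sigma>\<close> has length a power of p, and \<open>F\<close> is
  constant on it. Orbits of length at most p^r contribute 0, longer ones a multiple of p^(r+1). The
  induction removes one orbit at a time.\<close>

lemma prime_power_dvd_orbit_sum:
  fixes F :: "'b \<Rightarrow> int" and p :: nat
  assumes "finite X" "prime p"
    and "\<And>x. x \<in> X \<Longrightarrow> \<sigma> x \<in> X"
    and "\<And>x. x \<in> X \<Longrightarrow> (\<sigma> ^^ (p ^ m)) x = x"
    and "\<And>x. x \<in> X \<Longrightarrow> F (\<sigma> x) = F x"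
    and "\<And>x. x \<in> X \<Longrightarrow> (\<sigma> ^^ (p ^ r)) x = x \<Longrightarrow> F x = 0"
  shows "int p ^ Suc r dvd (\<Sum>x\<in>X. F x)"
  using assms
proof (induction X rule: finite_psubset_induct)
  case (psubset X)
  note [simp] = psubset.prems(1)
  show ?case
  proof (cases "X = {}")
    case False
    then obtain x where x: "x \<in> X" by blast
    have iter: "(\<sigma> ^^ i) y \<in> X" if "y \<in> X" for i y
      using that by (induction i) (auto simp: psubset.prems(2))
    have Fiter: "F ((\<sigma> ^^ i) y) = F y" if "y \<in> X" for i y
      by (induction i) (auto simp: psubset.prems(4) iter that)
    have mult: "(\<sigma> ^^ (d * i)) x = x" if "(\<sigma> ^^ d) x = x" for d i
      using that by (induction i) (auto simp: funpow_add)
    define d where "d = (LEAST d. d > 0 \<and> (\<sigma> ^^ d) x = x)"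
    have "p ^ m > 0 \<and> (\<sigma> ^^ (p ^ m)) x = x"
      using psubset.prems(3)[OF x] prime_gt_0_nat[OF psubset.prems(1)] by simp
    then have d: "d > 0 \<and> (\<sigma> ^^ d) x = x"
      unfolding d_def by (rule LeastI)
    have dmin: "d \<le> e" if "e > 0" "(\<sigma> ^^ e) x = x" for e
      unfolding d_def using that by (auto intro: Least_le)
    have mod: "(\<sigma> ^^ e) x = (\<sigma> ^^ (e mod d)) x" for e
    proof -
      have "(\<sigma> ^^ e) x = (\<sigma> ^^ (e mod d + d * (e div d))) x" by simp
      also have "\<dots> = (\<sigma> ^^ (e mod d)) ((\<sigma> ^^ (d * (e div d))) x)"
        by (simp only: funpow_add o_apply)
      finally show ?thesis using mult d by simp
    qed
    have ddvd: "d dvd e" if "(\<sigma> ^^ e) x = x" for e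
      using mod[of e] that dmin[of "e mod d"] d by (metis mod_less_divisor not_le dvd_eq_mod_eq_0 gr0I)
    obtain i where i: "d = p ^ i"
      using ddvd[OF psubset.prems(3)[OF x]] divides_primepow_nat[OF psubset.prems(1)] by blast
    define Orb where "Orb = (\<lambda>i. (\<sigma> ^^ i) x) ` {..<d}"
    have OrbI: "(\<sigma> ^^ e) x \<in> Orb" for e
      unfolding Orb_def using mod[of e] d by auto
    have OX: "Orb \<subseteq> X" unfolding Orb_def using iter x by auto
    have inj: "inj_on (\<lambda>i. (\<sigma> ^^ i) x) {..<d}"
    proof (rule linorder_inj_onI)
      fix a b assume ab: "a < b" "a \<in> {..<d}" "b \<in> {..<d}"
      show "(\<sigma> ^^ a) x \<noteq> (\<sigma> ^^ b) x"
      proof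
        assume "(\<sigma> ^^ a) x = (\<sigma> ^^ b) x"
        then have "(\<sigma> ^^ (d - b)) ((\<sigma> ^^ a) x) = (\<sigma> ^^ (d - b)) ((\<sigma> ^^ b) x)" by simp
        then have "(\<sigma> ^^ (d - b + a)) x = (\<sigma> ^^ (d - b + b)) x"
          by (simp only: funpow_add o_apply)
        then have "d dvd d - b + a" using ab d by (intro ddvd) simp
        then show False using ab by (auto dest!: dvd_imp_le)
      qed
    qed auto
    have "sum F Orb = (\<Sum>i<d. F ((\<sigma> ^^ i) x))"
      unfolding Orb_def using inj by (simp add: sum.reindex)
    also have "\<dots> = int d * F x" using Fiter x by simp
    finally have sumO: "sum F Orb = int d * F x" .
    have "int p ^ Suc r dvd int d * F x"
    proof (cases "i \<le> r")
      case True
      then have "d dvd p ^ r" using i by (simp add: le_imp_power_dvd)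
      then have "(\<sigma> ^^ (p ^ r)) x = x" using mult[of d] d by (elim dvdE) simp
      then show ?thesis using psubset.prems(5)[OF x] by simp
    next
      case False
      then have "int p ^ Suc r dvd int p ^ i" by (intro le_imp_power_dvd) simp
      then show ?thesis using i by simp
    qed
    moreover have "int p ^ Suc r dvd sum F (X - Orb)"
    proof (rule psubset.IH)
      show "X - Orb \<subset> X" using OX OrbI[of 0] by auto
      show "prime p" by simp
      fix y assume y: "y \<in> X - Orb"
      show "\<sigma> y \<in> X - Orb"
      proof
        show "\<sigma> y \<in> X" using y psubset.prems(2) by auto
        show "\<sigma> y \<notin> Orb"
        proof
          assume "\<sigma> y \<in> Orb"
          then obtain j where j: "\<sigma> y = (\<sigma> ^^ j) x" unfolding Orb_def by auto
          \<comment> \<open>The iterate with exponent \<open>p ^ m - 1\<close> inverts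
            \<open>\<sigma>\<close>, so a point mapped into the orbit already lies in it.\<close>
          have "p ^ m = Suc (p ^ m - 1)"
            using prime_gt_0_nat[OF psubset.prems(1)] by simp
          then have "y = (\<sigma> ^^ (p ^ m - 1)) (\<sigma> y)"
            using psubset.prems(3)[of y] y by (metis Diff_iff funpow_simps_right(2) o_apply)
          also have "\<dots> = (\<sigma> ^^ (p ^ m - 1 + j)) x" by (simp add: funpow_add j)
          finally show False using y OrbI by auto
        qed
      qed
    qed (use psubset.prems in auto)
    ultimately have "int p ^ Suc r dvd sum F Orb + sum F (X - Orb)"
      using sumO by simp
    also have "sum F Orb + sum F (X - Orb) = sum F X"
      using OX psubset.hyps by (simp add: sum.subset_diff add.commute)
    finally show ?thesis .
  qed simp
qed

section \<open>Linear functionals on the group ring\<close>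

text \<open>The linear extension of \<open>f\<close>. Group ring identities are proved by testing
  against all such functionals: they separate elements, and \<open>lin_mult\<close> turns a product
  into a nested functional.\<close>

definition lin :: "('a \<Rightarrow> int) \<Rightarrow> ('a \<Rightarrow>\<^sub>0 int) \<Rightarrow> int" where
  "lin f u = (\<Sum>g\<in>Poly_Mapping.keys u. Poly_Mapping.lookup u g * f g)"

lemma lin_superset:
  assumes "finite A" "Poly_Mapping.keys u \<subseteq> A"
  shows "lin f u = (\<Sum>g\<in>A. Poly_Mapping.lookup u g * f g)"
  unfolding lin_def using assms by (intro sum.mono_neutral_left) (auto simp: in_keys_iff)

lemma lin_cong: "(\<And>g. g \<in> Poly_Mapping.keys u \<Longrightarrow> f g = f' g) \<Longrightarrow> lin f u = lin f' u"
  by (simp add: lin_def)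

lemma lin_cong_mod:
  assumes "\<And>g. g \<in> Poly_Mapping.keys u \<Longrightarrow> [f g = f' g] (mod m)"
  shows "[lin f u = lin f' u] (mod m)"
  unfolding lin_def using assms by (intro cong_sum cong_mult cong_refl)

lemma lin_single [simp]: "lin f (Poly_Mapping.single g c) = c * f g"
  by (simp add: lin_def)

lemma lin_zero [simp]: "lin f 0 = 0"
  by (simp add: lin_def)

lemma lin_add: "lin f (u + v) = lin f u + lin f v"
proof -
  have "lin f w = (\<Sum>g\<in>Poly_Mapping.keys u \<union> Poly_Mapping.keys v. Poly_Mapping.lookup w g * f g)"
    if "w \<in> {u, v, u + v}" for w
    using that keys_add[of u v] by (intro lin_superset) auto
  then show ?thesis
    by (simp add: lookup_add algebra_simps sum.distrib)
qed

lemma lin_sum: "lin f (\<Sum>i\<in>I. u i) = (\<Sum>i\<in>I. lin f (u i))"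
  by (induction I rule: infinite_finite_induct) (auto simp: lin_add)

lemma lin_fun_sum: "lin (\<lambda>g. \<Sum>i\<in>I. f i g) u = (\<Sum>i\<in>I. lin (f i) u)"
  unfolding lin_def by (simp add: sum_distrib_left sum.swap[of _ I])

lemma lin_fun_scale: "lin (\<lambda>g. c * f g) u = c * lin f u"
  by (simp add: lin_def sum_distrib_left algebra_simps)

lemma lin_fun_scale_right: "lin (\<lambda>g. f g * c) u = c * lin f u"
  by (simp add: lin_def sum_distrib_left algebra_simps)

lemma lin_of_bool: "lin (\<lambda>g. of_bool (g = a)) u = Poly_Mapping.lookup u a"
  by (cases "a \<in> Poly_Mapping.keys u") (auto simp: lin_def of_bool_def if_distrib in_keys_iff cong: if_cong)

lemma poly_mapping_eq_lin: "(\<And>f. lin f u = lin f v) \<Longrightarrow> u = v"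
  by (rule poly_mapping_eqI) (metis lin_of_bool)

lemma augmentation_lin: "augmentation u = lin (\<lambda>_. 1) u"
  by (simp add: augmentation_def lin_def)

section \<open>The multiplicative monoid of the integral group ring\<close>

locale finite_group = group G for G (structure) +
  assumes finite_carrier: "finite (carrier G)"
begin

abbreviation ZG where "ZG \<equiv> integral_group_ring G"

lemma ZG_carrier: "u \<in> carrier ZG \<longleftrightarrow> Poly_Mapping.keys u \<subseteq> carrier G"
  by (simp add: integral_group_ring_def)

lemma lin_mult:
  "lin f (u \<otimes>\<^bsub>ZG\<^esub> v) = lin (\<lambda>g. lin (\<lambda>h. f (g \<otimes> h)) v) u"
proof -
  have "lin f (u \<otimes>\<^bsub>ZG\<^esub> v) = (\<Sum>g\<in>Poly_Mapping.keys u. \<Sum>h\<in>Poly_Mapping.keys v.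
      Poly_Mapping.lookup u g * Poly_Mapping.lookup v h * f (g \<otimes> h))"
    by (simp add: integral_group_ring_def lin_sum)
  then show ?thesis by (simp add: lin_def sum_distrib_left mult.assoc)
qed

lemma lin_one: "lin f \<one>\<^bsub>ZG\<^esub> = f \<one>"
  by (simp add: integral_group_ring_def)

lemma ZG_mult_closed:
  assumes "u \<in> carrier ZG" "v \<in> carrier ZG"
  shows "u \<otimes>\<^bsub>ZG\<^esub> v \<in> carrier ZG"
proof -
  have "Poly_Mapping.lookup (u \<otimes>\<^bsub>ZG\<^esub> v) a = 0" if "a \<notin> carrier G" for a
  proof -
    have "Poly_Mapping.lookup (u \<otimes>\<^bsub>ZG\<^esub> v) a = lin (\<lambda>g. lin (\<lambda>h. of_bool (g \<otimes> h = a)) v) u"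
      by (simp flip: lin_of_bool add: lin_mult)
    also have "\<dots> = lin (\<lambda>g. lin (\<lambda>h. 0) v) u"
      using assms that by (intro lin_cong) (auto simp: ZG_carrier)
    finally show ?thesis by (simp add: lin_def)
  qed
  then show ?thesis by (auto simp: ZG_carrier in_keys_iff)
qed

lemma monoid_ZG: "Group.monoid ZG"
proof (rule monoidI)
  fix u v w assume uvw: "u \<in> carrier ZG" "v \<in> carrier ZG" "w \<in> carrier ZG"
  show "u \<otimes>\<^bsub>ZG\<^esub> v \<otimes>\<^bsub>ZG\<^esub> w = u \<otimes>\<^bsub>ZG\<^esub> (v \<otimes>\<^bsub>ZG\<^esub> w)"
    using uvw by (intro poly_mapping_eq_lin) (auto simp: lin_mult ZG_carrier subset_iff m_assoc intro!: lin_cong)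
  show "u \<otimes>\<^bsub>ZG\<^esub> v \<in> carrier ZG" using uvw ZG_mult_closed by blast
next
  fix u assume "u \<in> carrier ZG"
  then show "\<one>\<^bsub>ZG\<^esub> \<otimes>\<^bsub>ZG\<^esub> u = u" "u \<otimes>\<^bsub>ZG\<^esub> \<one>\<^bsub>ZG\<^esub> = u"
    by (auto intro!: poly_mapping_eq_lin lin_cong simp: lin_mult lin_one ZG_carrier subset_iff)
qed (simp add: integral_group_ring_def)

sublocale ZG: Group.monoid ZG by (rule monoid_ZG)

section \<open>Powers expanded over words of group elements\<close>

definition words :: "nat \<Rightarrow> 'a list set" where
  "words N = {xs. set xs \<subseteq> carrier G \<and> length xs = N}"

definition word_prod :: "'a list \<Rightarrow> 'a" where
  "word_prod xs = foldr (\<otimes>) xs \<one>"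

definition class_fun :: "('a \<Rightarrow> int) \<Rightarrow> bool" where
  "class_fun f \<longleftrightarrow> (\<forall>g\<in>carrier G. \<forall>h\<in>carrier G. f (g \<otimes> h) = f (h \<otimes> g))"

lemma finite_words: "finite (words N)"
  unfolding words_def by (rule finite_lists_length_eq[OF finite_carrier])

lemma word_prod_closed: "set xs \<subseteq> carrier G \<Longrightarrow> word_prod xs \<in> carrier G"
  by (induction xs) (auto simp: word_prod_def)

lemma word_prod_append:
  "set xs \<subseteq> carrier G \<Longrightarrow> set ys \<subseteq> carrier G \<Longrightarrow> word_prod (xs @ ys) = word_prod xs \<otimes> word_prod ys"
  by (induction xs) (use word_prod_closed in \<open>auto simp: word_prod_def m_assoc\<close>)

lemma word_prod_concat_replicate:
  "set xs \<subseteq> carrier G \<Longrightarrow> word_prod (concat (replicate q xs)) = word_prod xs [^] q"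
proof (induction q)
  case 0
  then show ?case by (simp add: word_prod_def)
next
  case (Suc q)
  have "word_prod (concat (replicate (Suc q) xs)) = word_prod xs \<otimes> word_prod xs [^] q"
    using Suc by (simp, subst word_prod_append) auto
  then show ?case using nat_pow_Suc2 word_prod_closed Suc.prems by metis
qed

lemma class_fun_word_prod_rotate1:
  assumes "class_fun f" "set xs \<subseteq> carrier G"
  shows "f (word_prod (rotate1 xs)) = f (word_prod xs)"
proof (cases xs)
  case (Cons x ys)
  then show ?thesis
    using assms word_prod_closed[of ys] word_prod_append[of ys "[x]"]
    by (auto simp: class_fun_def) (simp add: word_prod_def)
qed simp

text \<open>The noncommutative multinomial expansion. It is proved for all \<open>f\<close> at once
  because the induction step uses the hypothesis for \<open>f\<close> composed with a left
  multiplication.\<close>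

lemma lin_pow:
  assumes "u \<in> carrier ZG"
  shows "lin f (u [^]\<^bsub>ZG\<^esub> N) =
    (\<Sum>xs\<in>words N. prod_list (map (Poly_Mapping.lookup u) xs) * f (word_prod xs))"
proof (induction N arbitrary: f)
  case 0
  have "words 0 = {[]}" by (auto simp: words_def)
  then show ?case by (simp add: lin_one word_prod_def)
next
  case (Suc N)
  have inj: "inj_on (\<lambda>y. snd y # fst y) (words N \<times> carrier G)"
    by (auto simp: inj_on_def)
  have "words (Suc N) = (\<lambda>(xs, x). x # xs) ` (words N \<times> carrier G)"
    unfolding words_def by (rule lists_length_Suc_eq)
  then have "(\<Sum>xs\<in>words (Suc N). prod_list (map (Poly_Mapping.lookup u) xs) * f (word_prod xs))
     = (\<Sum>(xs, x)\<in>words N \<times> carrier G. Poly_Mapping.lookup u x *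
          (prod_list (map (Poly_Mapping.lookup u) xs) * f (x \<otimes> word_prod xs)))"
    by (simp add: sum.reindex[OF inj] o_def case_prod_unfold word_prod_def mult.assoc)
  also have "\<dots> = (\<Sum>x\<in>carrier G. \<Sum>xs\<in>words N. Poly_Mapping.lookup u x *
          (prod_list (map (Poly_Mapping.lookup u) xs) * f (x \<otimes> word_prod xs)))"
    by (simp add: sum.cartesian_product[symmetric] sum.swap[of _ "words N"])
  also have "\<dots> = (\<Sum>x\<in>carrier G. Poly_Mapping.lookup u x * lin (\<lambda>g. f (x \<otimes> g)) (u [^]\<^bsub>ZG\<^esub> N))"
    by (simp add: Suc.IH sum_distrib_left)
  also have "\<dots> = lin f (u \<otimes>\<^bsub>ZG\<^esub> u [^]\<^bsub>ZG\<^esub> N)"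
    using assms by (simp add: lin_mult lin_superset[OF finite_carrier] ZG_carrier)
  also have "u \<otimes>\<^bsub>ZG\<^esub> u [^]\<^bsub>ZG\<^esub> N = u [^]\<^bsub>ZG\<^esub> Suc N"
    using assms by (metis ZG.nat_pow_Suc2)
  finally show ?case by simp
qed

lemma rotate1_words: "xs \<in> words N \<Longrightarrow> rotate1 xs \<in> words N"
  by (simp add: words_def)

lemma prod_list_map_rotate1: "prod_list (map h (rotate1 xs)) = (prod_list (map h xs) :: int)"
  by (cases xs) auto

lemma rotate1_funpow_length: "xs \<in> words N \<Longrightarrow> (rotate1 ^^ N) xs = xs"
  by (metis (mono_tags, lifting) mem_Collect_eq rotate_def rotate_id mod_self words_def)

text \<open>
  Expand \<open>u\<^bsup>p\<^sup>m\<^esup>\<close> over words of length \<open>p\<^sup>m\<close>. Words of period \<open>p\<^bsup>m-k\<^esup>\<close> have products that are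
  \<open>p\<^sup>k\<close>-th powers and contribute nothing; all other rotation orbits have length divisible by
  \<open>p\<^bsup>m-k+1\<^esup>\<close>. Since \<open>u\<^bsup>p\<^sup>m\<^esup> = u\<close> for arbitrarily large \<open>m\<close>, the integer \<open>lin f u\<close> is
  divisible by arbitrarily large powers of \<open>p\<close>.
\<close>

lemma lin_eq_0_of_vanishing_on_powers:
  fixes n p k :: nat
  assumes u: "u \<in> carrier ZG" "u [^]\<^bsub>ZG\<^esub> n = \<one>\<^bsub>ZG\<^esub>" "n > 0"
    and p: "prime p" "coprime p n"
    and f: "class_fun f" "\<And>g. g \<in> carrier G \<Longrightarrow> f (g [^] (p ^ k)) = 0"
  shows "lin f u = 0"
proof -
  have dvd: "int p ^ t dvd lin f u" for t
  proof -
    \<comment> \<open>By Euler's theorem p^m is 1 modulo n, hence u^(p^m) = u; the factor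
      \<open>k + t\<close> makes \<open>m\<close> large enough for divisibility by p^t.\<close>
    define m where "m = totient n * (k + t)"
    have "totient n > 0" using u(3) by simp
    then have "1 \<le> totient n" by linarith
    then have "1 * (k + t) \<le> totient n * (k + t)" by (rule mult_le_mono1)
    then have m: "k + t \<le> m" by (simp only: m_def mult_1)
    have "[(p ^ totient n) ^ (k + t) = 1 ^ (k + t)] (mod n)"
      by (intro cong_pow euler_theorem p)
    then have "[p ^ m = 1] (mod n)" by (simp add: m_def power_mult)
    moreover have "p ^ m \<ge> 1" using prime_gt_0_nat[OF p(1)] by simp
    ultimately obtain c where c: "p ^ m = 1 + n * c"
      by (metis cong_to_1_nat dvdE le_add_diff_inverse)
    have "u [^]\<^bsub>ZG\<^esub> (n * c) = \<one>\<^bsub>ZG\<^esub>"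
      using u by (simp flip: ZG.nat_pow_pow)
    then have "u [^]\<^bsub>ZG\<^esub> (p ^ m) = u"
      using u by (simp add: c flip: ZG.nat_pow_mult)
    then have "lin f u = (\<Sum>xs\<in>words (p ^ m). prod_list (map (Poly_Mapping.lookup u) xs) * f (word_prod xs))"
      using lin_pow[OF u(1)] by metis
    also have "int p ^ Suc (m - k) dvd \<dots>"
    proof (rule prime_power_dvd_orbit_sum[OF finite_words p(1) rotate1_words rotate1_funpow_length])
      fix xs assume xs: "xs \<in> words (p ^ m)"
      show "prod_list (map (Poly_Mapping.lookup u) (rotate1 xs)) * f (word_prod (rotate1 xs))
          = prod_list (map (Poly_Mapping.lookup u) xs) * f (word_prod xs)"
        using class_fun_word_prod_rotate1[OF f(1)] xs by (simp add: prod_list_map_rotate1 words_def)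
      assume "(rotate1 ^^ p ^ (m - k)) xs = xs"
      then have per: "rotate (p ^ (m - k)) xs = xs" by (simp add: rotate_def)
      have pk: "Suc (p ^ k - 1) = p ^ k" using prime_gt_0_nat[OF p(1)] by simp
      have "length xs = p ^ (m - k) * Suc (p ^ k - 1)"
        using xs m by (simp only: pk) (simp add: words_def flip: power_add)
      from rotate_fixed_concat_replicate[OF per this]
      have "xs = concat (replicate (p ^ k) (take (p ^ (m - k)) xs))" by (simp only: pk)
      moreover have "set (take (p ^ (m - k)) xs) \<subseteq> carrier G"
        using xs set_take_subset[of _ xs] by (auto simp: words_def)
      ultimately have "\<exists>g\<in>carrier G. word_prod xs = g [^] (p ^ k)"
        using word_prod_concat_replicate word_prod_closed by metis
      then show "prod_list (map (Poly_Mapping.lookup u) xs) * f (word_prod xs) = 0"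
        using f(2) by auto
    qed
    finally have "int p ^ Suc (m - k) dvd lin f u" .
    moreover have "t \<le> Suc (m - k)" using m by linarith
    ultimately show ?thesis by (meson le_imp_power_dvd dvd_trans)
  qed
  show ?thesis
  proof (rule ccontr)
    assume nz: "lin f u \<noteq> 0"
    define t where "t = nat \<bar>lin f u\<bar>"
    have "\<bar>int p ^ t\<bar> \<le> \<bar>lin f u\<bar>" by (rule dvd_imp_le_int[OF nz dvd])
    moreover have "t < p ^ t" using prime_gt_1_nat[OF p(1)] by (simp add: power_gt_expt)
    then have "int t < int p ^ t" by (metis of_nat_less_iff of_nat_power)
    moreover have "int t = \<bar>lin f u\<bar>" by (simp add: t_def)
    ultimately show False by simp
  qed
qed

lemma fermat_int:
  fixes a :: int assumes "prime (p::nat)"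
  shows "[a ^ p = a] (mod int p)"
proof -
  define b where "b = nat (a mod int p)"
  have p0: "p > 0" using assms by (rule prime_gt_0_nat)
  then have ab: "[a = int b] (mod int p)" by (simp add: b_def cong_def)
  have "[b ^ p = b] (mod p)"
  proof (cases "p dvd b")
    case True
    then have "p dvd b ^ p" using p0 by (simp add: dvd_power_iff dvd_trans[OF _ dvd_power])
    with True show ?thesis by (simp add: cong_def mod_eq_0_iff_dvd)
  next
    case False
    have "[b ^ (p - 1) * b = 1 * b] (mod p)"
      by (intro cong_mult fermat_theorem assms False cong_refl)
    then show ?thesis using p0 by (simp flip: power_Suc2)
  qed
  then have "[int b ^ p = int b] (mod int p)"
    by (simp flip: of_nat_power add: cong_int_iff)
  then show ?thesis using ab by (meson cong_pow cong_sym cong_trans)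
qed

text \<open>Rotation splits the words of length p into orbits of length p and constant words. The
  constant word at x contributes the p-th power of the coefficient at x, which Fermat's theorem
  reduces to the coefficient itself.\<close>

lemma lin_prime_power_cong:
  fixes p :: nat
  assumes u: "u \<in> carrier ZG" and p: "prime p" and f: "class_fun f"
  shows "[lin f (u [^]\<^bsub>ZG\<^esub> p) = lin (\<lambda>g. f (g [^] p)) u] (mod int p)"
proof -
  define F where "F xs = prod_list (map (Poly_Mapping.lookup u) xs) * f (word_prod xs)" for xs
  define C where "C = {xs \<in> words p. rotate1 xs = xs}"
  have C: "C = (\<lambda>x. replicate p x) ` carrier G"
  proof (intro equalityI subsetI)
    fix xs assume xs: "xs \<in> C"
    have "p = Suc (p - 1)" using prime_gt_0_nat[OF p] by simp
    then have "xs = concat (replicate p (take 1 xs))"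
      using xs rotate_fixed_concat_replicate[of 1 xs "p - 1"] by (auto simp: C_def words_def)
    moreover obtain x where "take 1 xs = [x]" "x \<in> carrier G"
      using xs prime_gt_0_nat[OF p] by (cases xs) (auto simp: C_def words_def)
    moreover have "concat (replicate p [x]) = replicate p x" for x
      by (induction p) auto
    ultimately show "xs \<in> (\<lambda>x. replicate p x) ` carrier G" by auto
  next
    fix xs assume "xs \<in> (\<lambda>x. replicate p x) ` carrier G"
    then show "xs \<in> C"
      by (cases p) (auto simp: C_def words_def replicate_append_same)
  qed
  have inj: "inj_on (\<lambda>x. replicate p x) (carrier G)"
    using prime_gt_0_nat[OF p] by (auto simp: inj_on_def replicate_eq_replicate)
  have wp: "word_prod (replicate p x) = x [^] p" if "x \<in> carrier G" for x
  proof -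
    have "concat (replicate p [x]) = replicate p x" by (induction p) auto
    then show ?thesis
      using word_prod_concat_replicate[of "[x]" p] that by (simp add: word_prod_def)
  qed
  \<comment> \<open>Constant words are masked by 0, so that the orbit lemma applies with r =
    0.\<close>
  have "int p ^ Suc 0 dvd (\<Sum>xs\<in>words p. if rotate1 xs = xs then 0 else F xs)"
  proof (rule prime_power_dvd_orbit_sum[OF finite_words p rotate1_words, where m = 1])
    fix xs assume xs: "xs \<in> words p"
    then have "F (rotate1 xs) = F xs"
      using class_fun_word_prod_rotate1[OF f] by (simp add: F_def prod_list_map_rotate1 words_def)
    moreover have "rotate1 (rotate1 xs) = rotate1 xs \<longleftrightarrow> rotate1 xs = xs"
      using injD[OF inj_rotate1] by metis
    ultimately show "(if rotate1 (rotate1 xs) = rotate1 xs then 0 else F (rotate1 xs))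
        = (if rotate1 xs = xs then 0 else F xs)" by simp
  qed (auto simp: rotate1_funpow_length)
  moreover have "(\<Sum>xs\<in>words p. F xs) = (\<Sum>xs\<in>words p. if rotate1 xs = xs then 0 else F xs) + sum F C"
    unfolding C_def sum.inter_filter[OF finite_words] sum.distrib[symmetric] by (intro sum.cong) auto
  ultimately have "[(\<Sum>xs\<in>words p. F xs) = sum F C] (mod int p)"
    by (simp add: cong_iff_dvd_diff)
  moreover have "sum F C = (\<Sum>x\<in>carrier G. Poly_Mapping.lookup u x ^ p * f (x [^] p))"
    unfolding C by (simp add: sum.reindex[OF inj] F_def wp prod_list_replicate map_replicate)
  moreover have "[(\<Sum>x\<in>carrier G. Poly_Mapping.lookup u x ^ p * f (x [^] p))
      = (\<Sum>x\<in>carrier G. Poly_Mapping.lookup u x * f (x [^] p))] (mod int p)"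
    by (intro cong_sum cong_mult fermat_int p cong_refl)
  ultimately show ?thesis
    using u lin_pow[OF u] by (simp add: F_def lin_superset[OF finite_carrier] ZG_carrier cong_trans)
qed

section \<open>The group of normalized units\<close>

abbreviation V where "V \<equiv> normalized_units G"

lemma V_carrier: "u \<in> carrier V \<longleftrightarrow> u \<in> Units ZG \<and> augmentation u = 1"
  by (simp add: normalized_units_def)

lemma V_mult: "u \<otimes>\<^bsub>V\<^esub> v = u \<otimes>\<^bsub>ZG\<^esub> v"
  by (simp add: normalized_units_def units_of_def)

lemma V_one: "\<one>\<^bsub>V\<^esub> = \<one>\<^bsub>ZG\<^esub>"
  by (simp add: normalized_units_def units_of_def)

lemma V_pow: "u [^]\<^bsub>V\<^esub> (n::nat) = u [^]\<^bsub>ZG\<^esub> n"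
  by (simp add: nat_pow_def V_mult V_one)

lemma V_ZG: "u \<in> carrier V \<Longrightarrow> u \<in> carrier ZG"
  by (simp add: V_carrier Units_def)

lemma augmentation_mult: "augmentation (u \<otimes>\<^bsub>ZG\<^esub> v) = augmentation u * augmentation v"
  using lin_fun_scale[of "lin (\<lambda>_. 1) v" "\<lambda>_. 1" u]
  by (simp add: augmentation_lin lin_mult)

lemma augmentation_one: "augmentation \<one>\<^bsub>ZG\<^esub> = 1"
  by (simp add: augmentation_lin lin_one)

lemma group_V: "group V"
proof -
  interpret U: group "units_of ZG" by (rule ZG.units_group)
  have "subgroup {u \<in> Units ZG. augmentation u = 1} (units_of ZG)"
  proof (rule U.subgroupI)
    show "{u \<in> Units ZG. augmentation u = 1} \<noteq> {}"
      using augmentation_one ZG.Units_one_closed by blast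
    fix u assume u: "u \<in> {u \<in> Units ZG. augmentation u = 1}"
    have "augmentation (u \<otimes>\<^bsub>ZG\<^esub> inv\<^bsub>ZG\<^esub> u) = 1"
      using u by (simp add: augmentation_one)
    then show "inv\<^bsub>units_of ZG\<^esub> u \<in> {u \<in> Units ZG. augmentation u = 1}"
      using u by (simp add: ZG.units_of_inv augmentation_mult)
  qed (auto simp: units_of_def augmentation_mult)
  then show ?thesis
    using U.subgroup_imp_group by (simp add: normalized_units_def)
qed

sublocale V: group V by (rule group_V)

definition emb :: "'a \<Rightarrow> 'a \<Rightarrow>\<^sub>0 int" where
  "emb g = Poly_Mapping.single g 1"

lemma emb_mult: "emb g \<otimes>\<^bsub>ZG\<^esub> emb h = emb (g \<otimes> h)"
  by (simp add: emb_def integral_group_ring_def)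

lemma emb_one: "emb \<one> = \<one>\<^bsub>ZG\<^esub>"
  by (simp add: emb_def integral_group_ring_def)

lemma emb_eq_iff: "emb g = emb h \<longleftrightarrow> g = h"
  by (metis emb_def lookup_single_eq lookup_single_not_eq zero_neq_one)

lemma emb_closed: "g \<in> carrier G \<Longrightarrow> emb g \<in> carrier V"
proof -
  assume g: "g \<in> carrier G"
  have ZG: "emb h \<in> carrier ZG" if "h \<in> carrier G" for h
    using that by (simp add: emb_def ZG_carrier)
  have "emb g \<in> Units ZG"
    unfolding Units_def using g
    by (auto intro!: ZG bexI[of _ "emb (inv g)"] simp: emb_mult emb_one)
  then show ?thesis by (simp add: V_carrier augmentation_def emb_def)
qed

lemma emb_pow: "emb g [^]\<^bsub>ZG\<^esub> (n::nat) = emb (g [^] n)"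
  by (induction n) (simp_all add: emb_one emb_mult)

lemma ord_emb:
  assumes "g \<in> carrier G"
  shows "V.ord (emb g) = ord g"
proof -
  have "emb g [^]\<^bsub>V\<^esub> n = \<one>\<^bsub>V\<^esub> \<longleftrightarrow> ord g dvd n" for n :: nat
    using assms by (simp add: V_pow V_one emb_pow emb_eq_iff flip: emb_one pow_eq_id)
  then show ?thesis
    using V.ord_unique[OF emb_closed[OF assms]] by blast
qed

lemma prime_graph_vertices_subset: "prime_graph_vertices G \<subseteq> prime_graph_vertices V"
proof
  fix p assume "p \<in> prime_graph_vertices G"
  then obtain g where "prime p" "g \<in> carrier G" "ord g = p"
    by (auto simp: prime_graph_vertices_def)
  then show "p \<in> prime_graph_vertices V"
    using emb_closed[of g] ord_emb[of g] by (auto simp: prime_graph_vertices_def)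
qed

lemma prime_graph_edges_subset: "prime_graph_edges G \<subseteq> prime_graph_edges V"
proof
  fix E assume "E \<in> prime_graph_edges G"
  then obtain p q g where "E = {p, q}" "p \<in> prime_graph_vertices G" "q \<in> prime_graph_vertices G"
    "p \<noteq> q" "g \<in> carrier G" "ord g = p * q"
    by (auto simp: prime_graph_edges_def)
  then show "E \<in> prime_graph_edges V"
    using emb_closed[of g] ord_emb[of g] subsetD[OF prime_graph_vertices_subset]
    unfolding prime_graph_edges_def
    by (intro CollectI exI[of _ p] exI[of _ q] conjI bexI[of _ "emb g"]) simp_all
qed

end

section \<open>Eigenvalues of torsion units in permutation representations\<close>

definition mat_trace :: "'a::comm_ring_1 mat \<Rightarrow> 'a" where
  "mat_trace A = (\<Sum>i<dim_row A. A $$ (i, i))"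

lemma mat_trace_comm:
  assumes "A \<in> carrier_mat n m" "B \<in> carrier_mat m n"
  shows "mat_trace (A * B) = mat_trace (B * A)"
proof -
  have "mat_trace (A * B) = (\<Sum>i<n. \<Sum>j<m. A $$ (i, j) * B $$ (j, i))"
    using assms by (simp add: mat_trace_def scalar_prod_def atLeast0LessThan)
  also have "\<dots> = (\<Sum>j<m. \<Sum>i<n. B $$ (j, i) * A $$ (i, j))"
    by (subst sum.swap) (simp add: mult.commute)
  also have "\<dots> = mat_trace (B * A)"
    using assms by (simp add: mat_trace_def scalar_prod_def atLeast0LessThan)
  finally show ?thesis .
qed

lemma upper_triangular_pow:
  fixes B :: "'a::comm_ring_1 mat"
  assumes B: "B \<in> carrier_mat d d" and ut: "upper_triangular B"
  shows "(\<forall>i j. j < i \<longrightarrow> i < d \<longrightarrow> (B ^\<^sub>m k) $$ (i, j) = 0) \<and> (\<forall>i<d. (B ^\<^sub>m k) $$ (i, i) = (B $$ (i, i)) ^ k)"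
proof (induction k)
  case (Suc k)
  have Bk: "B ^\<^sub>m k \<in> carrier_mat d d" using B by simp
  have entry: "(B ^\<^sub>m Suc k) $$ (i, j) = (\<Sum>l<d. (B ^\<^sub>m k) $$ (i, l) * B $$ (l, j))" if "i < d" "j < d" for i j
    using B Bk that by (simp add: scalar_prod_def atLeast0LessThan)
  have ut': "B $$ (i, j) = 0" if "j < i" "i < d" for i j
    using ut B that by auto
  have low: "(B ^\<^sub>m k) $$ (i, j) = 0" if "j < i" "i < d" for i j
    using Suc that by blast
  have diag: "(B ^\<^sub>m k) $$ (i, i) = B $$ (i, i) ^ k" if "i < d" for i
    using Suc that by blast
  show ?case
  proof (intro conjI allI impI)
    fix i j assume ij: "j < i" "i < d"
    have "(B ^\<^sub>m k) $$ (i, l) * B $$ (l, j) = 0" if "l < d" for l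
      using low[of l i] ut'[of j l] ij that by (cases "l < i") auto
    then show "(B ^\<^sub>m Suc k) $$ (i, j) = 0"
      using entry[of i j] ij by simp
  next
    fix i assume i: "i < d"
    have "(B ^\<^sub>m k) $$ (i, l) * B $$ (l, i) = 0" if "l < d" "l \<noteq> i" for l
      using low[of l i] ut'[of i l] i that by (cases "l < i") auto
    then have "(\<Sum>l<d. (B ^\<^sub>m k) $$ (i, l) * B $$ (l, i)) = (\<Sum>l\<in>{i}. (B ^\<^sub>m k) $$ (i, l) * B $$ (l, i))"
      using i by (intro sum.mono_neutral_right) auto
    then show "(B ^\<^sub>m Suc k) $$ (i, i) = B $$ (i, i) ^ Suc k"
      using entry[of i i] diag[of i] i by (simp add: mult.commute)
  qed
qed (use B in auto)

text \<open>In characteristic 0 a nonzero strictly upper triangular part survives in all powers: on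
  the nearest superdiagonal where it is nonzero, the k-th power has the entry of \<open>B\<close>
  times k c^(k-1).\<close>

lemma upper_triangular_finite_order_scalar:
  fixes B :: "'a::{field_char_0} mat"
  assumes B: "B \<in> carrier_mat d d" and ut: "upper_triangular B"
    and diag: "\<And>i. i < d \<Longrightarrow> B $$ (i, i) = c"
    and pow: "B ^\<^sub>m n = 1\<^sub>m d" and n: "n > 0"
  shows "B = c \<cdot>\<^sub>m 1\<^sub>m d"
proof -
  have ut': "B $$ (i, j) = 0" if "j < i" "i < d" for i j
    using ut B that by auto
  have zero: "B $$ (i, j) = 0" if "i < j" "j < d" for i j
    using that
  proof (induction "j - i" arbitrary: i j rule: less_induct)
    case less
    \<comment> \<open>The extra factor \<open>c\<close> avoids the truncated exponent
      \<open>k - 1\<close> at \<open>k = 0\<close>.\<close>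
    have pw: "(B ^\<^sub>m k) $$ (i, j) * c = of_nat k * c ^ k * B $$ (i, j)" for k
    proof (induction k)
      case 0
      then show ?case using less B by auto
    next
      case (Suc k)
      have Bk: "B ^\<^sub>m k \<in> carrier_mat d d" using B by simp
      have "(B ^\<^sub>m Suc k) $$ (i, j) = (\<Sum>l<d. (B ^\<^sub>m k) $$ (i, l) * B $$ (l, j))"
        using B Bk less by (simp add: scalar_prod_def atLeast0LessThan)
      also have "\<dots> = (\<Sum>l\<in>{i, j}. (B ^\<^sub>m k) $$ (i, l) * B $$ (l, j))"
      proof (rule sum.mono_neutral_right)
        show "\<forall>l\<in>{..<d} - {i, j}. (B ^\<^sub>m k) $$ (i, l) * B $$ (l, j) = 0"
        proof
          fix l assume l: "l \<in> {..<d} - {i, j}"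
          then consider "l < i" | "j < l" | "i < l" "l < j" by fastforce
          then show "(B ^\<^sub>m k) $$ (i, l) * B $$ (l, j) = 0"
          proof cases
            case 1
            then show ?thesis using upper_triangular_pow[OF B ut, of k] less by auto
          next
            case 2
            then show ?thesis using ut' l by auto
          next
            case 3
            then show ?thesis using less l by auto
          qed
        qed
      qed (use less in auto)
      also have "\<dots> = c ^ k * B $$ (i, j) + (B ^\<^sub>m k) $$ (i, j) * c"
        using less upper_triangular_pow[OF B ut, of k] diag by auto
      finally show ?case using Suc by (simp add: algebra_simps)
    qed
    have "d > 0" using less by simp
    then have "c ^ n = 1"
      using upper_triangular_pow[OF B ut, of n] pow diag by auto
    then show ?case using pw[of n] pow n less by auto
  qed
  show ?thesis
  proof (rule eq_matI)
    fix i j assume "i < dim_row (c \<cdot>\<^sub>m 1\<^sub>m d)" "j < dim_col (c \<cdot>\<^sub>m 1\<^sub>m d)"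
    then show "B $$ (i, j) = (c \<cdot>\<^sub>m 1\<^sub>m d) $$ (i, j)"
      using zero[of i j] ut'[of j i] diag by (cases i j rule: linorder_cases) auto
  qed (use B in auto)
qed

text \<open>A Schur form takes the place of a diagonalization: traces of powers are read off the
  diagonal, and finite order makes a triangular matrix with a single eigenvalue scalar. The last
  clause serves the equality case in Berman--Higman.\<close>

lemma finite_order_eigenvalues:
  fixes A :: "complex mat"
  assumes A: "A \<in> carrier_mat d d" and pow: "A ^\<^sub>m n = 1\<^sub>m d" and n: "n > 0"
  obtains es where "length es = d" "\<And>e. e \<in> set es \<Longrightarrow> e ^ n = 1"
    "\<And>k. mat_trace (A ^\<^sub>m k) = (\<Sum>e\<leftarrow>es. e ^ k)"
    "\<And>c. (\<forall>e\<in>set es. e = c) \<Longrightarrow> A = c \<cdot>\<^sub>m 1\<^sub>m d"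
proof -
  obtain es where es: "char_poly A = (\<Prod>a\<leftarrow>es. [:- a, 1:])"
    using char_poly_factorized[OF A] by blast
  obtain B P Q where BPQ: "schur_decomposition A es = (B, P, Q)"
    by (cases "schur_decomposition A es")
  have wit: "similar_mat_wit A B P Q" and ut: "upper_triangular B" and diag: "diag_mat B = es"
    using schur_decomposition[OF A es BPQ] by auto
  have B: "B \<in> carrier_mat d d" and P: "P \<in> carrier_mat d d" and Q: "Q \<in> carrier_mat d d"
    and PQ: "P * Q = 1\<^sub>m d" and QP: "Q * P = 1\<^sub>m d" and APBQ: "A = P * B * Q"
    using similar_mat_witD2[OF A wit] by auto
  have Apow: "A ^\<^sub>m k = P * B ^\<^sub>m k * Q" for k
    by (rule similar_mat_wit_pow_id[OF wit])
  have BA: "B ^\<^sub>m k = Q * A ^\<^sub>m k * P" for k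
    by (rule similar_mat_wit_pow_id[OF similar_mat_wit_sym[OF wit]])
  have Bn: "B ^\<^sub>m n = 1\<^sub>m d" using BA[of n] pow Q QP by simp
  have es_nth: "es = map (\<lambda>i. B $$ (i, i)) [0..<d]"
    using diag B by (simp add: diag_mat_def)
  show thesis
  proof (rule that[of es])
    show "length es = d" by (simp add: es_nth)
    show "e ^ n = 1" if "e \<in> set es" for e
      using that upper_triangular_pow[OF B ut, of n] Bn by (auto simp: es_nth)
    show "mat_trace (A ^\<^sub>m k) = (\<Sum>e\<leftarrow>es. e ^ k)" for k
    proof -
      have Bk: "B ^\<^sub>m k \<in> carrier_mat d d" using B by simp
      have "mat_trace (A ^\<^sub>m k) = mat_trace (Q * (P * B ^\<^sub>m k))"
        unfolding Apow using P Bk Q by (intro mat_trace_comm) auto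
      also have "Q * (P * B ^\<^sub>m k) = B ^\<^sub>m k"
        using assoc_mult_mat[OF Q P Bk] QP left_mult_one_mat[OF Bk] by simp
      also have "mat_trace (B ^\<^sub>m k) = (\<Sum>i<d. (B $$ (i, i)) ^ k)"
        using upper_triangular_pow[OF B ut, of k] B by (simp add: mat_trace_def)
      finally show ?thesis
        by (simp add: es_nth o_def interv_sum_list_conv_sum_set_nat atLeast0LessThan)
    qed
    show "A = c \<cdot>\<^sub>m 1\<^sub>m d" if "\<forall>e\<in>set es. e = c" for c
    proof -
      have "B = c \<cdot>\<^sub>m 1\<^sub>m d"
        using that by (intro upper_triangular_finite_order_scalar[OF B ut _ Bn n]) (auto simp: es_nth)
      then show ?thesis
        using APBQ PQ mult_smult_distrib[OF P one_carrier_mat, of c] right_mult_one_mat[OF P]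
          mult_smult_assoc_mat[OF P Q, of c] by simp
    qed
  qed
qed

lemma sum_powers_root_of_unity:
  fixes z :: complex
  assumes "z ^ q = 1" "q > 0"
  shows "(\<Sum>j<q. z ^ j) = (if z = 1 then of_nat q else 0)"
  using assms by (simp add: sum_gp_strict)

text \<open>For each \<open>e\<close> the power e^m is a q-th root of unity, so its powers sum to q
  or to 0 according to whether it is 1.\<close>

lemma count_roots_of_unity:
  fixes es :: "complex list"
  assumes "\<And>e. e \<in> set es \<Longrightarrow> e ^ (m * q) = 1" "q > 0"
  shows "(\<Sum>j<q. \<Sum>e\<leftarrow>es. e ^ (m * j)) = of_nat (q * length (filter (\<lambda>e. e ^ m = 1) es))"
  using assms(1)
proof (induction es)
  case (Cons e es)
  have "(\<Sum>j<q. e ^ (m * j)) = (if e ^ m = 1 then of_nat q else 0)"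
    using sum_powers_root_of_unity[of "e ^ m" q] Cons.prems assms(2) by (simp add: power_mult)
  then show ?case using Cons by (simp add: sum.distrib algebra_simps)
qed simp

lemma norm_root_of_unity: "(e::complex) ^ n = 1 \<Longrightarrow> n > 0 \<Longrightarrow> norm e = 1"
  by (metis norm_one norm_power norm_ge_zero power_eq_imp_eq_base power_one zero_le_one)

text \<open>The equality case of the triangle inequality: after multiplication by the conjugate of
  \<open>c\<close> all real parts are at most 1 and their average is 1.\<close>

lemma roots_of_unity_sum_extremal:
  fixes es :: "complex list" and c :: complex
  assumes "\<And>e. e \<in> set es \<Longrightarrow> norm e = 1" and "norm c = 1"
    and "(\<Sum>e\<leftarrow>es. e) = of_nat (length es) * c" and "e \<in> set es"
  shows "e = c"
proof -
  have "(\<Sum>e\<leftarrow>es. e * cnj c) = (\<Sum>e\<leftarrow>es. e) * cnj c"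
    by (induction es) (auto simp: algebra_simps)
  also have "\<dots> = of_nat (length es)"
    using assms(2,3) by (simp add: complex_norm_square[symmetric])
  finally have "(\<Sum>e\<leftarrow>es. Re (e * cnj c)) = real (length es)"
  proof -
    assume h: "(\<Sum>e\<leftarrow>es. e * cnj c) = of_nat (length es)"
    have "(\<Sum>e\<leftarrow>es. Re (e * cnj c)) = Re (\<Sum>e\<leftarrow>es. e * cnj c)"
      by (induction es) auto
    then show ?thesis using h by simp
  qed
  then have z: "(\<Sum>e\<leftarrow>es. 1 - Re (e * cnj c)) = 0"
    by (simp add: sum_list_subtractf sum_list_triv)
  have le: "Re (e * cnj c) \<le> 1" if "e \<in> set es" for e
    using complex_Re_le_cmod[of "e * cnj c"] assms(1)[OF that] assms(2) by (simp add: norm_mult)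
  have "1 - Re (e * cnj c) = 0"
    using z le assms(4) by (subst (asm) sum_list_nonneg_eq_0_iff) auto
  moreover have "norm (e * cnj c) = 1" using assms by (simp add: norm_mult)
  then have "(Re (e * cnj c))\<^sup>2 + (Im (e * cnj c))\<^sup>2 = 1"
    by (simp add: cmod_def)
  ultimately have "e * cnj c = 1" by (simp add: complex_eq_iff)
  moreover have "c * cnj c = 1" using assms(2) by (simp add: complex_norm_square[symmetric])
  ultimately have "e * (c * cnj c) = c" by (metis mult.assoc mult.commute mult_1)
  then show ?thesis using \<open>c * cnj c = 1\<close> by simp
qed

section \<open>Permutation representations of the group ring\<close>

locale perm_rep = finite_group +
  fixes d :: nat and act :: "'a \<Rightarrow> nat \<Rightarrow> nat"
  assumes act_lt: "g \<in> carrier G \<Longrightarrow> i < d \<Longrightarrow> act g i < d"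
    and act_mult: "g \<in> carrier G \<Longrightarrow> h \<in> carrier G \<Longrightarrow> i < d \<Longrightarrow> act (g \<otimes> h) i = act g (act h i)"
    and act_one: "i < d \<Longrightarrow> act \<one> i = i"
begin

definition rho :: "('a \<Rightarrow>\<^sub>0 int) \<Rightarrow> complex mat" where
  "rho u = mat d d (\<lambda>(i, j). of_int (lin (\<lambda>g. of_bool (act g j = i)) u))"

definition fix_count :: "'a \<Rightarrow> int" where
  "fix_count g = int (card {i. i < d \<and> act g i = i})"

lemma rho_carrier [simp]: "rho u \<in> carrier_mat d d"
  by (simp add: rho_def)

lemma rho_mult:
  assumes "u \<in> carrier ZG" "v \<in> carrier ZG"
  shows "rho (u \<otimes>\<^bsub>ZG\<^esub> v) = rho u * rho v"
proof (rule eq_matI)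
  fix i j assume "i < dim_row (rho u * rho v)" "j < dim_col (rho u * rho v)"
  then have ij: "i < d" "j < d" by (auto simp: rho_def)
  have "lin (\<lambda>g. of_bool (act g j = i)) (u \<otimes>\<^bsub>ZG\<^esub> v)
      = lin (\<lambda>g. lin (\<lambda>h. \<Sum>k<d. of_bool (act g k = i) * of_bool (act h j = k)) v) u"
    unfolding lin_mult
  proof (intro lin_cong)
    fix g h assume "g \<in> Poly_Mapping.keys u" "h \<in> Poly_Mapping.keys v"
    then have gh: "g \<in> carrier G" "h \<in> carrier G" using assms by (auto simp: ZG_carrier)
    have "(\<Sum>k<d. of_bool (act g k = i) * of_bool (act h j = k))
        = (\<Sum>k\<in>{act h j}. of_bool (act g k = i) * of_bool (act h j = k) :: int)"
      using act_lt[OF gh(2) ij(2)] by (intro sum.mono_neutral_right) auto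
    then show "of_bool (act (g \<otimes> h) j = i) = (\<Sum>k<d. of_bool (act g k = i) * of_bool (act h j = k) :: int)"
      using act_mult[OF gh ij(2)] by simp
  qed
  also have "\<dots> = (\<Sum>k<d. lin (\<lambda>h. of_bool (act h j = k)) v * lin (\<lambda>g. of_bool (act g k = i)) u)"
    by (simp only: lin_fun_sum lin_fun_scale lin_fun_scale_right)
  finally show "rho (u \<otimes>\<^bsub>ZG\<^esub> v) $$ (i, j) = (rho u * rho v) $$ (i, j)"
    using ij by (simp add: rho_def scalar_prod_def atLeast0LessThan mult.commute)
qed (auto simp: rho_def)

lemma rho_one: "rho \<one>\<^bsub>ZG\<^esub> = 1\<^sub>m d"
  by (rule eq_matI) (auto simp: rho_def lin_one act_one)

lemma rho_pow: "u \<in> carrier ZG \<Longrightarrow> rho (u [^]\<^bsub>ZG\<^esub> k) = rho u ^\<^sub>m k"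
proof (induction k)
  case 0
  have "dim_row (rho u) = d" by (simp add: rho_def)
  then show ?case by (simp add: rho_one)
next
  case (Suc k)
  then show ?case by (simp add: rho_mult)
qed

lemma trace_rho: "mat_trace (rho u) = of_int (lin fix_count u)"
proof -
  have "fix_count = (\<lambda>g. \<Sum>i<d. of_bool (act g i = i))"
    by (simp add: fix_count_def fun_eq_iff of_bool_def sum.If_cases lessThan_def Collect_conj_eq)
  then have "lin fix_count u = (\<Sum>i<d. lin (\<lambda>g. of_bool (act g i = i)) u)"
    by (simp only: lin_fun_sum)
  then show ?thesis by (simp add: mat_trace_def rho_def)
qed

lemma torsion_eigenvalues:
  fixes n :: nat
  assumes u: "u \<in> carrier ZG" "u [^]\<^bsub>ZG\<^esub> n = \<one>\<^bsub>ZG\<^esub>" "n > 0"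
  obtains es where "length es = d" "\<And>e. e \<in> set es \<Longrightarrow> e ^ n = 1"
    "\<And>k. of_int (lin fix_count (u [^]\<^bsub>ZG\<^esub> k)) = (\<Sum>e\<leftarrow>es. e ^ k)"
    "\<And>c. (\<forall>e\<in>set es. e = c) \<Longrightarrow> rho u = c \<cdot>\<^sub>m 1\<^sub>m d"
proof -
  have "rho u ^\<^sub>m n = 1\<^sub>m d" using u by (metis rho_one rho_pow)
  from finite_order_eigenvalues[OF rho_carrier this u(3)] obtain es :: "complex list" where
    "length es = d" "\<And>e. e \<in> set es \<Longrightarrow> e ^ n = 1"
    "\<And>k. mat_trace (rho u ^\<^sub>m k) = (\<Sum>e\<leftarrow>es. e ^ k)"
    "\<And>c. (\<forall>e\<in>set es. e = c) \<Longrightarrow> rho u = c \<cdot>\<^sub>m 1\<^sub>m d" by metis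
  then show thesis
    using that[of es] u(1) by (simp add: rho_pow flip: trace_rho)
qed

lemma abs_lin_fix_count_le:
  fixes n :: nat
  assumes u: "u \<in> carrier ZG" "u [^]\<^bsub>ZG\<^esub> n = \<one>\<^bsub>ZG\<^esub>" "n > 0"
  shows "\<bar>lin fix_count u\<bar> \<le> int d"
proof -
  obtain es :: "complex list" where es: "length es = d" "\<And>e. e \<in> set es \<Longrightarrow> e ^ n = 1"
    "\<And>k. of_int (lin fix_count (u [^]\<^bsub>ZG\<^esub> k)) = (\<Sum>e\<leftarrow>es. e ^ k)"
    using torsion_eigenvalues[OF u] by metis
  have "norm (\<Sum>e\<leftarrow>es. e) \<le> (\<Sum>e\<leftarrow>es. norm e)"
    by (induction es) (auto intro: order_trans[OF norm_triangle_ineq])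
  also have "\<dots> = (\<Sum>e\<leftarrow>es. 1)"
    using es(2) norm_root_of_unity u(3) by (intro arg_cong[of _ _ sum_list] map_cong) auto
  also have "\<dots> = real d" using es(1) by (simp add: sum_list_triv)
  finally have "norm (of_int (lin fix_count u) :: complex) \<le> real d"
    using es(3)[of 1] u(1) by simp
  then show ?thesis by simp
qed

text \<open>
  The number of eigenvalues \<open>e\<close> of \<open>u\<close> with \<open>e\<^sup>m = 1\<close> is the average of the traces of the powers
  of \<open>u\<^sup>m\<close>.
\<close>

lemma eigenvalue_counts:
  fixes n :: nat
  assumes u: "u \<in> carrier ZG" "u [^]\<^bsub>ZG\<^esub> n = \<one>\<^bsub>ZG\<^esub>" "n > 0"
  obtains c :: "nat \<Rightarrow> nat" where
    "\<And>m q. n = m * q \<Longrightarrow> int (q * c m) = (\<Sum>j<q. lin fix_count (u [^]\<^bsub>ZG\<^esub> (m * j)))"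
    "\<And>m m'. m dvd m' \<Longrightarrow> c m \<le> c m'"
proof -
  obtain es :: "complex list" where es: "length es = d" "\<And>e. e \<in> set es \<Longrightarrow> e ^ n = 1"
    "\<And>k. of_int (lin fix_count (u [^]\<^bsub>ZG\<^esub> k)) = (\<Sum>e\<leftarrow>es. e ^ k)"
    using torsion_eigenvalues[OF u] by metis
  show thesis
  proof (rule that[of "\<lambda>m. length (filter (\<lambda>e. e ^ m = 1) es)"])
    fix m q assume n: "n = m * q"
    then have "q > 0" using u(3) by (cases q) auto
    then have "(\<Sum>j<q. \<Sum>e\<leftarrow>es. e ^ (m * j)) = of_nat (q * length (filter (\<lambda>e. e ^ m = 1) es))"
      using es(2) n by (intro count_roots_of_unity) auto
    then have "complex_of_int (\<Sum>j<q. lin fix_count (u [^]\<^bsub>ZG\<^esub> (m * j)))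
        = complex_of_int (int (q * length (filter (\<lambda>e. e ^ m = 1) es)))"
      by (simp add: es(3))
    then show "int (q * length (filter (\<lambda>e. e ^ m = 1) es)) = (\<Sum>j<q. lin fix_count (u [^]\<^bsub>ZG\<^esub> (m * j)))"
      by (simp only: of_int_eq_iff)
  next
    fix m m' :: nat assume "m dvd m'"
    then have "e ^ m' = 1" if "e ^ m = 1" for e :: complex
      using that by (auto simp: power_mult)
    then show "length (filter (\<lambda>e. e ^ m = 1) es) \<le> length (filter (\<lambda>e. e ^ m' = 1) es)"
      by (induction es) auto
  qed
qed

end

text \<open>Berman--Higman.\<close>

lemma (in finite_group) torsion_unit_coeff_one:
  fixes n :: nat
  assumes u: "u \<in> carrier V" "u [^]\<^bsub>ZG\<^esub> n = \<one>\<^bsub>ZG\<^esub>" "n > 0" and ne: "u \<noteq> \<one>\<^bsub>ZG\<^esub>"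
  shows "Poly_Mapping.lookup u \<one> = 0"
proof (rule ccontr)
  assume nz: "Poly_Mapping.lookup u \<one> \<noteq> 0"
  define d where "d = card (carrier G)"
  obtain h where h: "bij_betw h {0..<d} (carrier G)"
    using ex_bij_betw_nat_finite[OF finite_carrier] d_def by auto
  define k where "k = the_inv_into {0..<d} h"
  have hk: "h (k a) = a" "k a < d" if "a \<in> carrier G" for a
    using that h f_the_inv_into_f_bij_betw[OF h] bij_betw_the_inv_into[OF h]
    by (auto simp: k_def bij_betw_def)
  have kh: "k (h i) = i" "h i \<in> carrier G" if "i < d" for i
    using that h by (auto simp: k_def the_inv_into_f_f bij_betw_def)
  \<comment> \<open>The left regular representation, with group elements numbered by
    \<open>h\<close>. Only the identity has fixed points, so the trace of u is \<open>d\<close>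
    times its coefficient at the identity.\<close>
  define act where "act g i = k (g \<otimes> h i)" for g i
  interpret perm_rep G d act
    by unfold_locales (auto simp: act_def hk kh m_assoc)
  have dpos: "d > 0" using finite_carrier by (auto simp: d_def card_gt_0_iff)
  have fc: "fix_count g = int d * of_bool (g = \<one>)" if g: "g \<in> carrier G" for g
  proof (cases "g = \<one>")
    case True
    then have "{i. i < d \<and> act g i = i} = {..<d}" by (auto simp: act_def kh)
    then show ?thesis using True by (simp add: fix_count_def)
  next
    case False
    have "act g i \<noteq> i" if "i < d" for i
    proof
      assume "act g i = i"
      then have "g \<otimes> h i = h i" using hk(1)[of "g \<otimes> h i"] g kh[OF that] by (simp add: act_def)
      then show False using False g kh[OF that] by (simp add: r_cancel_one')
    qed
    then have "{i. i < d \<and> act g i = i} = {}" by auto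
    then show ?thesis using False by (simp only: fix_count_def) simp
  qed
  have uZ: "u \<in> carrier ZG" using u(1) by (rule V_ZG)
  have lf: "lin fix_count u = int d * Poly_Mapping.lookup u \<one>"
  proof -
    have "lin fix_count u = lin (\<lambda>g. int d * of_bool (g = \<one>)) u"
      using uZ fc by (intro lin_cong) (auto simp: ZG_carrier)
    then show ?thesis by (simp only: lin_fun_scale lin_of_bool)
  qed
  \<comment> \<open>The trace is at most \<open>d\<close> in absolute value, so a nonzero
    coefficient is 1 or -1; the bound is then attained and all eigenvalues coincide.\<close>
  then have "\<bar>Poly_Mapping.lookup u \<one>\<bar> \<le> 1"
    using abs_lin_fix_count_le[OF uZ u(2,3)] dpos by (simp add: abs_mult)
  then have abs1: "\<bar>Poly_Mapping.lookup u \<one>\<bar> = 1" using nz by linarith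
  define c :: complex where "c = of_int (Poly_Mapping.lookup u \<one>)"
  have nc: "norm c = 1" using abs1 by (simp add: c_def flip: of_int_abs)
  obtain es :: "complex list" where es: "length es = d" "\<And>e. e \<in> set es \<Longrightarrow> e ^ n = 1"
    "\<And>k. of_int (lin fix_count (u [^]\<^bsub>ZG\<^esub> k)) = (\<Sum>e\<leftarrow>es. e ^ k)"
    "\<And>c. (\<forall>e\<in>set es. e = c) \<Longrightarrow> rho u = c \<cdot>\<^sub>m 1\<^sub>m d"
    using torsion_eigenvalues[OF uZ u(2,3)] by metis
  have "(\<Sum>e\<leftarrow>es. e) = of_nat (length es) * c"
    using es(3)[of 1] uZ lf es(1) by (simp add: c_def)
  then have "\<forall>e\<in>set es. e = c"
    using roots_of_unity_sum_extremal[of es c] es(2) norm_root_of_unity u(3) nc by metis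
  then have rho: "rho u = c \<cdot>\<^sub>m 1\<^sub>m d" by (rule es(4))
  \<comment> \<open>The column of \<open>rho u\<close> at the identity lists the coefficients of u,
    and a scalar matrix vanishes off the diagonal.\<close>
  have zero: "Poly_Mapping.lookup u a = 0" if a: "a \<in> carrier G" "a \<noteq> \<one>" for a
  proof -
    have "rho u $$ (k a, k \<one>) = 0"
      using rho a hk[OF a(1)] hk[of \<one>] by auto
    then have "lin (\<lambda>g. of_bool (act g (k \<one>) = k a)) u = 0"
      using hk[OF a(1)] hk[of \<one>] by (simp add: rho_def)
    moreover have "lin (\<lambda>g. of_bool (act g (k \<one>) = k a)) u = lin (\<lambda>g. of_bool (g = a)) u"
    proof (rule lin_cong)
      fix g assume "g \<in> Poly_Mapping.keys u"
      then have "g \<in> carrier G" using uZ by (auto simp: ZG_carrier)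
      then have "act g (k \<one>) = k g" "h (k g) = g"
        using hk(1) by (simp_all add: act_def)
      then have "act g (k \<one>) = k a \<longleftrightarrow> g = a"
        using hk(1)[OF a(1)] by metis
      then show "of_bool (act g (k \<one>) = k a) = (of_bool (g = a) :: int)" by simp
    qed
    ultimately show ?thesis by (simp add: lin_of_bool)
  qed
  have "u = Poly_Mapping.single \<one> (Poly_Mapping.lookup u \<one>)"
  proof (rule poly_mapping_eqI)
    fix a
    show "Poly_Mapping.lookup u a = Poly_Mapping.lookup (Poly_Mapping.single \<one> (Poly_Mapping.lookup u \<one>)) a"
      using zero[of a] uZ by (cases "a \<in> carrier G") (auto simp: lookup_single when_def ZG_carrier in_keys_iff)
  qed
  moreover have "augmentation u = 1" using u(1) by (simp add: V_carrier)
  ultimately have "u = Poly_Mapping.single \<one> 1"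
    by (metis augmentation_lin lin_single mult.right_neutral)
  then show False using ne emb_one by (simp add: emb_def)
qed

lemma (in finite_group) prime_graph_vertices_V: "prime_graph_vertices V \<subseteq> prime_graph_vertices G"
proof
  fix p assume "p \<in> prime_graph_vertices V"
  then obtain u where p: "prime p" and u: "u \<in> carrier V" "V.ord u = p"
    by (auto simp: prime_graph_vertices_def)
  have up: "u [^]\<^bsub>ZG\<^esub> p = \<one>\<^bsub>ZG\<^esub>" using V.pow_ord_eq_1[OF u(1)] u(2) by (simp add: V_pow V_one)
  have ne: "u \<noteq> \<one>\<^bsub>ZG\<^esub>" using V.ord_eq_1[OF u(1)] u(2) p by (auto simp: V_one)
  show "p \<in> prime_graph_vertices G"
  proof (rule ccontr)
    assume no: "p \<notin> prime_graph_vertices G"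
    have gp: "g = \<one>" if "g \<in> carrier G" "g [^] p = \<one>" for g
    proof -
      have "ord g dvd p" using that by (simp flip: pow_eq_id)
      then have "ord g = 1" using no p that(1) by (auto simp: prime_graph_vertices_def prime_nat_iff)
      then show ?thesis using that(1) ord_eq_1 by simp
    qed
    define f where "f g = (of_bool (g = \<one>) :: int)" for g
    have cf: "class_fun f"
    proof -
      have "g \<otimes> h = \<one> \<longleftrightarrow> h \<otimes> g = \<one>" if "g \<in> carrier G" "h \<in> carrier G" for g h
        using that inv_comm by blast
      then show ?thesis unfolding class_fun_def f_def by auto
    qed
    have "lin f (u [^]\<^bsub>ZG\<^esub> p) = 1" using up by (simp add: lin_one f_def)
    \<comment> \<open>Only the identity has trivial p-th power, so the congruence compares 1 with
      the coefficient of u at the identity.\<close>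
    moreover have "lin (\<lambda>g. f (g [^] p)) u = lin f u"
      using V_ZG[OF u(1)] gp by (intro lin_cong) (auto simp: f_def ZG_carrier subset_iff nat_pow_one)
    moreover have "lin f u = 0"
      using torsion_unit_coeff_one[OF u(1) up _ ne] p by (simp add: f_def[abs_def] lin_of_bool prime_gt_0_nat)
    ultimately have "[1 = 0] (mod int p)"
      using lin_prime_power_cong[OF V_ZG[OF u(1)] p cf] by simp
    then show False using prime_gt_1_nat[OF p] by (simp add: cong_def zmod_trivial_iff)
  qed
qed

section \<open>A vanishing trace for involutions\<close>

text \<open>
  Write \<open>s\<close> for conjugation by \<open>X\<close>. Modulo 2 the element \<open>T\<close> below is the trace of \<open>k0 * c\<close> over the
  group of order 8 generated by \<open>s\<close>, where \<open>c\<close> is fixed by \<open>s\<^sup>2\<close> and \<open>c + s c = 1\<close>; hence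
  \<open>T = 1\<close> modulo 2. The signs make \<open>X\<close> anticommute with \<open>T\<close>, so that \<open>T\<^sup>n X\<close> has trace zero for
  \<open>n > 0\<close>, while \<open>T\<^sup>n\<close> is 2-adically close to 1 for \<open>n = 2\<^sup>m\<close>.
\<close>

lemma trace_eq_0_of_relative_trace_one:
  fixes X Y k0 :: "'r::ring_1" and tr :: "'r \<Rightarrow> int"
  assumes tr_add: "\<And>a b. tr (a + b) = tr a + tr b" and tr_comm: "\<And>a b. tr (a * b) = tr (b * a)"
    and XY: "X * Y = 1" and YX: "Y * X = 1" and X8: "X ^ 8 = 1"
    and k0: "k0 + X ^ 2 * k0 * Y ^ 2 + X ^ 4 * k0 * Y ^ 4 + X ^ 6 * k0 * Y ^ 6 = 1"
  shows "tr X = 0"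
proof -
  define s where "s n z = X ^ n * z * Y ^ n" for n z
  have YnXn: "Y ^ n * X ^ n = 1" for n
  proof (induction n)
    case (Suc n)
    have "Y ^ Suc n * X ^ Suc n = Y ^ n * (Y * X) * X ^ n"
      by (simp only: power_Suc2[of Y] power_Suc[of X] mult.assoc)
    then show ?case using Suc YX by simp
  qed simp
  have XnYn: "X ^ n * Y ^ n = 1" for n
  proof (induction n)
    case (Suc n)
    have "X ^ Suc n * Y ^ Suc n = X ^ n * (X * Y) * Y ^ n"
      by (simp only: power_Suc2[of X] power_Suc[of Y] mult.assoc)
    then show ?case using Suc XY by simp
  qed simp
  have Y8: "Y ^ 8 = 1" using YnXn[of 8] X8 by simp
  have s_add: "s n (a + b) = s n a + s n b" for n a b by (simp add: s_def algebra_simps)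
  have s_minus: "s n (- a) = - s n a" for n a by (simp add: s_def)
  have s_diff: "s n (a - b) = s n a - s n b" for n a b by (simp add: s_def algebra_simps)
  have s_mult: "s n (a * b) = s n a * s n b" for n a b
  proof -
    have "s n a * s n b = X ^ n * a * (Y ^ n * X ^ n) * b * Y ^ n"
      by (simp only: s_def mult.assoc)
    then show ?thesis by (simp add: YnXn s_def mult.assoc)
  qed
  have s_s: "s m (s n z) = s (m + n) z" for m n z
    by (simp add: s_def power_add mult.assoc) (metis power_add add.commute mult.assoc)
  have s8: "s 8 z = z" for z by (simp add: s_def X8 Y8)
  have s_one: "s n 1 = 1" for n by (simp add: s_def XnYn)
  define k1 k2 k3 k4 k5 k6 k7 where "k1 = s 1 k0" and "k2 = s 2 k0" and "k3 = s 3 k0"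
    and "k4 = s 4 k0" and "k5 = s 5 k0" and "k6 = s 6 k0" and "k7 = s 7 k0"
  note kd = k1_def k2_def k3_def k4_def k5_def k6_def k7_def
  have sk: "s 1 k0 = k1" "s 1 k1 = k2" "s 1 k2 = k3" "s 1 k3 = k4" "s 1 k4 = k5" "s 1 k5 = k6"
    "s 1 k6 = k7" "s 1 k7 = k0"
    unfolding kd s_s by (simp_all add: s8 del: One_nat_def)
  have ev: "k0 + k2 + k4 + k6 = 1" using k0 by (simp add: kd s_def)
  have "s 1 (k0 + k2 + k4 + k6) = 1" by (simp only: ev s_one)
  then have od: "k1 + k3 + k5 + k7 = 1" by (simp only: s_add sk)
  \<comment> \<open>\<open>c\<close> is (1 + s)(1 + s^4) applied to \<open>k0\<close>. Over the
    integers c + s c = 1 + 2 (k1 + k5) and s^2 c = 2 - c.\<close>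
  define c c1 where "c = k0 + k1 + k4 + k5" and "c1 = k1 + k2 + k5 + k6"
  have sc: "s 1 c = c1" by (simp only: c_def c1_def s_add sk)
  have "c1 = 2 * (k1 + k5) + 1 - c"
  proof -
    have "c + c1 = (k0 + k2 + k4 + k6) + 2 * (k1 + k5)"
      by (simp add: c_def c1_def mult_2 algebra_simps)
    then have "c + c1 = 1 + 2 * (k1 + k5)" by (simp only: ev)
    then show ?thesis by (simp add: algebra_simps)
  qed
  have "s 1 c1 + c = (k0 + k2 + k4 + k6) + (k1 + k3 + k5 + k7)"
    by (simp only: c_def c1_def s_add sk) (simp add: algebra_simps)
  then have "s 1 c1 + c = 2" by (simp only: ev od one_add_one)
  then have sc1: "s 1 c1 = 2 - c" by (simp add: eq_diff_eq)
  have s2: "s 1 2 = 2" using s_add[of 1 1 1] by (simp add: s_one one_add_one)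
  \<comment> \<open>The alternating sum of the eight conjugates of \<open>k0 * c\<close> under s;
    applying s shifts the terms and flips all signs.\<close>
  define T where "T = k0 * c - k1 * c1 + k2 * (2 - c) - k3 * (2 - c1)
      + k4 * c - k5 * c1 + k6 * (2 - c) - k7 * (2 - c1)"
  have "s 1 T = - T"
    unfolding T_def s_add s_diff s_mult sk sc sc1 s2 by (simp add: algebra_simps)
  then have "X * T * Y = - T" by (simp add: s_def)
  then have "X * T * (Y * X) = - T * X" by (metis mult.assoc)
  then have anti: "X * T = - (T * X)" by (simp add: YX)
  \<comment> \<open>Half of the even remainder that is left when the even-indexed and the
    odd-indexed conjugates of \<open>k0\<close> are summed to 1 and c - c1 is written as (c + c1) -
    2 c1.\<close>
  define R where "R = (k1 + k5) - c1 - (k2 + k6) * c + (k3 + k7) * c1 + (k2 + k6 - k3 - k7)"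
  have "T = (k0 + k2 + k4 + k6) * c - (k1 + k3 + k5 + k7) * c1 - 2 * ((k2 + k6) * c)
      + 2 * ((k3 + k7) * c1) + 2 * (k2 + k6 - k3 - k7)"
    unfolding T_def by (simp add: mult_2 mult_2_right algebra_simps)
  also have "\<dots> = c - c1 - 2 * ((k2 + k6) * c) + 2 * ((k3 + k7) * c1) + 2 * (k2 + k6 - k3 - k7)"
    by (simp only: ev od mult_1)
  also have "\<dots> = (c + c1) - 2 * c1 - 2 * ((k2 + k6) * c) + 2 * ((k3 + k7) * c1) + 2 * (k2 + k6 - k3 - k7)"
    by (simp add: mult_2 algebra_simps)
  also have "c + c1 = 1 + 2 * (k1 + k5)"
    using \<open>c1 = 2 * (k1 + k5) + 1 - c\<close> by (simp add: algebra_simps)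
  finally have TR: "T = 1 + of_nat 2 * R"
    unfolding R_def by (simp add: mult_2 algebra_simps)
  have tr_of_nat: "tr (of_nat n * z) = int n * tr z" for n z
  proof (induction n)
    case 0
    have "tr 0 = 0" using tr_add[of 0 0] by simp
    then show ?case by simp
  qed (simp add: algebra_simps tr_add)
  have tr_minus: "tr (- z) = - tr z" for z
    using tr_add[of z "- z"] tr_add[of 0 0] by simp
  have trT: "tr (T ^ Suc n * X) = 0" for n
  proof -
    have "tr (T ^ n * (X * T)) = tr (T * (T ^ n * X))"
      by (subst tr_comm[of T]) (simp only: mult.assoc)
    then have "tr (T ^ n * (X * T)) = tr (T ^ Suc n * X)"
      by (simp add: mult.assoc)
    moreover have "T ^ n * (X * T) = - (T ^ Suc n * X)"
      by (simp add: anti power_Suc2 mult.assoc del: power_Suc)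
    ultimately show ?thesis using tr_minus by simp
  qed
  have pow: "\<exists>R. T ^ (2 ^ m) = 1 + of_nat (2 ^ Suc m) * R" for m
  proof (induction m)
    case 0
    show ?case using TR by auto
  next
    case (Suc m)
    then obtain R where R: "T ^ (2 ^ m) = 1 + of_nat (2 ^ Suc m) * R" by blast
    define N where "N = (of_nat (2 ^ Suc m) :: 'r)"
    have "T ^ (2 ^ Suc m) = T ^ (2 ^ m) * T ^ (2 ^ m)"
      by (simp add: mult_2 power_add)
    also have "\<dots> = (1 + N * R) * (1 + N * R)" by (simp only: R N_def)
    also have "\<dots> = 1 + (N + N) * R + N * (R * N) * R" by (simp add: algebra_simps)
    also have "R * N = N * R" unfolding N_def by (rule mult_of_nat_commute[symmetric])
    \<comment> \<open>For N = 2^(m+1) the square of N is 2^m times 2 N, so each squaring of T gains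
      a factor 2.\<close>
    also have "N * (N * R) * R = (N + N) * (of_nat (2 ^ m) * R * R)"
    proof -
      have "N * N = (N + N) * of_nat (2 ^ m)"
        unfolding N_def of_nat_mult[symmetric] of_nat_add[symmetric]
        by (rule arg_cong[where f = of_nat]) simp
      then show ?thesis by (metis mult.assoc)
    qed
    also have "1 + (N + N) * R + (N + N) * (of_nat (2 ^ m) * R * R)
        = 1 + (N + N) * (R + of_nat (2 ^ m) * R * R)"
      by (simp add: algebra_simps)
    also have "N + N = of_nat (2 ^ Suc (Suc m))"
      unfolding N_def of_nat_add[symmetric] by (rule arg_cong[where f = of_nat]) simp
    finally show ?case by blast
  qed
  have "int (2 ^ Suc m) dvd tr X" for m
  proof -
    obtain R where R: "T ^ (2 ^ m) = 1 + of_nat (2 ^ Suc m) * R" using pow by blast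
    have "tr (T ^ Suc (2 ^ m - 1) * X) = 0" by (rule trT)
    then have "tr ((1 + of_nat (2 ^ Suc m) * R) * X) = 0" by (simp add: R del: power_Suc)
    then have "tr X + int (2 ^ Suc m) * tr (R * X) = 0"
      using tr_add[of X "of_nat (2 ^ Suc m) * (R * X)"] tr_of_nat[of "2 ^ Suc m" "R * X"]
      by (simp only: distrib_right mult_1 mult.assoc)
    then have "tr X = int (2 ^ Suc m) * (- tr (R * X))" by (simp add: algebra_simps)
    then show ?thesis by (rule dvdI)
  qed
  then have "int (2 ^ Suc (nat \<bar>tr X\<bar>)) dvd tr X" .
  moreover have "nat \<bar>tr X\<bar> < 2 ^ Suc (nat \<bar>tr X\<bar>)"
    using less_exp[of "Suc (nat \<bar>tr X\<bar>)"] by linarith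
  then have "\<bar>tr X\<bar> < int (2 ^ Suc (nat \<bar>tr X\<bar>))" by linarith
  ultimately show ?thesis using dvd_imp_le_int[of "tr X"] by force
qed

section \<open>The ring of integer square matrices\<close>

text \<open>The abstract trace lemma lives in the class \<open>ring_1\<close>, so the operators on
  the group ring must form a type; matrices over a finite index type provide it.\<close>

typedef 'n sqmat = "UNIV :: ('n::finite \<Rightarrow> 'n \<Rightarrow> int) set"
  morphisms entry Sqmat by simp

setup_lifting type_definition_sqmat

instantiation sqmat :: (finite) ring_1
begin

lift_definition zero_sqmat :: "'a sqmat" is "\<lambda>i j. 0" .
lift_definition one_sqmat :: "'a sqmat" is "\<lambda>i j. of_bool (i = j)" .
lift_definition plus_sqmat :: "'a sqmat \<Rightarrow> 'a sqmat \<Rightarrow> 'a sqmat" is "\<lambda>A B i j. A i j + B i j" .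
lift_definition minus_sqmat :: "'a sqmat \<Rightarrow> 'a sqmat \<Rightarrow> 'a sqmat" is "\<lambda>A B i j. A i j - B i j" .
lift_definition uminus_sqmat :: "'a sqmat \<Rightarrow> 'a sqmat" is "\<lambda>A i j. - A i j" .
lift_definition times_sqmat :: "'a sqmat \<Rightarrow> 'a sqmat \<Rightarrow> 'a sqmat" is
  "\<lambda>A B i j. \<Sum>k\<in>UNIV. A i k * B k j" .

instance
proof
  fix A B C :: "'a sqmat"
  show "A * B * C = A * (B * C)"
  proof (transfer, intro ext)
    fix A B C :: "'a \<Rightarrow> 'a \<Rightarrow> int" and i j
    show "(\<Sum>k\<in>UNIV. (\<Sum>l\<in>UNIV. A i l * B l k) * C k j) = (\<Sum>k\<in>UNIV. A i k * (\<Sum>l\<in>UNIV. B k l * C l j))"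
      unfolding sum_distrib_left sum_distrib_right by (subst sum.swap) (simp add: mult.assoc)
  qed
  have delta: "(\<Sum>k\<in>UNIV. of_bool (i = k) * f k) = f i" "(\<Sum>k\<in>UNIV. f k * of_bool (k = i)) = f i"
    for i :: 'a and f :: "'a \<Rightarrow> int"
  proof -
    have "(\<Sum>k\<in>UNIV. of_bool (i = k) * f k) = (\<Sum>k\<in>UNIV. if k = i then f k else 0)"
      by (intro sum.cong) auto
    then show "(\<Sum>k\<in>UNIV. of_bool (i = k) * f k) = f i" by simp
    have "(\<Sum>k\<in>UNIV. f k * of_bool (k = i)) = (\<Sum>k\<in>UNIV. if k = i then f k else 0)"
      by (intro sum.cong) auto
    then show "(\<Sum>k\<in>UNIV. f k * of_bool (k = i)) = f i" by simp
  qed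
  show "1 * A = A" "A * 1 = A"
    by (transfer, simp only: delta)+
  show "0 \<noteq> (1 :: 'a sqmat)" by transfer (auto simp: fun_eq_iff)
  show "(A + B) * C = A * C + B * C" "A * (B + C) = A * B + A * C"
    by (transfer, simp add: algebra_simps sum.distrib)+
  show "A + B + C = A + (B + C)" "A + B = B + A" "0 + A = A" "- A + A = 0" "A - B = A + - B"
    by (transfer, simp add: algebra_simps)+
qed

end

lift_definition sqtrace :: "'n::finite sqmat \<Rightarrow> int" is "\<lambda>A. \<Sum>i\<in>UNIV. A i i" .

lemma sqtrace_add: "sqtrace (A + B) = sqtrace A + sqtrace B"
  by transfer (simp add: sum.distrib)

lemma sqtrace_comm: "sqtrace (A * B) = sqtrace (B * A)"
  by transfer (subst sum.swap, simp add: mult.commute)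

section \<open>Left and right multiplications on the group ring\<close>

context finite_group
begin

text \<open>\<open>S\<close> takes one chosen point from each coset of the cyclic group generated by
  \<open>h\<close>. Writing this group with inverted powers matches the translates in the sum with
  the coset \<open>H #> a\<close>.\<close>

lemma left_transversal:
  assumes h: "h \<in> carrier G" "ord h = n" "n > 0"
  obtains S where "\<And>a. a \<in> carrier G \<Longrightarrow> (\<Sum>i<n. of_bool (inv (h [^] i) \<otimes> a \<in> S)) = (1::int)"
proof -
  define H where "H = (\<lambda>i. inv (h [^] i)) ` {..<n}"
  have inj: "inj_on (\<lambda>i. inv (h [^] i)) {..<n}"
  proof (rule inj_onI)
    fix i j assume ij: "i \<in> {..<n}" "j \<in> {..<n}" "inv (h [^] i) = inv (h [^] j)"
    then have "h [^] i = h [^] j" using h(1) by (metis inv_inv nat_pow_closed)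
    moreover have "{..<n} = {0..ord h - 1}" using h(2,3) by auto
    ultimately show "i = j" using ord_inj'[OF h(1)] ord_inj[OF h(1)] ij by (auto dest: inj_onD)
  qed
  define K where "K = {h [^] i | i. i \<in> {0..ord h - 1}}"
  have K: "subgroup K G" unfolding K_def by (rule element_generates_subgroup[OF finite_carrier h(1)])
  have Kim: "K = (\<lambda>i. h [^] i) ` {..<n}" unfolding K_def using h(2,3) by auto
  have "H \<subseteq> K"
    using subgroup.m_inv_closed[OF K] unfolding H_def Kim by auto
  moreover have "card K \<le> card H"
    using card_image_le[of "{..<n}" "\<lambda>i. h [^] i"] inj by (simp add: H_def Kim card_image)
  ultimately have HK: "H = K" by (intro card_seteq) (auto simp: Kim)
  have H: "subgroup H G" using K HK by simp
  define S where "S = {a. a = (SOME b. b \<in> H #> a)}"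
  show thesis
  proof (rule that[of S])
    fix a assume a: "a \<in> carrier G"
    define r where "r = (SOME b. b \<in> H #> a)"
    have "a \<in> H #> a" using a H by (rule rcos_self)
    then have "r \<in> H #> a" unfolding r_def by (rule someI)
    then obtain i where i: "i < n" "r = inv (h [^] i) \<otimes> a"
      unfolding r_coset_def H_def by auto
    have S: "inv (h [^] j) \<otimes> a \<in> S \<longleftrightarrow> j = i" if "j < n" for j
    proof -
      have "inv (h [^] j) \<otimes> a \<in> H #> a"
        using that unfolding r_coset_def H_def by auto
      then have "H #> a = H #> (inv (h [^] j) \<otimes> a)"
        using a H by (rule repr_independence)
      then have "inv (h [^] j) \<otimes> a \<in> S \<longleftrightarrow> inv (h [^] j) \<otimes> a = inv (h [^] i) \<otimes> a"
        using i by (auto simp: S_def r_def)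
      also have "\<dots> \<longleftrightarrow> inv (h [^] j) = inv (h [^] i)" using a h(1) by simp
      also have "\<dots> \<longleftrightarrow> j = i" by (rule inj_on_eq_iff[OF inj]) (use that i in auto)
      finally show ?thesis .
    qed
    have "(\<Sum>j<n. of_bool (inv (h [^] j) \<otimes> a \<in> S)) = (\<Sum>j<n. if j = i then 1 else (0::int))"
      using S by (intro sum.cong) auto
    then show "(\<Sum>j<n. of_bool (inv (h [^] j) \<otimes> a \<in> S)) = (1::int)"
      using i by simp
  qed
qed

text \<open>
  The left side is the trace of \<open>m \<mapsto> g m u\<close> on the group ring. The left multiplications by the
  powers of \<open>g\<^sup>2\<close> act freely, which supplies \<open>k0\<close> as the projection to a transversal.
\<close>

lemma involution_trace_order_8:
  fixes \<iota> :: "'n::finite \<Rightarrow> 'a"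
  assumes \<iota>: "bij_betw \<iota> UNIV (carrier G)"
    and u: "u \<in> carrier ZG" "u \<otimes>\<^bsub>ZG\<^esub> u = \<one>\<^bsub>ZG\<^esub>"
    and g: "g \<in> carrier G" "ord g = 8"
  shows "(\<Sum>a\<in>carrier G. Poly_Mapping.lookup u (inv a \<otimes> (inv g \<otimes> a))) = 0"
proof -
  have \<iota>c [simp]: "\<iota> i \<in> carrier G" for i using \<iota> by (auto simp: bij_betw_def)
  have \<iota>eq: "\<iota> i = \<iota> j \<longleftrightarrow> i = j" for i j using \<iota> by (auto simp: bij_betw_def inj_on_def)
  have \<iota>sum: "(\<Sum>k\<in>UNIV. F (\<iota> k)) = (\<Sum>a\<in>carrier G. F a)" for F :: "'a \<Rightarrow> int"
    using sum.reindex_bij_betw[OF \<iota>, of F] by simp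
  have delta: "(\<Sum>a\<in>carrier G. of_bool (a = b) * F a) = F b" if "b \<in> carrier G" for b and F :: "'a \<Rightarrow> int"
  proof -
    have "(\<Sum>a\<in>carrier G. of_bool (a = b) * F a) = (\<Sum>a\<in>carrier G. if a = b then F a else 0)"
      by (intro sum.cong) auto
    then show ?thesis using that finite_carrier by simp
  qed
  \<comment> \<open>\<open>L h\<close> is left multiplication by h and \<open>W\<close> right
    multiplication by u, as matrices in the basis of group elements. They commute, and
    \<open>W * W = 1\<close> because u is an involution.\<close>
  define L where "L h = Sqmat (\<lambda>i j. of_bool (\<iota> i = h \<otimes> \<iota> j))" for h
  define W where "W = Sqmat (\<lambda>i j. Poly_Mapping.lookup u (inv (\<iota> j) \<otimes> \<iota> i))"
  have ext: "A = B" if "\<And>i j. entry A i j = entry B i j" for A B :: "'n sqmat"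
    using that by transfer auto
  have eL: "entry (L h) i j = of_bool (\<iota> i = h \<otimes> \<iota> j)" for h i j
    by (simp add: L_def Sqmat_inverse)
  have eW: "entry W i j = Poly_Mapping.lookup u (inv (\<iota> j) \<otimes> \<iota> i)" for i j
    by (simp add: W_def Sqmat_inverse)
  have swap: "\<iota> i = h \<otimes> a \<longleftrightarrow> a = inv h \<otimes> \<iota> i" if "h \<in> carrier G" "a \<in> carrier G" for h i a
    using that by (metis \<iota>c inv_solve_left inv_closed m_closed)
  define \<kappa> where "\<kappa> = inv_into UNIV \<iota>"
  have \<kappa>\<iota> [simp]: "\<kappa> (\<iota> k) = k" for k
    using \<iota> by (simp add: \<kappa>_def bij_betw_def)
  have \<iota>\<kappa>: "\<iota> (\<kappa> a) = a" if "a \<in> carrier G" for a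
    using \<iota> that by (auto simp: \<kappa>_def bij_betw_def intro: f_inv_into_f)
  have eLA: "entry (L h * A) i j = entry A (\<kappa> (inv h \<otimes> \<iota> i)) j" if h: "h \<in> carrier G" for h A i j
  proof -
    have "entry (L h * A) i j = (\<Sum>k\<in>UNIV. of_bool (\<iota> k = inv h \<otimes> \<iota> i) * entry A (\<kappa> (\<iota> k)) j)"
      unfolding times_sqmat.rep_eq eL using swap[OF h \<iota>c] by simp
    also have "\<dots> = entry A (\<kappa> (inv h \<otimes> \<iota> i)) j"
      unfolding \<iota>sum[of "\<lambda>a. of_bool (a = inv h \<otimes> \<iota> i) * entry A (\<kappa> a) j"]
      by (rule delta) (use h in simp)
    finally show ?thesis .
  qed
  have eAL: "entry (A * L h) i j = entry A i (\<kappa> (h \<otimes> \<iota> j))" if h: "h \<in> carrier G" for h A i j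
  proof -
    have "entry (A * L h) i j = (\<Sum>k\<in>UNIV. of_bool (\<iota> k = h \<otimes> \<iota> j) * entry A i (\<kappa> (\<iota> k)))"
      unfolding times_sqmat.rep_eq eL by (simp add: mult.commute)
    also have "\<dots> = entry A i (\<kappa> (h \<otimes> \<iota> j))"
      unfolding \<iota>sum[of "\<lambda>a. of_bool (a = h \<otimes> \<iota> j) * entry A i (\<kappa> a)"]
      by (rule delta) (use h in simp)
    finally show ?thesis .
  qed
  have LL: "L h * L h' = L (h \<otimes> h')" if h: "h \<in> carrier G" "h' \<in> carrier G" for h h'
  proof (rule ext)
    fix i j
    have "inv h \<otimes> \<iota> i = h' \<otimes> \<iota> j \<longleftrightarrow> \<iota> i = h \<otimes> (h' \<otimes> \<iota> j)"
      using swap[OF h(1), of "h' \<otimes> \<iota> j" i] h by auto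
    then show "entry (L h * L h') i j = entry (L (h \<otimes> h')) i j"
      using h by (simp add: eLA eL \<iota>\<kappa> m_assoc)
  qed
  have L1: "L \<one> = 1"
    by (intro ext) (simp add: eL one_sqmat.rep_eq \<iota>eq)
  have LW: "L h * W = W * L h" if "h \<in> carrier G" for h
    using that by (intro ext) (simp add: eLA eAL eW \<iota>\<kappa> m_assoc inv_mult_group)
  have WW: "W * W = 1"
  proof (rule ext)
    fix i j
    have bij: "bij_betw (\<lambda>a. inv (\<iota> j) \<otimes> a) (carrier G) (carrier G)"
      by (rule bij_betwI[where g = "\<lambda>a. \<iota> j \<otimes> a"]) (auto simp flip: m_assoc)
    have "entry (W * W) i j = (\<Sum>a\<in>carrier G. Poly_Mapping.lookup u (inv a \<otimes> \<iota> i) * Poly_Mapping.lookup u (inv (\<iota> j) \<otimes> a))"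
      unfolding times_sqmat.rep_eq eW by (rule \<iota>sum)
    also have "\<dots> = (\<Sum>a\<in>carrier G. Poly_Mapping.lookup u (inv (inv (\<iota> j) \<otimes> a) \<otimes> (inv (\<iota> j) \<otimes> \<iota> i)) * Poly_Mapping.lookup u (inv (\<iota> j) \<otimes> a))"
    proof (intro sum.cong refl)
      fix a assume a: "a \<in> carrier G"
      have "inv (inv (\<iota> j) \<otimes> a) \<otimes> (inv (\<iota> j) \<otimes> \<iota> i) = inv a \<otimes> (\<iota> j \<otimes> (inv (\<iota> j) \<otimes> \<iota> i))"
        using a by (simp add: inv_mult_group m_assoc)
      also have "\<dots> = inv a \<otimes> \<iota> i" using a by (simp flip: m_assoc[of "\<iota> j"])
      finally show "Poly_Mapping.lookup u (inv a \<otimes> \<iota> i) * Poly_Mapping.lookup u (inv (\<iota> j) \<otimes> a)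
        = Poly_Mapping.lookup u (inv (inv (\<iota> j) \<otimes> a) \<otimes> (inv (\<iota> j) \<otimes> \<iota> i)) * Poly_Mapping.lookup u (inv (\<iota> j) \<otimes> a)"
        by simp
    qed
    also have "\<dots> = (\<Sum>b\<in>carrier G. Poly_Mapping.lookup u (inv b \<otimes> (inv (\<iota> j) \<otimes> \<iota> i)) * Poly_Mapping.lookup u b)"
      by (rule sum.reindex_bij_betw[OF bij])
    also have "\<dots> = Poly_Mapping.lookup (u \<otimes>\<^bsub>ZG\<^esub> u) (inv (\<iota> j) \<otimes> \<iota> i)"
    proof -
      define x where "x = inv (\<iota> j) \<otimes> \<iota> i"
      have x: "x \<in> carrier G" by (simp add: x_def)
      have "Poly_Mapping.lookup (u \<otimes>\<^bsub>ZG\<^esub> u) x = (\<Sum>b\<in>carrier G. Poly_Mapping.lookup u b * lin (\<lambda>h. of_bool (b \<otimes> h = x)) u)"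
        unfolding lin_of_bool[of x "u \<otimes>\<^bsub>ZG\<^esub> u", symmetric] lin_mult
        using u(1) by (intro lin_superset[OF finite_carrier]) (simp add: ZG_carrier)
      also have "\<dots> = (\<Sum>b\<in>carrier G. Poly_Mapping.lookup u b * Poly_Mapping.lookup u (inv b \<otimes> x))"
      proof (intro sum.cong refl arg_cong2[where f = "(*)"])
        fix b assume b: "b \<in> carrier G"
        have "lin (\<lambda>h. of_bool (b \<otimes> h = x)) u = lin (\<lambda>h. of_bool (h = inv b \<otimes> x)) u"
        proof (rule lin_cong)
          fix h assume "h \<in> Poly_Mapping.keys u"
          then have "h \<in> carrier G" using u(1) by (auto simp: ZG_carrier)
          then have "b \<otimes> h = x \<longleftrightarrow> h = inv b \<otimes> x" using b x by (metis inv_solve_left)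
          then show "of_bool (b \<otimes> h = x) = (of_bool (h = inv b \<otimes> x) :: int)" by simp
        qed
        then show "lin (\<lambda>h. of_bool (b \<otimes> h = x)) u = Poly_Mapping.lookup u (inv b \<otimes> x)"
          by (simp add: lin_of_bool)
      qed
      finally show ?thesis by (simp add: x_def mult.commute)
    qed
    also have "\<dots> = of_bool (\<one> = inv (\<iota> j) \<otimes> \<iota> i)"
      by (simp only: u(2) lin_of_bool[symmetric] lin_one)
    also have "\<one> = inv (\<iota> j) \<otimes> \<iota> i \<longleftrightarrow> i = j"
      by (metis \<iota>c \<iota>eq inv_solve_left r_one one_closed)
    finally show "entry (W * W) i j = entry 1 i j" by (simp add: one_sqmat.rep_eq)
  qed
  define X Y where "X = L g * W" and "Y = L (inv g) * W"
  have sq: "(L h * W) * (L h' * W) = L (h \<otimes> h')" if "h \<in> carrier G" "h' \<in> carrier G" for h h'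
  proof -
    have "(L h * W) * (L h' * W) = L h * (W * L h') * W" by (simp only: mult.assoc)
    also have "\<dots> = L h * (L h' * W) * W" by (simp only: LW[OF that(2)])
    also have "\<dots> = L h * L h' * (W * W)" by (simp only: mult.assoc)
    finally show ?thesis using that by (simp add: WW LL)
  qed
  have powL: "L h ^ n = L (h [^] n)" if "h \<in> carrier G" for h n
    using that by (induction n) (simp_all add: L1 LL flip: nat_pow_Suc2)
  \<comment> \<open>\<open>W\<close> cancels from even powers: conjugation by X^2 is conjugation by
    the left multiplication by g^2.\<close>
  have even_pow: "(L x * W) ^ (2 * n) = L (x [^] (2 * n))" if "x \<in> carrier G" for x n
  proof -
    have "(L x * W) ^ 2 = L (x [^] (2::nat))"
      using that by (simp add: power2_eq_square sq numeral_2_eq_2)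
    then show ?thesis using that by (simp only: power_mult powL nat_pow_closed nat_pow_pow)
  qed
  have X2: "X ^ (2 * n) = L (g [^] (2 * n))" for n
    using g(1) by (simp only: X_def even_pow)
  have Y2: "Y ^ (2 * n) = L (inv (g [^] (2 * n)))" for n
    using g(1) by (simp only: Y_def even_pow inv_closed nat_pow_inv)
  define h where "h = g [^] (2::nat)"
  have h: "h \<in> carrier G" "ord h = 4"
    using g ord_pow[of g 2] by (simp_all add: h_def)
  obtain S where S: "\<And>a. a \<in> carrier G \<Longrightarrow> (\<Sum>i<4. of_bool (inv (h [^] (i::nat)) \<otimes> a \<in> S)) = (1::int)"
    using left_transversal[OF h zero_less_numeral] by blast
  define k0 where "k0 = Sqmat (\<lambda>i j. of_bool (i = j \<and> \<iota> i \<in> S))"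
  \<comment> \<open>Conjugation by \<open>L x\<close> carries the projection onto \<open>S\<close>
    to the projection onto the translate of \<open>S\<close> by x; the four translates partition the
    group.\<close>
  have conj: "entry (L x * k0 * L (inv x)) i j = of_bool (i = j) * of_bool (inv x \<otimes> \<iota> i \<in> S)" if "x \<in> carrier G" for x i j
  proof -
    have "\<kappa> (inv x \<otimes> \<iota> i) = \<kappa> (inv x \<otimes> \<iota> j) \<longleftrightarrow> i = j"
    proof
      assume "\<kappa> (inv x \<otimes> \<iota> i) = \<kappa> (inv x \<otimes> \<iota> j)"
      then have "inv x \<otimes> \<iota> i = inv x \<otimes> \<iota> j" using that by (metis \<iota>\<kappa> \<iota>c inv_closed m_closed)
      then show "i = j" using that by (simp add: \<iota>eq)
    qed simp
    then show ?thesis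
      using that by (simp add: eLA eAL k0_def Sqmat_inverse \<iota>\<kappa> of_bool_conj)
  qed
  have "k0 + X ^ 2 * k0 * Y ^ 2 + X ^ 4 * k0 * Y ^ 4 + X ^ 6 * k0 * Y ^ 6
      = (\<Sum>n<(4::nat). L (h [^] n) * k0 * L (inv (h [^] n)))"
  proof -
    have sum4: "(\<Sum>n<4. F n) = F 0 + F 1 + F 2 + F 3" for F :: "nat \<Rightarrow> 'n sqmat"
      by (simp add: eval_nat_numeral)
    have "h [^] n = g [^] (2 * n)" for n :: nat
      using g(1) by (simp add: h_def nat_pow_pow)
    then have X: "X ^ (2 * n) = L (h [^] n)" and Y: "Y ^ (2 * n) = L (inv (h [^] n))" for n
      by (simp_all add: X2 Y2)
    show ?thesis
      unfolding sum4 using X[of 1] X[of 2] X[of 3] Y[of 1] Y[of 2] Y[of 3] by (simp add: L1)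
  qed
  also have "\<dots> = 1"
  proof (rule ext)
    fix i j
    have es: "entry (\<Sum>n\<in>I. A n) i j = (\<Sum>n\<in>I. entry (A n) i j)" if "finite I" for I :: "nat set" and A :: "nat \<Rightarrow> 'n sqmat"
      using that by (induction I) (auto simp: zero_sqmat.rep_eq plus_sqmat.rep_eq)
    have "entry (\<Sum>n<(4::nat). L (h [^] n) * k0 * L (inv (h [^] n))) i j
        = of_bool (i = j) * (\<Sum>n<(4::nat). of_bool (inv (h [^] n) \<otimes> \<iota> i \<in> S))"
      by (simp only: es[OF finite_lessThan] conj[OF nat_pow_closed[OF h(1)]] sum_distrib_left)
    then show "entry (\<Sum>n<(4::nat). L (h [^] n) * k0 * L (inv (h [^] n))) i j = entry 1 i j"
      by (simp only: S[OF \<iota>c] one_sqmat.rep_eq mult_1_right)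
  qed
  finally have k0: "k0 + X ^ 2 * k0 * Y ^ 2 + X ^ 4 * k0 * Y ^ 4 + X ^ 6 * k0 * Y ^ 6 = 1" .
  have "g [^] (8::nat) = \<one>" using pow_ord_eq_1[OF g(1)] g(2) by simp
  then have "X ^ 8 = 1" using X2[of 4] L1 by simp
  moreover have "X * Y = 1" "Y * X = 1" using g(1) by (simp_all add: X_def Y_def sq L1)
  ultimately have "sqtrace X = 0"
    using k0 by (intro trace_eq_0_of_relative_trace_one[OF sqtrace_add sqtrace_comm])
  moreover have "sqtrace X = (\<Sum>i\<in>UNIV. Poly_Mapping.lookup u (inv (\<iota> i) \<otimes> (inv g \<otimes> \<iota> i)))"
    using g(1) by (simp add: sqtrace.rep_eq X_def eLA eW \<iota>\<kappa>)
  ultimately show ?thesis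
    using \<iota>sum[of "\<lambda>a. Poly_Mapping.lookup u (inv a \<otimes> (inv g \<otimes> a))"] by simp
qed

end

section \<open>The Mathieu group of degree 11\<close>

text \<open>Permutations are given by their image lists so that the finite checks can be evaluated;
  \<open>gen_a_eq\<close> and \<open>gen_b_eq\<close> identify the generators with the cycle
  notation of \<open>M11\<close>.\<close>

definition perm_of :: "nat list \<Rightarrow> nat \<Rightarrow> nat" where
  "perm_of l i = (if 1 \<le> i \<and> i \<le> length l then l ! (i - 1) else i)"

definition gen_a :: "nat \<Rightarrow> nat" where
  "gen_a = perm_of [2,3,4,5,6,7,8,9,10,11,1]"

definition gen_b :: "nat \<Rightarrow> nat" where
  "gen_b = perm_of [1,2,7,10,6,4,11,3,9,5,8]"

text \<open>
  The blocks of a Steiner system \<open>S(4,5,11)\<close>: the orbit of \<open>{1,2,3,4,10}\<close> under \<open>M11\<close>.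
\<close>

definition blocks :: "nat list list" where
  "blocks = [[1,2,3,4,10], [1,2,3,5,8], [1,2,3,6,7], [1,2,3,9,11], [1,2,4,5,9], [1,2,4,6,8],
    [1,2,4,7,11], [1,2,5,6,11], [1,2,5,7,10], [1,2,6,9,10], [1,2,7,8,9], [1,2,8,10,11],
    [1,3,4,5,6], [1,3,4,7,9], [1,3,4,8,11], [1,3,5,7,11], [1,3,5,9,10], [1,3,6,8,9],
    [1,3,6,10,11], [1,3,7,8,10], [1,4,5,7,8], [1,4,5,10,11], [1,4,6,7,10], [1,4,6,9,11],
    [1,4,8,9,10], [1,5,6,7,9], [1,5,6,8,10], [1,5,8,9,11], [1,6,7,8,11], [1,7,9,10,11],
    [2,3,4,5,11], [2,3,4,6,9], [2,3,4,7,8], [2,3,5,6,10], [2,3,5,7,9], [2,3,6,8,11],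
    [2,3,7,10,11], [2,3,8,9,10], [2,4,5,6,7], [2,4,5,8,10], [2,4,6,10,11], [2,4,7,9,10],
    [2,4,8,9,11], [2,5,6,8,9], [2,5,7,8,11], [2,5,9,10,11], [2,6,7,8,10], [2,6,7,9,11],
    [3,4,5,7,10], [3,4,5,8,9], [3,4,6,7,11], [3,4,6,8,10], [3,4,9,10,11], [3,5,6,7,8],
    [3,5,6,9,11], [3,5,8,10,11], [3,6,7,9,10], [3,7,8,9,11], [4,5,6,8,11], [4,5,6,9,10],
    [4,5,7,9,11], [4,6,7,8,9], [4,7,8,10,11], [5,6,7,10,11], [5,7,8,9,10], [6,8,9,10,11]]"

text \<open>Sorting makes the test independent of the order in which the points are listed.\<close>

definition is_block :: "nat list \<Rightarrow> bool" where
  "is_block xs \<longleftrightarrow> sort xs \<in> set blocks"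

text \<open>Cycle types are determined for this whole group; \<open>M11_block_perms\<close> places
  M11 inside it.\<close>

definition block_perms :: "(nat \<Rightarrow> nat) set" where
  "block_perms = {g. g permutes {1..11} \<and> (\<forall>xs. is_block xs \<longrightarrow> is_block (map g xs))}"

primrec word_perm :: "(nat \<Rightarrow> nat) list \<Rightarrow> nat \<Rightarrow> nat" where
  "word_perm [] i = i"
| "word_perm (x # w) i = x (word_perm w i)"

text \<open>
  An entry \<open>(n, d, w)\<close> is a word \<open>w\<close> in the generators that fixes \<open>1, \<dots>, n - 1\<close> and maps \<open>n\<close> to \<open>d\<close>.
\<close>

definition transversal_words :: "(nat \<times> nat \<times> (nat \<Rightarrow> nat) list) list" where
  "transversal_words = [(1, 1, []), (1, 2, [gen_a]), (1, 3, [gen_a,gen_a]),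
    (1, 4, [gen_a,gen_a,gen_a]), (1, 5, [gen_a,gen_a,gen_a,gen_a]), (1, 6, [gen_a,gen_a,gen_a,gen_a,gen_a]),
    (1, 7, [gen_b,gen_a,gen_a]), (1, 8, [gen_a,gen_b,gen_a,gen_a]), (1, 9, [gen_a,gen_a,gen_b,gen_a,gen_a]),
    (1, 10, [gen_b,gen_a,gen_a,gen_a]), (1, 11, [gen_b,gen_b,gen_a,gen_a]), (2, 2, []),
    (2, 3, [gen_b,gen_a,gen_a,gen_b,gen_a,gen_a,gen_a]), (2, 4, [gen_b,gen_a,gen_b,gen_b,gen_a,gen_a]), (2, 5, [gen_b,gen_b,gen_b,gen_a,gen_b,gen_b,gen_a,gen_a]),
    (2, 6, [gen_a,gen_b,gen_b,gen_a,gen_a]), (2, 7, [gen_a,gen_b,gen_a,gen_b,gen_a,gen_a,gen_a,gen_a]), (2, 8, [gen_a,gen_a,gen_b,gen_a,gen_a,gen_a]),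
    (2, 9, [gen_a,gen_b,gen_a,gen_b,gen_b,gen_b,gen_a,gen_a,gen_a]), (2, 10, [gen_b,gen_b,gen_a,gen_b,gen_b,gen_a,gen_a]), (2, 11, [gen_a,gen_a,gen_b,gen_a,gen_a,gen_b,gen_a]),
    (3, 3, []), (3, 4, [gen_a,gen_b,gen_a,gen_a,gen_a,gen_a,gen_a,gen_b,gen_a,gen_b]), (3, 5, [gen_a,gen_b,gen_a,gen_a,gen_a,gen_a,gen_a,gen_b,gen_a,gen_b,gen_b]),
    (3, 6, [gen_a,gen_b,gen_a,gen_b,gen_a,gen_b,gen_a,gen_b,gen_b,gen_a,gen_a,gen_a]), (3, 7, [gen_b]), (3, 8, [gen_b,gen_b,gen_b]),
    (3, 9, [gen_a,gen_a,gen_b,gen_a,gen_b,gen_b,gen_a,gen_b,gen_a,gen_a,gen_b,gen_a]), (3, 10, [gen_b,gen_a,gen_b,gen_a,gen_a,gen_a,gen_a,gen_a,gen_b,gen_a,gen_b]), (3, 11, [gen_b,gen_b]),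
    (4, 4, []), (4, 5, [gen_a,gen_a,gen_a,gen_b,gen_b,gen_a,gen_b,gen_a,gen_b,gen_a,gen_b,gen_a,gen_b,gen_a,gen_a]), (4, 6, [gen_a,gen_a,gen_a,gen_b,gen_b,gen_a,gen_b,gen_a,gen_b,gen_a,gen_a,gen_b,gen_a]),
    (4, 7, [gen_b,gen_a,gen_a,gen_b,gen_b,gen_a,gen_b,gen_a,gen_a,gen_a,gen_b,gen_a,gen_a]), (4, 8, [gen_a,gen_a,gen_a,gen_a,gen_a,gen_a,gen_a,gen_b,gen_b,gen_a,gen_a,gen_b,gen_b,gen_b,gen_a]), (4, 9, [gen_b,gen_b,gen_a,gen_b,gen_a,gen_a,gen_a,gen_a,gen_a,gen_b,gen_a]),
    (4, 10, [gen_b,gen_b,gen_a,gen_b,gen_a,gen_a,gen_a,gen_a,gen_b,gen_a,gen_b,gen_a,gen_a]), (4, 11, [gen_a,gen_b,gen_a,gen_b,gen_a,gen_b,gen_a,gen_b,gen_b,gen_a,gen_a,gen_a,gen_b])]"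

text \<open>
  An entry \<open>(l, w, m, f)\<close> is an element with list of images \<open>l\<close>, given by the word \<open>w\<close>, of order \<open>m\<close>
  with \<open>f\<close> fixed points.
\<close>

definition representatives :: "(nat list \<times> (nat \<Rightarrow> nat) list \<times> nat \<times> nat) list" where
  "representatives =
   [([2,3,4,1,8,6,9,7,5,10,11], [gen_b,gen_b,gen_a,gen_b,gen_a,gen_a,gen_a,gen_b,gen_a,gen_a,gen_b,gen_a,gen_a], 4, 3),
    ([2,3,4,5,6,7,8,9,10,11,1], [gen_a], 11, 0),
    ([2,3,4,6,11,10,1,5,8,9,7], [gen_b,gen_b,gen_b,gen_a,gen_b,gen_b,gen_a,gen_a,gen_b,gen_b,gen_a,gen_a,gen_a,gen_a,gen_a], 11, 0),
    ([2,3,4,7,1,11,5,10,6,8,9], [gen_b,gen_a,gen_a,gen_a,gen_b,gen_b,gen_b,gen_a,gen_a,gen_a,gen_a], 6, 0),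
    ([2,3,4,8,10,5,11,1,9,7,6], [gen_a,gen_b,gen_a,gen_a,gen_b,gen_b,gen_a,gen_b,gen_a,gen_a,gen_a,gen_b,gen_a,gen_a], 5, 1),
    ([2,3,4,9,5,1,10,11,7,6,8], [gen_b,gen_a,gen_a,gen_a,gen_b,gen_a,gen_b,gen_a,gen_a,gen_a,gen_a,gen_a,gen_a,gen_a,gen_b], 8, 1),
    ([2,3,4,10,7,9,6,8,11,1,5], [gen_b,gen_a,gen_a,gen_a,gen_b,gen_a,gen_a,gen_b,gen_b,gen_b,gen_a], 5, 1),
    ([2,3,4,11,9,8,7,6,1,5,10], [gen_a,gen_b,gen_b,gen_a,gen_b,gen_a,gen_a,gen_a,gen_a,gen_b,gen_a,gen_b,gen_a,gen_a], 8, 1),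
    ([2,3,1,4,9,5,8,11,6,10,7], [gen_b,gen_b,gen_b,gen_a,gen_b,gen_b,gen_a,gen_a,gen_a,gen_a,gen_b,gen_b,gen_b,gen_a,gen_a], 3, 2),
    ([2,3,1,5,7,10,4,6,9,8,11], [gen_b,gen_a,gen_a,gen_a,gen_b,gen_b,gen_a,gen_a,gen_a,gen_a,gen_b,gen_b,gen_a], 3, 2),
    ([2,3,1,6,5,11,9,8,10,7,4], [gen_a,gen_b,gen_b], 3, 2),
    ([2,3,1,7,8,9,11,5,4,6,10], [gen_a,gen_a,gen_b,gen_a,gen_a,gen_a,gen_a,gen_b,gen_a,gen_b,gen_a,gen_a], 6, 0),
    ([2,3,1,8,6,4,10,7,11,5,9], [gen_b,gen_b,gen_a,gen_a,gen_a,gen_b,gen_a,gen_b,gen_a,gen_b,gen_a,gen_b,gen_a,gen_b], 6, 0),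
    ([2,3,1,9,10,6,7,4,8,11,5], [gen_a,gen_b,gen_a,gen_a,gen_a,gen_a,gen_b,gen_b,gen_b,gen_a,gen_b,gen_b,gen_b,gen_a], 3, 2),
    ([2,3,1,10,11,8,5,9,7,4,6], [gen_a,gen_a,gen_b,gen_a,gen_a,gen_a,gen_a,gen_a,gen_b,gen_a], 6, 0),
    ([2,3,1,11,4,7,6,10,5,9,8], [gen_a,gen_a,gen_a,gen_b,gen_a,gen_a,gen_a,gen_b,gen_a,gen_b,gen_b,gen_a,gen_a], 6, 0),
    ([2,1,4,3,5,11,7,9,8,10,6], [gen_a,gen_a,gen_a,gen_b,gen_a,gen_b,gen_a,gen_b,gen_a,gen_a], 2, 3),
    ([2,1,3,4,7,8,5,6,11,10,9], [gen_b,gen_b,gen_a,gen_a,gen_a,gen_b,gen_a,gen_a,gen_b,gen_a,gen_b,gen_b,gen_b], 2, 3)]"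

text \<open>The divisibility form of the order is what \<open>ord_unique\<close> takes as input, and
  it passes to conjugates directly.\<close>

definition cycle_data :: "(nat \<Rightarrow> nat) \<Rightarrow> nat \<Rightarrow> nat \<Rightarrow> bool" where
  "cycle_data g m f \<longleftrightarrow> (\<forall>k. g ^^ k = id \<longleftrightarrow> m dvd k) \<and> card {i \<in> {1..11}. g i = i} = f"

section \<open>The sharply 4-transitive group of block-preserving permutations\<close>

lemma perm_of_permutes:
  assumes "sort l = [1..<Suc (length l)]"
  shows "perm_of l permutes {1..length l}"
proof (rule bij_imp_permutes)
  have set: "set l = {1..length l}"
    using arg_cong[OF assms, of set] by auto
  have dist: "distinct l"
    using assms by (metis distinct_sort distinct_upt)
  have im: "perm_of l ` {1..length l} = set l"
  proof (intro equalityI subsetI)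
    fix x assume "x \<in> set l"
    then obtain i where "i < length l" "x = l ! i" by (auto simp: in_set_conv_nth)
    then show "x \<in> perm_of l ` {1..length l}"
      by (intro image_eqI[of _ _ "Suc i"]) (auto simp: perm_of_def)
  qed (auto simp: perm_of_def)
  then show "bij_betw (perm_of l) {1..length l} {1..length l}"
    using set by (simp add: bij_betw_def eq_card_imp_inj_on)
qed (auto simp: perm_of_def)

lemma less_12_cases: "i < 12 \<Longrightarrow> i \<in> {0,1,2,3,4,5,6,7,8,9,10,11::nat}"
  by (auto simp: numeral_eq_Suc less_Suc_eq)

lemma gen_a_eq: "gen_a = cycle_of_list [1,2,3,4,5,6,7,8,9,10,11]"
proof
  fix i :: nat
  show "gen_a i = cycle_of_list [1,2,3,4,5,6,7,8,9,10,11] i"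
  proof (cases "i < 12")
    case True
    then show ?thesis
      using less_12_cases[OF True]
      by (elim insertE emptyE; hypsubst) (simp_all add: gen_a_def perm_of_def transpose_def)
  qed (simp add: gen_a_def perm_of_def transpose_def)
qed

lemma gen_b_eq: "gen_b = cycle_of_list [3,7,11,8] \<circ> cycle_of_list [4,10,5,6]"
proof
  fix i :: nat
  show "gen_b i = (cycle_of_list [3,7,11,8] \<circ> cycle_of_list [4,10,5,6]) i"
  proof (cases "i < 12")
    case True
    then show ?thesis
      using less_12_cases[OF True]
      by (elim insertE emptyE; hypsubst) (simp_all add: gen_b_def perm_of_def transpose_def)
  qed (simp add: gen_b_def perm_of_def transpose_def)
qed

lemma sort_map_cong: "sort xs = sort ys \<Longrightarrow> sort (map g xs) = sort (map g ys)"
  by (metis mset_map mset_sort sorted_list_of_multiset_mset)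

lemma block_permsI:
  assumes "sort l = [1..<12]" "list_all (\<lambda>b. is_block (map (perm_of l) b)) blocks"
  shows "perm_of l \<in> block_perms"
proof -
  have "length l = 11" using arg_cong[OF assms(1), of length] by simp
  then have "perm_of l permutes {1..11}"
    using perm_of_permutes[of l] assms(1) by simp
  moreover have "is_block (map (perm_of l) xs)" if "is_block xs" for xs
  proof -
    have "is_block (map (perm_of l) (sort xs))"
      using that assms(2) unfolding is_block_def by (simp add: list_all_iff)
    moreover have "sort (map (perm_of l) (sort xs)) = sort (map (perm_of l) xs)"
      by (rule sort_map_cong) (simp add: sorted_sort_id)
    ultimately show ?thesis by (simp add: is_block_def)
  qed
  ultimately show ?thesis by (simp add: block_perms_def)
qed

lemma gen_a_block_perms: "gen_a \<in> block_perms"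
  unfolding gen_a_def by (rule block_permsI; code_simp)

lemma gen_b_block_perms: "gen_b \<in> block_perms"
  unfolding gen_b_def by (rule block_permsI; code_simp)

lemma id_block_perms: "id \<in> block_perms"
  by (simp add: block_perms_def permutes_id)

lemma comp_block_perms: "g \<in> block_perms \<Longrightarrow> h \<in> block_perms \<Longrightarrow> g \<circ> h \<in> block_perms"
  by (auto simp: block_perms_def permutes_compose simp flip: map_map)

lemma funpow_block_perms: "g \<in> block_perms \<Longrightarrow> g ^^ n \<in> block_perms"
  by (induction n) (auto intro: comp_block_perms id_block_perms)

lemma block_perms_permutes: "g \<in> block_perms \<Longrightarrow> g permutes {1..11}"
  by (simp add: block_perms_def)

text \<open>A permutation of a finite set has finite order, so its inverse is one of its
  powers.\<close>

lemma inv_block_perms: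
  assumes "g \<in> block_perms"
  shows "inv' g \<in> block_perms"
proof -
  have "permutation g"
    using block_perms_permutes[OF assms] by (auto simp: permutation_permutes)
  then obtain n where n: "g ^^ n = id" "n > 0"
    using permutation_is_nilpotent by metis
  have "g ^^ Suc (n - 1) = id" using n by simp
  then have gn: "g \<circ> g ^^ (n - 1) = id" by simp
  have "inv' g = inv' g \<circ> (g \<circ> g ^^ (n - 1))" by (simp only: gn comp_id)
  also have "\<dots> = g ^^ (n - 1)"
    by (simp only: comp_assoc[symmetric] permutes_inv_o(2)[OF block_perms_permutes[OF assms]] id_comp)
  finally have "inv' g = g ^^ (n - 1)" .
  then show ?thesis using funpow_block_perms[OF assms] by simp
qed

lemma word_perm_Nil: "word_perm [] = id"
  by auto

lemma word_perm_Cons: "word_perm (x # w) = x \<circ> word_perm w"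
  by auto

lemma word_perm_replicate: "word_perm (replicate k g) = g ^^ k"
  by (induction k) (simp_all add: word_perm_Nil word_perm_Cons del: word_perm.simps)

lemma word_perm_block_perms: "set w \<subseteq> {gen_a, gen_b} \<Longrightarrow> word_perm w \<in> block_perms"
proof (induction w)
  case Nil
  then show ?case using id_block_perms by (simp only: word_perm_Nil)
next
  case (Cons x w)
  then have "x \<in> block_perms" "word_perm w \<in> block_perms"
    using gen_a_block_perms gen_b_block_perms by auto
  then show ?case by (simp only: word_perm_Cons comp_block_perms)
qed

text \<open>Four points determine their block, so \<open>g\<close> fixes 10, the fifth point of the
  block through 1, 2, 3, 4. Blocks through 5 and three fixed points then tie the images of the other
  points to that of 5, and a finite search leaves only the identity.\<close>

lemma block_perms_stabilizer:
  assumes g: "g \<in> block_perms" and fix4: "g 1 = 1" "g 2 = 2" "g 3 = 3" "g 4 = 4"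
  shows "g = id"
proof -
  have perm: "g permutes {1..11}" by (rule block_perms_permutes[OF g])
  have inj: "g x = g y \<longleftrightarrow> x = y" for x y
    using permutes_inj[OF perm] by (auto dest: injD)
  have ran: "g x \<in> set [1..<12]" if "x \<in> set [1..<12]" for x
    using permutes_in_image[OF perm, of x] that by auto
  have pres: "is_block (map g xs)" if "is_block xs" for xs
    using g that by (simp add: block_perms_def)
  have "list_all (\<lambda>x. is_block [1,2,3,4,x] \<longrightarrow> x = 10) [1..<12]" by code_simp
  then have "\<forall>x\<in>set [1..<12]. is_block [1,2,3,4,x] \<longrightarrow> x = 10" by (simp only: list_all_iff)
  moreover have "is_block [1,2,3,4,10]" by code_simp
  from pres[OF this] have "is_block [1,2,3,4,g 10]" by (simp only: list.map fix4)
  moreover have "g 10 \<in> set [1..<12]" by (rule ran) simp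
  ultimately have g10: "g 10 = 10" by blast
  define S :: "nat list" where "S = [5,6,7,8,9,11]"
  have S: "g x \<in> set S" if "x \<in> set S" for x
  proof -
    have "set [1..<12] - set S = {1,2,3,4,10::nat}" unfolding S_def by code_simp
    moreover have "g x \<noteq> y" if "g y = y" "y \<notin> set S" for y
      using inj[of x y] that \<open>x \<in> set S\<close> by auto
    then have "g x \<notin> {1,2,3,4,10}"
      using fix4 g10 unfolding S_def by simp
    moreover have "g x \<in> set [1..<12]" using that by (intro ran) (auto simp: S_def)
    ultimately show ?thesis by blast
  qed
  \<comment> \<open>The variables a, ..., f are the images of 5, 8, 9, 6, 11, 7. The filters use the
    blocks joining 5 to 8, 9, 6, 11, 7 through fixed points, and the final test uses the block
    {1,2,3,6,7}.\<close>
  have search: "list_all (\<lambda>a.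
     list_all (\<lambda>b. list_all (\<lambda>c. list_all (\<lambda>d. list_all (\<lambda>e. list_all (\<lambda>f.
        is_block [1,2,3,d,f] \<longrightarrow> distinct [a,b,c,d,e,f] \<longrightarrow> [a,b,c,d,e,f] = [5,8,9,6,11,7])
       (filter (\<lambda>f. is_block [1,2,10,a,f]) S))
       (filter (\<lambda>e. is_block [2,3,4,a,e]) S))
       (filter (\<lambda>d. is_block [1,3,4,a,d]) S))
       (filter (\<lambda>c. is_block [1,2,4,a,c]) S))
       (filter (\<lambda>b. is_block [1,2,3,a,b]) S)) S"
    unfolding S_def by code_simp
  have B: "is_block [1,2,3,5,8]" "is_block [1,2,4,5,9]" "is_block [1,3,4,5,6]" "is_block [2,3,4,5,11]"
    "is_block [1,2,10,5,7]" "is_block [1,2,3,6,7]"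
    by code_simp+
  have mem: "g 5 \<in> set S" "g 8 \<in> set S" "g 9 \<in> set S" "g 6 \<in> set S" "g 11 \<in> set S" "g 7 \<in> set S"
    by (rule S, simp add: S_def)+
  have dist: "distinct [g 5, g 8, g 9, g 6, g 11, g 7]"
    by (simp add: inj)
  have eq: "[g 5, g 8, g 9, g 6, g 11, g 7] = [5,8,9,6,11,7]"
    using search mem dist B[THEN pres] unfolding list_all_iff set_filter by (simp only: list.map fix4 g10) blast
  have "g x = x" if "x \<in> {1..11}" for x
  proof -
    have x: "x < 12" "x \<noteq> 0" using that by auto
    show ?thesis
      using less_12_cases[OF x(1)]
      by (elim insertE emptyE;
        use x(2) eq in \<open>simp add: fix4 fix4(1)[unfolded One_nat_def] g10\<close>)
  qed
  moreover have "g x = x" if "x \<notin> {1..11}" for x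
    using perm that by (simp add: permutes_def)
  ultimately show ?thesis by (metis eq_id_iff)
qed

lemma block_perms_eqI:
  assumes "g \<in> block_perms" "h \<in> block_perms" "map g [1,2,3,4] = map h [1,2,3,4]"
  shows "g = h"
proof -
  have bij: "bij h" using permutes_bij[OF block_perms_permutes[OF assms(2)]] .
  have "inv' h \<circ> g = id"
    using assms(3) bij
    by (intro block_perms_stabilizer comp_block_perms inv_block_perms assms)
       (auto simp: bij_is_inj)
  then have "h \<circ> (inv' h \<circ> g) = h" by simp
  then show ?thesis using bij by (simp add: comp_assoc[symmetric] bij_is_surj surj_iff[THEN iffD1])
qed

lemma transversal_words_correct:
  "list_all (\<lambda>(n, d, w). map (word_perm w) [1..<Suc n] = [1..<n] @ [d]) transversal_words"
  by code_simp

lemma transversal_step: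
  assumes "n \<in> {1..4}" "d \<in> {n..11}"
  obtains h where "h \<in> block_perms" "\<And>i. 1 \<le> i \<Longrightarrow> i < n \<Longrightarrow> h i = i" "h n = d"
proof -
  have "list_all (\<lambda>n. list_all (\<lambda>d. (n, d) \<in> set (map (\<lambda>(n, d, w). (n, d)) transversal_words)) [n..<12]) [1..<5]"
    by code_simp
  moreover have "n \<in> set [1..<5]" "d \<in> set [n..<12]" using assms by auto
  ultimately have "(n, d) \<in> set (map (\<lambda>(n, d, w). (n, d)) transversal_words)"
    by (simp only: list_all_iff)
  then obtain w where w: "(n, d, w) \<in> set transversal_words" by auto
  then have eq: "map (word_perm w) [1..<Suc n] = [1..<n] @ [d]"
    using bspec[OF transversal_words_correct[unfolded list_all_iff] w] by (simp only: prod.case)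
  have "\<forall>(n, d, w)\<in>set transversal_words. set w \<subseteq> {gen_a, gen_b}"
    by (simp add: transversal_words_def)
  then have "set w \<subseteq> {gen_a, gen_b}" using w by auto
  moreover have "word_perm w n = d" using eq assms(1) by simp
  moreover have "word_perm w i = i" if "1 \<le> i" "i < n" for i
  proof -
    have "map (word_perm w) [1..<n] = map id [1..<n]" using eq assms(1) by simp
    then show ?thesis using that by (subst (asm) map_eq_conv) auto
  qed
  ultimately show thesis using that word_perm_block_perms by blast
qed

text \<open>A stabilizer chain: each \<open>transversal_step\<close> moves one more point to its
  target, pulled back through the earlier factors, while fixing the points already placed.\<close>

lemma block_perms_4_transitive:
  assumes "distinct [a, b, c, d]" "set [a, b, c, d] \<subseteq> {1..11}"
  obtains h where "h \<in> block_perms" "h 1 = a" "h 2 = b" "h 3 = c" "h 4 = d"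
proof -
  obtain h1 where h1: "h1 \<in> block_perms" "h1 1 = a"
    using transversal_step[of 1 a] assms by auto
  have p1: "h1 permutes {1..11}" by (rule block_perms_permutes[OF h1(1)])
  define b1 c1 d1 where "b1 = inv' h1 b" and "c1 = inv' h1 c" and "d1 = inv' h1 d"
  have i1: "h1 b1 = b" "h1 c1 = c" "h1 d1 = d"
    by (simp_all add: b1_def c1_def d1_def permutes_inverses(1)[OF p1])
  have m1: "b1 \<in> {1..11}" "c1 \<in> {1..11}" "d1 \<in> {1..11}"
    using assms(2) permutes_in_image[OF permutes_inv[OF p1]] unfolding b1_def c1_def d1_def by auto
  have d1: "distinct [1, b1, c1, d1]" using assms(1) h1(2) i1 by auto
  have "b1 \<in> {2..11}" using m1 d1 by auto
  moreover have "2 \<in> {1..4::nat}" by simp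
  ultimately obtain h2 where h2': "h2 \<in> block_perms" "\<And>i. 1 \<le> i \<Longrightarrow> i < 2 \<Longrightarrow> h2 i = i" "h2 2 = b1"
    using transversal_step by blast
  then have h2: "h2 \<in> block_perms" "h2 1 = 1" "h2 2 = b1"
    by simp_all
  have p2: "h2 permutes {1..11}" by (rule block_perms_permutes[OF h2(1)])
  define c2 d2 where "c2 = inv' h2 c1" and "d2 = inv' h2 d1"
  have i2: "h2 c2 = c1" "h2 d2 = d1"
    by (simp_all add: c2_def d2_def permutes_inverses(1)[OF p2])
  have m2: "c2 \<in> {1..11}" "d2 \<in> {1..11}"
    using m1 permutes_in_image[OF permutes_inv[OF p2]] unfolding c2_def d2_def by auto
  have d2: "distinct [1, 2, c2, d2]" using d1 h2 i2 by auto
  have "c2 \<in> {3..11}" using m2 d2 by auto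
  moreover have "3 \<in> {1..4::nat}" by simp
  ultimately obtain h3 where h3': "h3 \<in> block_perms" "\<And>i. 1 \<le> i \<Longrightarrow> i < 3 \<Longrightarrow> h3 i = i" "h3 3 = c2"
    using transversal_step by blast
  then have h3: "h3 \<in> block_perms" "h3 1 = 1" "h3 2 = 2" "h3 3 = c2"
    by simp_all
  have p3: "h3 permutes {1..11}" by (rule block_perms_permutes[OF h3(1)])
  define d3 where "d3 = inv' h3 d2"
  have i3: "h3 d3 = d2" by (simp add: d3_def permutes_inverses(1)[OF p3])
  have m3: "d3 \<in> {1..11}"
    using m2 permutes_in_image[OF permutes_inv[OF p3]] unfolding d3_def by auto
  have d3: "distinct [1, 2, 3, d3]" using d2 h3 i3 by auto
  have "d3 \<in> {4..11}" using m3 d3 by auto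
  moreover have "4 \<in> {1..4::nat}" by simp
  ultimately obtain h4 where h4': "h4 \<in> block_perms" "\<And>i. 1 \<le> i \<Longrightarrow> i < 4 \<Longrightarrow> h4 i = i" "h4 4 = d3"
    using transversal_step by blast
  then have h4: "h4 \<in> block_perms" "h4 1 = 1" "h4 2 = 2" "h4 3 = 3" "h4 4 = d3"
    by simp_all
  show thesis
  proof (rule that[of "h1 \<circ> (h2 \<circ> (h3 \<circ> h4))"])
    show "h1 \<circ> (h2 \<circ> (h3 \<circ> h4)) \<in> block_perms"
      by (intro comp_block_perms h1 h2 h3 h4)
  qed (simp_all only: o_apply h1 h2 h3 h4 i1 i2 i3)
qed

section \<open>Cycle types of block-preserving permutations\<close>

lemma cycle_dataI:
  assumes g: "g permutes {1..11}" and m: "m > 0" "map (g ^^ m) [1..<12] = [1..<12]"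
    and lt: "list_all (\<lambda>k. map (g ^^ k) [1..<12] \<noteq> [1..<12]) [1..<m]"
    and f: "length (filter (\<lambda>i. g i = i) [1..<12]) = f"
  shows "cycle_data g m f"
proof -
  have pid: "g ^^ k = id \<longleftrightarrow> map (g ^^ k) [1..<12] = [1..<12]" for k
  proof
    assume h: "map (g ^^ k) [1..<12] = [1..<12]"
    have "(g ^^ k) x = x" for x
    proof (cases "x \<in> {1..11}")
      case True
      have "map (g ^^ k) [1..<12] = map id [1..<12]" using h by simp
      then have "\<forall>x\<in>set [1..<12]. (g ^^ k) x = id x" by (simp only: map_eq_conv)
      then show ?thesis using True by auto
    next
      case False
      then have "g x = x" using g by (simp add: permutes_def)
      then show ?thesis by (induction k) auto
    qed
    then show "g ^^ k = id" by auto
  qed simp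
  have gm: "g ^^ m = id" using pid m by blast
  have "g ^^ k = id \<longleftrightarrow> m dvd k" for k
  proof
    assume k: "g ^^ k = id"
    have "g ^^ k = g ^^ (k mod m + m * (k div m))" by simp
    also have "\<dots> = g ^^ (k mod m)"
      unfolding funpow_add by (simp add: funpow_mult[symmetric] gm)
    finally have "g ^^ (k mod m) = id" using k by simp
    then have "\<not> (1 \<le> k mod m \<and> k mod m < m)"
      using lt pid by (auto simp: list_all_iff)
    then show "m dvd k" using m(1) by (simp add: dvd_eq_mod_eq_0)
  next
    assume "m dvd k"
    then show "g ^^ k = id" by (auto simp: funpow_mult[symmetric] gm)
  qed
  moreover have "card {i \<in> {1..11}. g i = i} = f"
  proof -
    have "{i \<in> {1..11}. g i = i} = set (filter (\<lambda>i. g i = i) [1..<12])" by auto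
    also have "card \<dots> = f" using f by (subst distinct_card) auto
    finally show ?thesis .
  qed
  ultimately show ?thesis by (simp add: cycle_data_def)
qed

lemma cycle_data_conj:
  assumes k: "k permutes {1..11}" and h: "cycle_data (inv' k \<circ> g \<circ> k) m f"
  shows "cycle_data g m f"
proof -
  have kk: "k \<circ> inv' k = id" "inv' k \<circ> k = id"
    using permutes_inv_o[OF k] by auto
  have pow: "(inv' k \<circ> g \<circ> k) ^^ n = inv' k \<circ> g ^^ n \<circ> k" for n
  proof (induction n)
    case (Suc n)
    have "(inv' k \<circ> g \<circ> k) ^^ Suc n = (inv' k \<circ> g \<circ> k) \<circ> (inv' k \<circ> g ^^ n \<circ> k)"
      by (simp only: funpow.simps Suc)
    also have "\<dots> = inv' k \<circ> g \<circ> (k \<circ> inv' k) \<circ> g ^^ n \<circ> k"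
      by (simp only: comp_assoc)
    also have "\<dots> = inv' k \<circ> g ^^ Suc n \<circ> k"
      by (simp only: kk comp_id funpow.simps comp_assoc)
    finally show ?case .
  qed (simp add: kk)
  have iff: "inv' k \<circ> g ^^ n \<circ> k = id \<longleftrightarrow> g ^^ n = id" for n
  proof
    assume "inv' k \<circ> g ^^ n \<circ> k = id"
    then have "k \<circ> (inv' k \<circ> g ^^ n \<circ> k) \<circ> inv' k = k \<circ> id \<circ> inv' k" by (simp only:)
    then have "(k \<circ> inv' k) \<circ> g ^^ n \<circ> (k \<circ> inv' k) = k \<circ> inv' k"
      by (simp only: comp_assoc id_comp)
    then show "g ^^ n = id" by (simp only: kk id_comp comp_id)
  next
    assume "g ^^ n = id"
    then show "inv' k \<circ> g ^^ n \<circ> k = id" by (simp only: comp_id kk)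
  qed
  have bij: "bij_betw k {i \<in> {1..11}. (inv' k \<circ> g \<circ> k) i = i} {i \<in> {1..11}. g i = i}"
  proof (rule bij_betwI[where g = "inv' k"])
    show "k \<in> {i \<in> {1..11}. (inv' k \<circ> g \<circ> k) i = i} \<rightarrow> {i \<in> {1..11}. g i = i}"
    proof
      fix i assume i: "i \<in> {i \<in> {1..11}. (inv' k \<circ> g \<circ> k) i = i}"
      then have "k (inv' k (g (k i))) = k i" by simp
      then show "k i \<in> {i \<in> {1..11}. g i = i}"
        using i permutes_in_image[OF k, of i] by (simp add: permutes_inverses(1)[OF k])
    qed
    show "inv' k \<in> {i \<in> {1..11}. g i = i} \<rightarrow> {i \<in> {1..11}. (inv' k \<circ> g \<circ> k) i = i}"
      using permutes_in_image[OF permutes_inv[OF k]] permutes_inverses[OF k] by auto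
  qed (simp_all add: permutes_inverses[OF k])
  from h show ?thesis
    unfolding cycle_data_def pow iff bij_betw_same_card[OF bij] .
qed

text \<open>\<open>word_perm\<close> of a replicated list is an evaluable form of a power; powers
  are taken of the image list rather than of the long word.\<close>

lemma representatives_correct:
  "list_all (\<lambda>(l, w, m, f). map (word_perm w) [1..<12] = l \<and> m > 0
     \<and> map (word_perm (replicate m (perm_of l))) [1..<12] = [1..<12]
     \<and> list_all (\<lambda>k. map (word_perm (replicate k (perm_of l))) [1..<12] \<noteq> [1..<12]) [1..<m]
     \<and> length (filter (\<lambda>i. perm_of l i = i) [1..<12]) = f) representatives"
  by code_simp

definition cycle_types :: "(nat \<times> nat) set" where
  "cycle_types = {(1,11), (2,3), (3,2), (4,3), (5,1), (6,0), (8,1), (11,0)}"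

lemma representatives_cycle_types: "\<forall>(l, w, m, f)\<in>set representatives. (m, f) \<in> cycle_types"
  by (simp add: representatives_def cycle_types_def)

lemma representatives_words: "\<forall>(l, w, m, f)\<in>set representatives. set w \<subseteq> {gen_a, gen_b}"
  by (simp add: representatives_def)

text \<open>By sharp 4-transitivity the images of 1, 2, 3, 4 already identify the
  representative.\<close>

definition representative_heads :: "nat list list" where
  "representative_heads = map (\<lambda>(l, w). take 4 l) representatives"

text \<open>The patterns account for 8 + 8 + 1 + 1 = 18 representatives.\<close>

lemma representatives_images:
  "list_all (\<lambda>x. [2,3,4,x] \<in> set representative_heads) [1,5,6,7,8,9,10,11]"
  "list_all (\<lambda>x. [2,3,1,x] \<in> set representative_heads) [4..<12]"
  "[2,1,4,3] \<in> set representative_heads"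
  "[2,1,3,4] \<in> set representative_heads"
  by code_simp+

lemma representative_data:
  assumes r: "(l, w, m, f) \<in> set representatives"
  shows "word_perm w \<in> block_perms" "map (word_perm w) [1,2,3,4] = take 4 l" "cycle_data (word_perm w) m f"
proof -
  note rc = bspec[OF representatives_correct[unfolded list_all_iff[of _ representatives]] r,
      unfolded prod.case word_perm_replicate]
  from rc have wl: "map (word_perm w) [1..<12] = l"
    and pm: "m > 0" "map (perm_of l ^^ m) [1..<12] = [1..<12]"
      "list_all (\<lambda>k. map (perm_of l ^^ k) [1..<12] \<noteq> [1..<12]) [1..<m]"
      "length (filter (\<lambda>i. perm_of l i = i) [1..<12]) = f"
    by blast+
  show wb: "word_perm w \<in> block_perms"
    using representatives_words r by (intro word_perm_block_perms) auto
  have "take 4 [1..<12] = [1,2,3,4::nat]" by (simp add: upt_rec)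
  then show "map (word_perm w) [1,2,3,4] = take 4 l"
    unfolding wl[symmetric] take_map by simp
  have len: "length l = 11" by (simp flip: wl)
  have "perm_of l i = word_perm w i" for i
  proof (cases "i \<in> {1..11}")
    case True
    then have "l ! (i - 1) = word_perm w ([1..<12] ! (i - 1))"
      unfolding wl[symmetric] by (intro nth_map) auto
    also have "[1..<12] ! (i - 1) = i" using True by (subst nth_upt) auto
    finally show ?thesis using True len by (simp add: perm_of_def)
  next
    case False
    then show ?thesis
      using block_perms_permutes[OF wb] len by (auto simp: perm_of_def permutes_def)
  qed
  then have "perm_of l = word_perm w" by auto
  then show "cycle_data (word_perm w) m f"
    using cycle_dataI[OF block_perms_permutes[OF wb]] pm by simp
qed

lemma cycle_data_of_images:
  assumes h: "h \<in> block_perms" and im: "map h [1,2,3,4] \<in> set representative_heads"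
  shows "\<exists>(m, f)\<in>cycle_types. cycle_data h m f"
proof -
  obtain l w m f where r: "(l, w, m, f) \<in> set representatives" "map h [1,2,3,4] = take 4 l"
    using im by (auto simp: representative_heads_def)
  have "h = word_perm w"
    by (rule block_perms_eqI[OF h]) (simp_all only: representative_data[OF r(1)] r(2))
  then have "cycle_data h m f" using representative_data(3)[OF r(1)] by simp
  then show ?thesis using representatives_cycle_types r(1) by blast
qed

text \<open>Four points are chosen along the orbits of \<open>g\<close>: inside an orbit of length
  at least 4; else a 3-cycle and one more point; else two 2-cycles; else a 2-cycle and two fixed
  points. Conjugating them to 1, 2, 3, 4 produces one of the listed heads.\<close>

lemma block_perms_cycle_data:
  assumes g: "g \<in> block_perms"
  shows "\<exists>(m, f)\<in>cycle_types. cycle_data g m f"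
proof (cases "g = id")
  case True
  have "g ^^ k = id" for k using True by (induction k) auto
  moreover have "{i \<in> {1..11}. g i = i} = {1..11}" using True by auto
  ultimately have "cycle_data g 1 11" unfolding cycle_data_def by simp
  then show ?thesis by (auto simp: cycle_types_def)
next
  case False
  have perm: "g permutes {1..11}" by (rule block_perms_permutes[OF g])
  have inj: "g x = g y \<longleftrightarrow> x = y" for x y
    using permutes_inj[OF perm] by (auto dest: injD)
  have ran: "g x \<in> {1..11} \<longleftrightarrow> x \<in> {1..11}" for x
    by (rule permutes_in_image[OF perm])
  obtain a where a: "g a \<noteq> a" using False by (auto simp: fun_eq_iff)
  then have a11: "a \<in> {1..11}" using perm by (auto simp: permutes_def)
  text \<open>Conjugate four distinct points \<open>x, y, z, t\<close> to \<open>1, 2, 3, 4\<close>.\<close>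
  have main: ?thesis
    if dist: "distinct [x, y, z, t]" and sub: "set [x, y, z, t] \<subseteq> {1..11}"
      and im: "\<And>k. k \<in> block_perms \<Longrightarrow> k 1 = x \<Longrightarrow> k 2 = y \<Longrightarrow> k 3 = z \<Longrightarrow> k 4 = t \<Longrightarrow>
        (\<And>i. inv' k (k i) = i) \<Longrightarrow> (\<And>p. p \<in> {1..11} \<Longrightarrow> inv' k p \<in> {1..11}) \<Longrightarrow> (\<And>p q. inv' k p = inv' k q \<longleftrightarrow> p = q) \<Longrightarrow>
        [inv' k (g x), inv' k (g y), inv' k (g z), inv' k (g t)]
          \<in> set representative_heads"
    for x y z t
  proof -
    obtain k where k: "k \<in> block_perms" "k 1 = x" "k 2 = y" "k 3 = z" "k 4 = t"
      using block_perms_4_transitive[OF dist sub] by metis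
    have kp: "k permutes {1..11}" by (rule block_perms_permutes[OF k(1)])
    have "inv' k \<circ> g \<circ> k \<in> block_perms"
      by (intro comp_block_perms inv_block_perms k g)
    moreover have "map (inv' k \<circ> g \<circ> k) [1,2,3,4] \<in> set representative_heads"
      using im[OF k] permutes_inverses[OF kp] permutes_in_image[OF permutes_inv[OF kp]] k
        permutes_inj[OF permutes_inv[OF kp]] by (simp add: inj_eq)
    ultimately obtain m f where "(m, f) \<in> cycle_types" "cycle_data (inv' k \<circ> g \<circ> k) m f"
      using cycle_data_of_images by blast
    then show ?thesis using cycle_data_conj[OF kp] by blast
  qed
  have rep: "[2,3,4,x] \<in> set representative_heads" if "x \<in> {1..11}" "x \<notin> {2,3,4}" for x
  proof -
    have "x < 12" "x \<noteq> 0" using that(1) by auto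
    then have "x \<in> set [1,5,6,7,8,9,10,11]" using less_12_cases[of x] that(2) by simp
    then show ?thesis by (rule bspec[OF representatives_images(1)[unfolded list_all_iff]])
  qed
  have rep3: "[2,3,1,x] \<in> set representative_heads" if "x \<in> {1..11}" "x \<notin> {1,2,3}" for x
  proof -
    have "x \<in> {4..<12}" using that by auto
    then have "x \<in> set [4..<12]" by (simp only: set_upt)
    then show ?thesis by (rule bspec[OF representatives_images(2)[unfolded list_all_iff]])
  qed
  have other: "\<exists>d\<in>{1..11}. d \<notin> set xs" if "length xs < 11" for xs :: "nat list"
  proof (rule ccontr)
    assume "\<not> ?thesis"
    then have "{1..11} \<subseteq> set xs" by auto
    then have "card {1..11::nat} \<le> card (set xs)" by (intro card_mono) auto
    then show False using card_length[of xs] that by simp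
  qed
  show ?thesis
  proof (cases "\<exists>x. distinct [x, g x, g (g x), g (g (g x))]")
    case True
    then obtain x where x: "distinct [x, g x, g (g x), g (g (g x))]" by blast
    then have "x \<in> {1..11}" using perm by (auto simp: permutes_def)
    then have s: "set [x, g x, g (g x), g (g (g x))] \<subseteq> {1..11}" by (simp add: ran[unfolded One_nat_def] del: atLeastAtMost_iff)
    show ?thesis
    proof (rule main[OF x s])
      fix k assume k: "k \<in> block_perms" "k 1 = x" "k 2 = g x" "k 3 = g (g x)" "k 4 = g (g (g x))"
        "\<And>i. inv' k (k i) = i" "\<And>p. p \<in> {1..11} \<Longrightarrow> inv' k p \<in> {1..11}"
        "\<And>p q. inv' k p = inv' k q \<longleftrightarrow> p = q"
      have e: "inv' k (g x) = 2" "inv' k (g (g x)) = 3" "inv' k (g (g (g x))) = 4"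
        using k(6)[of 2] k(6)[of 3] k(6)[of 4] k by simp_all
      have "inv' k (g (g (g (g x)))) \<notin> {2,3,4}"
        unfolding e[symmetric] insert_iff k(8) using x inj by auto
      moreover have "inv' k (g (g (g (g x)))) \<in> {1..11}"
        using s by (intro k(7)) (simp add: ran[unfolded One_nat_def] del: atLeastAtMost_iff)
      ultimately show "[inv' k (g x), inv' k (g (g x)), inv' k (g (g (g x))), inv' k (g (g (g (g x))))]
          \<in> set representative_heads"
        using rep e by simp
    qed
  next
    case no4: False
    show ?thesis
    proof (cases "\<exists>x. distinct [x, g x, g (g x)]")
      case True
      then obtain x where x: "distinct [x, g x, g (g x)]" by blast
      then have xm: "x \<in> {1..11}" using perm by (auto simp: permutes_def)
      have ggg: "g (g (g x)) = x" using no4 x inj by auto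
      obtain d where d: "d \<in> {1..11}" "d \<notin> set [x, g x, g (g x)]" using other[of "[x, g x, g (g x)]"] by auto
      have dd: "distinct [x, g x, g (g x), d]" using x d by auto
      have s: "set [x, g x, g (g x), d] \<subseteq> {1..11}" using xm d by (simp add: ran[unfolded One_nat_def] del: atLeastAtMost_iff)
      show ?thesis
      proof (rule main[OF dd s])
        fix k assume k: "k \<in> block_perms" "k 1 = x" "k 2 = g x" "k 3 = g (g x)" "k 4 = d"
          "\<And>i. inv' k (k i) = i" "\<And>p. p \<in> {1..11} \<Longrightarrow> inv' k p \<in> {1..11}"
          "\<And>p q. inv' k p = inv' k q \<longleftrightarrow> p = q"
        have e: "inv' k x = 1" "inv' k (g x) = 2" "inv' k (g (g x)) = 3"
          using k(6)[of 1] k(6)[of 2] k(6)[of 3] by (simp_all only: k(2-4))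
        have "g d \<notin> {x, g x, g (g x)}"
        proof
          assume "g d \<in> {x, g x, g (g x)}"
          then have "g d \<in> {g (g (g x)), g x, g (g x)}" by (simp only: ggg)
          then show False using d inj by auto
        qed
        then have "inv' k (g d) \<notin> {1,2,3}"
          unfolding e[symmetric] insert_iff k(8) by auto
        moreover have "inv' k (g d) \<in> {1..11}"
          using d by (intro k(7)) (simp add: ran[unfolded One_nat_def] del: atLeastAtMost_iff)
        ultimately have "[2, 3, 1, inv' k (g d)] \<in> set representative_heads" by (intro rep3)
        then show "[inv' k (g x), inv' k (g (g x)), inv' k (g (g (g x))), inv' k (g d)] \<in> set representative_heads"
          by (simp only: ggg e)
      qed
    next
      case no3: False
      have gg: "g (g x) = x" for x
      proof -
        have "\<not> distinct [x, g x, g (g x)]" using no3 by blast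
        then have "x = g x \<or> x = g (g x)" using inj[of x "g x"] by auto
        then show ?thesis by metis
      qed
      show ?thesis
      proof (cases "\<exists>d. d \<notin> {a, g a} \<and> g d \<noteq> d")
        case True
        then obtain d where d: "d \<notin> {a, g a}" "g d \<noteq> d" by blast
        then have dm: "d \<in> {1..11}" using perm by (auto simp: permutes_def)
        have "g d \<noteq> a" "g d \<noteq> g a" using d gg inj by force+
        then have dd: "distinct [a, g a, d, g d]" using a d by auto
        have s: "set [a, g a, d, g d] \<subseteq> {1..11}" using a11 dm by (simp add: ran[unfolded One_nat_def] del: atLeastAtMost_iff)
        show ?thesis
        proof (rule main[OF dd s])
          fix k :: "nat \<Rightarrow> nat"
          assume k: "k 1 = a" "k 2 = g a" "k 3 = d" "k 4 = g d" "\<And>i. inv' k (k i) = i"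
          have "inv' k a = 1" "inv' k (g a) = 2" "inv' k d = 3" "inv' k (g d) = 4"
            using k(5)[of 1] k(5)[of 2] k(5)[of 3] k(5)[of 4] by (simp_all only: k(1-4))
          then show "[inv' k (g a), inv' k (g (g a)), inv' k (g d), inv' k (g (g d))] \<in> set representative_heads"
            by (simp only: gg representatives_images)
        qed
      next
        \<comment> \<open>Here \<open>g\<close> only swaps \<open>a\<close> and \<open>g a\<close>;
          two further points give the head [2,1,3,4].\<close>
        case fixed: False
        obtain c where c: "c \<in> {1..11}" "c \<notin> set [a, g a]" using other[of "[a, g a]"] by auto
        obtain d where d: "d \<in> {1..11}" "d \<notin> set [a, g a, c]" using other[of "[a, g a, c]"] by auto
        have dd: "distinct [a, g a, c, d]" using a c d by auto
        have s: "set [a, g a, c, d] \<subseteq> {1..11}" using a11 c d by (simp add: ran[unfolded One_nat_def] del: atLeastAtMost_iff)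
        show ?thesis
        proof (rule main[OF dd s])
          fix k :: "nat \<Rightarrow> nat"
          assume k: "k 1 = a" "k 2 = g a" "k 3 = c" "k 4 = d" "\<And>i. inv' k (k i) = i"
          have "inv' k a = 1" "inv' k (g a) = 2" "inv' k c = 3" "inv' k d = 4"
            using k(5)[of 1] k(5)[of 2] k(5)[of 3] k(5)[of 4] by (simp_all only: k(1-4))
          moreover have "g c = c" "g d = d" using fixed c d by auto
          ultimately show "[inv' k (g a), inv' k (g (g a)), inv' k (g c), inv' k (g d)] \<in> set representative_heads"
            by (simp only: gg representatives_images)
        qed
      qed
    qed
  qed
qed

section \<open>M11 inside the block-preserving permutations\<close>

lemma M11_mult: "g \<otimes>\<^bsub>M11\<^esub> h = g \<circ> h"
  by (simp add: M11_def subgroup_generated_def sym_group_def)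

lemma M11_one: "\<one>\<^bsub>M11\<^esub> = id"
  by (simp add: M11_def subgroup_generated_def sym_group_def)

lemma M11_pow: "g [^]\<^bsub>M11\<^esub> (n::nat) = g ^^ n"
  by (induction n) (simp_all add: M11_mult M11_one funpow_Suc_right del: funpow.simps(2))

lemma M11_group: "group M11"
  unfolding M11_def by (rule group.group_subgroup_generated[OF sym_group_is_group])

lemma gen_permutes: "gen_a permutes {1..11}" "gen_b permutes {1..11}"
  using gen_a_block_perms gen_b_block_perms by (simp_all add: block_perms_def)

lemma M11_carrier: "carrier M11 = generate (sym_group 11) {gen_a, gen_b}"
proof -
  have "carrier (sym_group 11) \<inter> {gen_a, gen_b} = {gen_a, gen_b}"
    using gen_permutes by (auto simp: sym_group_carrier)
  then show ?thesis
    unfolding M11_def carrier_subgroup_generated gen_a_eq[symmetric] gen_b_eq[symmetric] by (simp only:)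
qed

lemma M11_block_perms: "g \<in> carrier M11 \<Longrightarrow> g \<in> block_perms"
  unfolding M11_carrier
proof (induction rule: generate.induct)
  case (inv h)
  then have "h \<in> carrier (sym_group 11)" using gen_permutes by (auto simp: sym_group_carrier)
  then show ?case
    using inv gen_a_block_perms gen_b_block_perms inv_block_perms by auto
next
  case one
  show ?case by (simp only: sym_group_one id_block_perms)
next
  case (incl h)
  then show ?case using gen_a_block_perms gen_b_block_perms by auto
next
  case (eng h1 h2)
  then show ?case by (simp only: sym_group_mult comp_block_perms)
qed

lemma M11_finite: "finite (carrier M11)"
proof (rule finite_subset)
  show "carrier M11 \<subseteq> {g. g permutes {1..11}}"
    using M11_block_perms block_perms_permutes by auto
qed (simp add: finite_permutations)

interpretation M11: finite_group M11
  by (intro finite_group.intro M11_group finite_group_axioms.intro M11_finite)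

lemma M11_ord:
  assumes "g \<in> carrier M11" "cycle_data g m f"
  shows "M11.ord g = m"
  using assms M11.ord_unique[of g m] by (simp add: M11_pow M11_one cycle_data_def)

lemma M11_cycle_types:
  assumes "g \<in> carrier M11"
  shows "(M11.ord g, card {i \<in> {1..11}. g i = i}) \<in> cycle_types"
proof -
  obtain m f where "(m, f) \<in> cycle_types" "cycle_data g m f"
    using block_perms_cycle_data[OF M11_block_perms[OF assms]] by blast
  then show ?thesis using M11_ord[OF assms] by (auto simp: cycle_data_def)
qed

lemma M11_word: "set w \<subseteq> {gen_a, gen_b} \<Longrightarrow> word_perm w \<in> carrier M11"
proof (induction w)
  case Nil
  then show ?case using M11.one_closed by (simp only: word_perm_Nil M11_one)
next
  case (Cons x w)
  then have "x \<in> carrier M11" by (auto simp: M11_carrier intro: generate.incl)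
  then have "x \<otimes>\<^bsub>M11\<^esub> word_perm w \<in> carrier M11" using Cons by (intro M11.m_closed) auto
  then show ?case by (simp only: word_perm_Cons M11_mult)
qed

lemma M11_ord_exists:
  assumes "m \<in> {2, 3, 5, 6, 11}"
  shows "\<exists>g\<in>carrier M11. M11.ord g = m"
proof -
  have "\<exists>(l, w, m', f)\<in>set representatives. m' = m"
    using assms by (auto simp: representatives_def)
  then obtain l w f where r: "(l, w, m, f) \<in> set representatives" by auto
  then have w: "set w \<subseteq> {gen_a, gen_b}" using representatives_words by auto
  show ?thesis
    using M11_word[OF w] M11_ord[OF _ representative_data(3)[OF r]] by blast
qed

section \<open>Torsion units of the group ring of the Mathieu group\<close>

text \<open>The two products are conjugate, as (xy)^n x = x (yx)^n shows. Functions of the order are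
  therefore class functions.\<close>

lemma (in group) ord_mult_commute:
  assumes "g \<in> carrier G" "h \<in> carrier G"
  shows "ord (g \<otimes> h) = ord (h \<otimes> g)"
proof -
  have pow: "(x \<otimes> y) [^] n \<otimes> x = x \<otimes> (y \<otimes> x) [^] n" if "x \<in> carrier G" "y \<in> carrier G" for x y and n :: nat
  proof (induction n)
    case (Suc n)
    have "(x \<otimes> y) [^] Suc n \<otimes> x = ((x \<otimes> y) [^] n \<otimes> x) \<otimes> (y \<otimes> x)"
      using that by (simp add: m_assoc)
    also have "\<dots> = x \<otimes> (y \<otimes> x) [^] Suc n"
      unfolding Suc using that by (simp add: m_assoc)
    finally show ?case .
  qed (use that in simp)
  have "(x \<otimes> y) [^] n = \<one>" if "(y \<otimes> x) [^] n = \<one>" "x \<in> carrier G" "y \<in> carrier G" for x y and n :: nat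
    using pow[OF that(2,3), of n] that by (simp add: r_cancel_one)
  then have "(h \<otimes> g) [^] n = \<one> \<longleftrightarrow> ord (g \<otimes> h) dvd n" for n :: nat
    using assms pow_eq_id[of "g \<otimes> h" n] by blast
  then show ?thesis using ord_unique[of "h \<otimes> g" "ord (g \<otimes> h)"] assms by simp
qed

lemma (in finite_group) class_fun_ord: "class_fun (\<lambda>g. \<phi> (ord g))"
  unfolding class_fun_def using ord_mult_commute by auto

section \<open>Coefficient sums by element order and the permutation character\<close>

definition M11_orders :: "nat set" where
  "M11_orders = {1, 2, 3, 4, 5, 6, 8, 11}"

text \<open>The permutation character as a function of the order; the default 0 covers orders 6 and
  11.\<close>

definition fixes_of_order :: "nat \<Rightarrow> int" where
  "fixes_of_order m = (if m = 1 then 11 else if m \<in> {2, 4} then 3 else if m = 3 then 2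
     else if m \<in> {5, 8} then 1 else 0)"

lemma M11_ord_in: "g \<in> carrier M11 \<Longrightarrow> M11.ord g \<in> M11_orders"
  using M11_cycle_types[of g] by (auto simp: cycle_types_def M11_orders_def)

lemma M11_fixes: "g \<in> carrier M11 \<Longrightarrow> int (card {i \<in> {1..11}. g i = i}) = fixes_of_order (M11.ord g)"
  using M11_cycle_types[of g] by (auto simp: cycle_types_def fixes_of_order_def)

lemma M11_ord_pow: "g \<in> carrier M11 \<Longrightarrow> k > 0 \<Longrightarrow> M11.ord (g [^]\<^bsub>M11\<^esub> k) = M11.ord g div gcd (M11.ord g) k"
  using M11.ord_pow_gen[of g k] by simp

text \<open>The trace of a group ring element on the permutation module of degree 11.\<close>

definition tr11 :: "((nat \<Rightarrow> nat) \<Rightarrow>\<^sub>0 int) \<Rightarrow> int" where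
  "tr11 u = lin (\<lambda>g. fixes_of_order (M11.ord g)) u"

text \<open>A sum of partial augmentations: classes of equal order, such as the two of order 8, are
  merged, because the permutation character sees only the order.\<close>

definition coeff_ord :: "nat \<Rightarrow> ((nat \<Rightarrow> nat) \<Rightarrow>\<^sub>0 int) \<Rightarrow> int" where
  "coeff_ord m u = lin (\<lambda>g. of_bool (M11.ord g = m)) u"

text \<open>The points 1, ..., 11 are shifted down by one to serve as matrix indices.\<close>

interpretation R11: perm_rep M11 11 "\<lambda>g i. g (Suc i) - Suc 0"
proof
  fix g :: "nat \<Rightarrow> nat" and i :: nat assume g: "g \<in> carrier M11" and i: "i < 11"
  have p: "g permutes {1..11}" using g by (intro block_perms_permutes M11_block_perms)
  have gi: "g (Suc i) \<in> {1..11}" using i permutes_in_image[OF p, of "Suc i"] by simp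
  then show "g (Suc i) - Suc 0 < 11" by auto
next
  fix g h :: "nat \<Rightarrow> nat" and i :: nat assume h: "h \<in> carrier M11" and i: "i < 11"
  have p: "h permutes {1..11}" using h by (intro block_perms_permutes M11_block_perms)
  have "h (Suc i) \<in> {1..11}" using i permutes_in_image[OF p, of "Suc i"] by simp
  then have "Suc (h (Suc i) - Suc 0) = h (Suc i)" by auto
  then show "(g \<otimes>\<^bsub>M11\<^esub> h) (Suc i) - Suc 0 = g (Suc (h (Suc i) - Suc 0)) - Suc 0" by (simp add: M11_mult)
qed (simp add: M11_one)

lemma fix_count_M11:
  assumes "g \<in> carrier M11"
  shows "R11.fix_count g = fixes_of_order (M11.ord g)"
proof -
  have p: "g permutes {1..11}" using assms by (intro block_perms_permutes M11_block_perms)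
  have "g (Suc i) - Suc 0 = i \<longleftrightarrow> g (Suc i) = Suc i" if "i < 11" for i
  proof -
    have "g (Suc i) \<in> {1..11}" using that permutes_in_image[OF p, of "Suc i"] by simp
    then have "g (Suc i) \<ge> 1" by (simp only: atLeastAtMost_iff)
    then show ?thesis by linarith
  qed
  then have "bij_betw Suc {i. i < 11 \<and> g (Suc i) - Suc 0 = i} {i \<in> {1..11}. g i = i}"
    by (intro bij_betwI[where g = "\<lambda>i. i - 1"]) auto
  then have "card {i. i < 11 \<and> g (Suc i) - Suc 0 = i} = card {i \<in> {1..11}. g i = i}"
    by (rule bij_betw_same_card)
  then show ?thesis using M11_fixes[OF assms] by (simp only: R11.fix_count_def)
qed

lemma lin_fix_count_M11: "u \<in> carrier M11.ZG \<Longrightarrow> lin R11.fix_count u = tr11 u"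
  unfolding tr11_def using fix_count_M11 by (intro lin_cong) (auto simp: M11.ZG_carrier)

lemma lin_ord_expand:
  assumes "u \<in> carrier M11.ZG"
  shows "lin (\<lambda>g. \<phi> (M11.ord g)) u = (\<Sum>m\<in>M11_orders. \<phi> m * coeff_ord m u)"
proof -
  have fin: "finite M11_orders" by (simp add: M11_orders_def)
  have "lin (\<lambda>g. \<phi> (M11.ord g)) u = lin (\<lambda>g. \<Sum>m\<in>M11_orders. \<phi> m * of_bool (M11.ord g = m)) u"
  proof (rule lin_cong)
    fix g assume "g \<in> Poly_Mapping.keys u"
    then have "M11.ord g \<in> M11_orders" using assms M11_ord_in by (auto simp: M11.ZG_carrier)
    then have "(\<Sum>m\<in>M11_orders. \<phi> m * of_bool (M11.ord g = m)) = (\<Sum>m\<in>{M11.ord g}. \<phi> m * of_bool (M11.ord g = m))"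
      using fin by (intro sum.mono_neutral_right) auto
    then show "\<phi> (M11.ord g) = (\<Sum>m\<in>M11_orders. \<phi> m * of_bool (M11.ord g = m))" by simp
  qed
  then show ?thesis by (simp only: lin_fun_sum lin_fun_scale coeff_ord_def)
qed

lemma augmentation_expand: "u \<in> carrier M11.ZG \<Longrightarrow> augmentation u = (\<Sum>m\<in>M11_orders. coeff_ord m u)"
  using lin_ord_expand[of u "\<lambda>_. 1"] by (simp add: augmentation_lin)

lemma tr11_expand: "u \<in> carrier M11.ZG \<Longrightarrow> tr11 u = (\<Sum>m\<in>M11_orders. fixes_of_order m * coeff_ord m u)"
  unfolding tr11_def by (rule lin_ord_expand)

text \<open>The exponent 3 suffices because p^4 is at least 16 and element orders are at most 11: a
  p^3-th power has order prime to p and so never order m.\<close>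

lemma coeff_ord_eq_0:
  fixes n p m :: nat
  assumes u: "u \<in> carrier M11.ZG" "u [^]\<^bsub>M11.ZG\<^esub> n = \<one>\<^bsub>M11.ZG\<^esub>" "n > 0"
    and p: "prime p" "coprime p n" "p dvd m"
  shows "coeff_ord m u = 0"
  unfolding coeff_ord_def
proof (rule M11.lin_eq_0_of_vanishing_on_powers[OF u p(1,2) M11.class_fun_ord, of _ 3])
  fix g assume g: "g \<in> carrier M11"
  have p0: "p > 0" using p(1) by (rule prime_gt_0_nat)
  have "M11.ord (g [^]\<^bsub>M11\<^esub> (p ^ 3)) \<noteq> m"
  proof
    define k where "k = M11.ord g"
    assume "M11.ord (g [^]\<^bsub>M11\<^esub> (p ^ 3)) = m"
    then have "p dvd k div gcd k (p ^ 3)" using p(3) p0 g M11_ord_pow[of g "p ^ 3"] by (simp add: k_def)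
    then have "gcd k (p ^ 3) * p dvd gcd k (p ^ 3) * (k div gcd k (p ^ 3))"
      by (rule mult_dvd_mono[OF dvd_refl])
    then have dv: "gcd k (p ^ 3) * p dvd k" by simp
    have kO: "k \<in> M11_orders" unfolding k_def by (rule M11_ord_in[OF g])
    then have k: "k > 0" "k \<le> 11" by (auto simp: M11_orders_def)
    obtain i where i: "i \<le> 3" "gcd k (p ^ 3) = p ^ i"
      using divides_primepow_nat[OF p(1), of "gcd k (p ^ 3)" 3] by auto
    have dvi: "p ^ Suc i dvd k" using dv i by (simp add: mult.commute)
    show False
    proof (cases "i = 3")
      case True
      then have "p ^ 4 dvd k" using dvi by (simp add: eval_nat_numeral)
      then have "p ^ 4 \<le> 11" using k by (meson dvd_imp_le le_trans)
      moreover have "2 ^ 4 \<le> p ^ 4" using prime_ge_2_nat[OF p(1)] by (rule power_mono) simp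
      ultimately show False by simp
    next
      case False
      then have "p ^ Suc i dvd p ^ 3" using i by (intro le_imp_power_dvd) simp
      then have "p ^ Suc i dvd p ^ i" using dvi i(2) gcd_greatest by metis
      then show False using p0 prime_gt_1_nat[OF p(1)] by (simp add: dvd_power_iff)
    qed
  qed
  then show "of_bool (M11.ord (g [^]\<^bsub>M11\<^esub> (p ^ 3)) = m) = (0::int)" by simp
qed

text \<open>The number of fixed points of g^l is congruent modulo l to that of g. If l does not
  divide the order of g, then g^l has the same order; the other cases are read off the
  table.\<close>

lemma tr11_cong:
  assumes u: "u \<in> carrier M11.ZG" and l: "prime (l::nat)"
  shows "[tr11 (u [^]\<^bsub>M11.ZG\<^esub> l) = tr11 u] (mod int l)"
proof -
  have l0: "l > 0" using l by (rule prime_gt_0_nat)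
  have table: "[fixes_of_order (m div gcd m l) = fixes_of_order m] (mod int l)" if m: "m \<in> M11_orders" for m
  proof (cases "coprime m l")
    case True
    then show ?thesis by simp
  next
    case False
    then have dvd: "l dvd m" using prime_imp_coprime[OF l] coprime_commute by metis
    have "l \<in> {2, 3, 5, 11}"
    proof -
      \<comment> \<open>The product is 1320, the least common multiple of the element
        orders.\<close>
      have "m dvd 2 * (2 * (2 * (3 * (5 * 11))))" using m by (auto simp: M11_orders_def)
      with dvd have "l dvd 2 * (2 * (2 * (3 * (5 * 11))))" by (rule dvd_trans)
      then have "l dvd 2 \<or> l dvd 3 \<or> l dvd 5 \<or> l dvd 11"
        by (simp only: prime_dvd_mult_iff[OF l]) blast
      moreover have "prime (2::nat)" "prime (3::nat)" "prime (5::nat)" "prime (11::nat)" by simp_all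
      ultimately show ?thesis using primes_dvd_imp_eq[OF l] by blast
    qed
    moreover have "\<forall>m\<in>M11_orders. \<forall>l\<in>{2, 3, 5, 11}. l dvd m \<longrightarrow>
        [fixes_of_order (m div l) = fixes_of_order m] (mod int l)"
      by (simp add: M11_orders_def fixes_of_order_def cong_def)
    ultimately have "[fixes_of_order (m div l) = fixes_of_order m] (mod int l)"
      using m dvd by blast
    moreover have "gcd m l = l" using dvd by (simp add: gcd_nat.absorb2)
    ultimately show ?thesis by (simp only:)
  qed
  have "[tr11 (u [^]\<^bsub>M11.ZG\<^esub> l) = lin (\<lambda>g. fixes_of_order (M11.ord (g [^]\<^bsub>M11\<^esub> l))) u] (mod int l)"
    unfolding tr11_def by (rule M11.lin_prime_power_cong[OF u l M11.class_fun_ord])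
  also have "[lin (\<lambda>g. fixes_of_order (M11.ord (g [^]\<^bsub>M11\<^esub> l))) u = tr11 u] (mod int l)"
    unfolding tr11_def
  proof (rule lin_cong_mod)
    fix g assume "g \<in> Poly_Mapping.keys u"
    then have g: "g \<in> carrier M11" using u by (auto simp: M11.ZG_carrier)
    show "[fixes_of_order (M11.ord (g [^]\<^bsub>M11\<^esub> l)) = fixes_of_order (M11.ord g)] (mod int l)"
      using table[OF M11_ord_in[OF g]] M11_ord_pow[OF g l0] by simp
  qed
  finally show ?thesis .
qed

lemma abs_tr11_le:
  fixes n :: nat
  assumes "u \<in> carrier M11.ZG" "u [^]\<^bsub>M11.ZG\<^esub> n = \<one>\<^bsub>M11.ZG\<^esub>" "n > 0"
  shows "\<bar>tr11 u\<bar> \<le> 11"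
  using R11.abs_lin_fix_count_le[OF assms] lin_fix_count_M11[OF assms(1)] by simp

lemma torsion_pow:
  fixes n k :: nat
  assumes "u \<in> carrier M11.ZG" "u [^]\<^bsub>M11.ZG\<^esub> n = \<one>\<^bsub>M11.ZG\<^esub>"
  shows "(u [^]\<^bsub>M11.ZG\<^esub> k) [^]\<^bsub>M11.ZG\<^esub> n = \<one>\<^bsub>M11.ZG\<^esub>"
  using assms by (simp add: M11.ZG.nat_pow_pow mult.commute[of k] flip: M11.ZG.nat_pow_pow[of u n k])

text \<open>
  For a prime \<open>l > 22\<close> the congruence modulo \<open>l\<close> between two integers of absolute value at most 11 is
  an equality, and every residue class prime to \<open>n\<close> contains a product of such primes.
\<close>

lemma tr11_pow_coprime:
  fixes n k :: nat
  assumes u: "u \<in> carrier M11.ZG" "u [^]\<^bsub>M11.ZG\<^esub> n = \<one>\<^bsub>M11.ZG\<^esub>" "n > 0"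
    and k: "coprime k n"
  shows "tr11 (u [^]\<^bsub>M11.ZG\<^esub> k) = tr11 u"
proof -
  have large: "tr11 (u [^]\<^bsub>M11.ZG\<^esub> x) = tr11 u" if "x > 0" "\<And>l. prime l \<Longrightarrow> l dvd x \<Longrightarrow> l > 22" for x :: nat
    using that
  proof (induction x rule: less_induct)
    case (less x)
    show ?case
    proof (cases "x = 1")
      case True
      then show ?thesis using u(1) by simp
    next
      case False
      then obtain l where l: "prime l" "l dvd x" using prime_factor_nat by blast
      then obtain y where y: "x = y * l" by (auto elim: dvdE simp: mult.commute)
      have l22: "l > 22" using less.prems(2) l by blast
      define v where "v = u [^]\<^bsub>M11.ZG\<^esub> y"
      have v: "v \<in> carrier M11.ZG" using u(1) by (simp add: v_def)
      have vn: "v [^]\<^bsub>M11.ZG\<^esub> n = \<one>\<^bsub>M11.ZG\<^esub>" unfolding v_def by (rule torsion_pow[OF u(1,2)])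
      have xl: "u [^]\<^bsub>M11.ZG\<^esub> x = v [^]\<^bsub>M11.ZG\<^esub> l" using u(1) by (simp add: v_def y M11.ZG.nat_pow_pow)
      have "int l dvd tr11 (v [^]\<^bsub>M11.ZG\<^esub> l) - tr11 v"
        using tr11_cong[OF v l(1)] by (simp add: cong_iff_dvd_diff)
      moreover have "\<bar>tr11 (v [^]\<^bsub>M11.ZG\<^esub> l)\<bar> \<le> 11" "\<bar>tr11 v\<bar> \<le> 11"
        using abs_tr11_le[OF v vn u(3)] abs_tr11_le[OF _ torsion_pow[OF v vn] u(3), of l] v by auto
      then have "\<bar>tr11 (v [^]\<^bsub>M11.ZG\<^esub> l) - tr11 v\<bar> < int l" using l22 by linarith
      ultimately have "tr11 (v [^]\<^bsub>M11.ZG\<^esub> l) = tr11 v"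
        using dvd_imp_le_int[of "tr11 (v [^]\<^bsub>M11.ZG\<^esub> l) - tr11 v" "int l"] by force
      moreover have "tr11 v = tr11 u"
        unfolding v_def
      proof (rule less.IH)
        show "y < x" "y > 0" using less.prems(1) y l22 by auto
        show "l' > 22" if "prime l'" "l' dvd y" for l' using less.prems(2)[of l'] that y by simp
      qed
      ultimately show ?thesis using xl by simp
    qed
  qed
  \<comment> \<open>With x = 1 modulo \<open>M\<close> and x = k modulo n, no prime up to 22 divides
    x: those dividing n do not divide k, the others divide \<open>M\<close>. The Chinese remainder
    theorem thus replaces Dirichlet's theorem.\<close>
  define M where "M = \<Prod>{l. prime l \<and> l \<le> 22 \<and> \<not> l dvd n}"
  have fin: "finite {l::nat. prime l \<and> l \<le> 22 \<and> \<not> l dvd n}" by (rule finite_subset[of _ "{..22}"]) auto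
  have "coprime M n"
    unfolding M_def by (rule prod_coprime_left) (auto intro: prime_imp_coprime)
  then obtain x where x: "[x = 1] (mod M)" "[x = k] (mod n)"
    using binary_chinese_remainder_nat[of M n 1 k] by blast
  have big: "l > 22" if l: "prime l" "l dvd x" for l
  proof (rule ccontr)
    assume small: "\<not> l > 22"
    show False
    proof (cases "l dvd n")
      case True
      then have "l dvd k" using x(2) l(2) cong_dvd_iff cong_dvd_modulus_nat by blast
      then show False using True k l(1) by (meson coprime_common_divisor_nat not_prime_unit dvd_refl coprime_def)
    next
      case False
      then have "l dvd M" unfolding M_def using small l(1) fin by (intro dvd_prodI) auto
      then have "l dvd 1" using x(1) l(2) cong_dvd_iff cong_dvd_modulus_nat by blast
      then show False using l(1) by auto
    qed
  qed
  \<comment> \<open>Zero would be divisible by 2, which is not above 22.\<close>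
  have "x > 0"
  proof (rule ccontr)
    assume "\<not> x > 0"
    then show False using big[of 2] by simp
  qed
  then have "tr11 (u [^]\<^bsub>M11.ZG\<^esub> x) = tr11 u" using big by (rule large)
  moreover have red: "u [^]\<^bsub>M11.ZG\<^esub> j = u [^]\<^bsub>M11.ZG\<^esub> (j mod n)" for j
  proof -
    have "u [^]\<^bsub>M11.ZG\<^esub> j = u [^]\<^bsub>M11.ZG\<^esub> (n * (j div n) + j mod n)" by simp
    also have "\<dots> = u [^]\<^bsub>M11.ZG\<^esub> (n * (j div n)) \<otimes>\<^bsub>M11.ZG\<^esub> u [^]\<^bsub>M11.ZG\<^esub> (j mod n)"
      using u(1) by (simp only: M11.ZG.nat_pow_mult)
    also have "u [^]\<^bsub>M11.ZG\<^esub> (n * (j div n)) = \<one>\<^bsub>M11.ZG\<^esub>"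
      using u by (simp flip: M11.ZG.nat_pow_pow)
    finally show ?thesis using u(1) by simp
  qed
  then have "u [^]\<^bsub>M11.ZG\<^esub> x = u [^]\<^bsub>M11.ZG\<^esub> k" using x(2) by (metis cong_def)
  ultimately show ?thesis by simp
qed

text \<open>The finite index type for matrices acting on the group ring of M11.\<close>

typedef m11 = "carrier M11"
  using M11.one_closed by blast

instance m11 :: finite
proof
  have "UNIV = Abs_m11 ` carrier M11"
    using Abs_m11_cases by blast
  then show "finite (UNIV :: m11 set)" using M11_finite finite_imageI by metis
qed

lemma bij_Rep_m11: "bij_betw Rep_m11 UNIV (carrier M11)"
  by (simp add: bij_betw_def inj_on_def Rep_m11_inject type_definition.Rep_range[OF type_definition_m11])

text \<open>The vanishing traces are summed over all g of order 8. For fixed \<open>a\<close>,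
  inverting and conjugating by \<open>a\<close> permutes these g, so the total is the group order
  times the coefficient sum.\<close>

lemma involution_coeff_ord_8:
  assumes u: "u \<in> carrier M11.ZG" "u \<otimes>\<^bsub>M11.ZG\<^esub> u = \<one>\<^bsub>M11.ZG\<^esub>"
  shows "coeff_ord 8 u = 0"
proof -
  define E where "E = {g \<in> carrier M11. M11.ord g = 8}"
  have "0 = (\<Sum>g\<in>E. \<Sum>a\<in>carrier M11. Poly_Mapping.lookup u (inv\<^bsub>M11\<^esub> a \<otimes>\<^bsub>M11\<^esub> (inv\<^bsub>M11\<^esub> g \<otimes>\<^bsub>M11\<^esub> a)))"
    using M11.involution_trace_order_8[OF bij_Rep_m11 u] by (intro sum.neutral[symmetric]) (auto simp: E_def)
  also have "\<dots> = (\<Sum>a\<in>carrier M11. \<Sum>g\<in>E. Poly_Mapping.lookup u (inv\<^bsub>M11\<^esub> a \<otimes>\<^bsub>M11\<^esub> (inv\<^bsub>M11\<^esub> g \<otimes>\<^bsub>M11\<^esub> a)))"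
    by (rule sum.swap)
  also have "\<dots> = (\<Sum>a\<in>carrier M11. coeff_ord 8 u)"
  proof (rule sum.cong[OF refl])
    fix a assume a: "a \<in> carrier M11"
    have ordc: "M11.ord (inv\<^bsub>M11\<^esub> b \<otimes>\<^bsub>M11\<^esub> (inv\<^bsub>M11\<^esub> g \<otimes>\<^bsub>M11\<^esub> b)) = M11.ord g"
      if "g \<in> carrier M11" "b \<in> carrier M11" for g b
    proof -
      have "M11.ord (inv\<^bsub>M11\<^esub> b \<otimes>\<^bsub>M11\<^esub> (inv\<^bsub>M11\<^esub> g \<otimes>\<^bsub>M11\<^esub> b)) = M11.ord (inv\<^bsub>M11\<^esub> g \<otimes>\<^bsub>M11\<^esub> b \<otimes>\<^bsub>M11\<^esub> inv\<^bsub>M11\<^esub> b)"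
        using that by (intro M11.ord_mult_commute) auto
      then show ?thesis using that by (simp add: M11.m_assoc)
    qed
    have inv: "inv\<^bsub>M11\<^esub> (inv\<^bsub>M11\<^esub> b) \<otimes>\<^bsub>M11\<^esub> (inv\<^bsub>M11\<^esub> (inv\<^bsub>M11\<^esub> b \<otimes>\<^bsub>M11\<^esub> (inv\<^bsub>M11\<^esub> g \<otimes>\<^bsub>M11\<^esub> b)) \<otimes>\<^bsub>M11\<^esub> inv\<^bsub>M11\<^esub> b) = g"
      if "g \<in> carrier M11" "b \<in> carrier M11" for g b
    proof -
      have "inv\<^bsub>M11\<^esub> (inv\<^bsub>M11\<^esub> b \<otimes>\<^bsub>M11\<^esub> (inv\<^bsub>M11\<^esub> g \<otimes>\<^bsub>M11\<^esub> b)) = inv\<^bsub>M11\<^esub> b \<otimes>\<^bsub>M11\<^esub> (g \<otimes>\<^bsub>M11\<^esub> b)"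
        using that by (simp add: M11.inv_mult_group M11.m_assoc)
      then have "inv\<^bsub>M11\<^esub> (inv\<^bsub>M11\<^esub> b) \<otimes>\<^bsub>M11\<^esub> (inv\<^bsub>M11\<^esub> (inv\<^bsub>M11\<^esub> b \<otimes>\<^bsub>M11\<^esub> (inv\<^bsub>M11\<^esub> g \<otimes>\<^bsub>M11\<^esub> b)) \<otimes>\<^bsub>M11\<^esub> inv\<^bsub>M11\<^esub> b)
          = (b \<otimes>\<^bsub>M11\<^esub> inv\<^bsub>M11\<^esub> b) \<otimes>\<^bsub>M11\<^esub> g \<otimes>\<^bsub>M11\<^esub> (b \<otimes>\<^bsub>M11\<^esub> inv\<^bsub>M11\<^esub> b)"
        using that by (simp only: M11.inv_inv M11.m_assoc M11.inv_closed M11.m_closed)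
      then show ?thesis using that by simp
    qed
    have "bij_betw (\<lambda>g. inv\<^bsub>M11\<^esub> a \<otimes>\<^bsub>M11\<^esub> (inv\<^bsub>M11\<^esub> g \<otimes>\<^bsub>M11\<^esub> a)) E E"
    proof (rule bij_betwI[where g = "\<lambda>g. inv\<^bsub>M11\<^esub> (inv\<^bsub>M11\<^esub> a) \<otimes>\<^bsub>M11\<^esub> (inv\<^bsub>M11\<^esub> g \<otimes>\<^bsub>M11\<^esub> inv\<^bsub>M11\<^esub> a)"])
      show "(\<lambda>g. inv\<^bsub>M11\<^esub> a \<otimes>\<^bsub>M11\<^esub> (inv\<^bsub>M11\<^esub> g \<otimes>\<^bsub>M11\<^esub> a)) \<in> E \<rightarrow> E"
        using a ordc by (auto simp: E_def)
      show "(\<lambda>g. inv\<^bsub>M11\<^esub> (inv\<^bsub>M11\<^esub> a) \<otimes>\<^bsub>M11\<^esub> (inv\<^bsub>M11\<^esub> g \<otimes>\<^bsub>M11\<^esub> inv\<^bsub>M11\<^esub> a)) \<in> E \<rightarrow> E"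
      proof
        fix g assume "g \<in> E"
        then show "inv\<^bsub>M11\<^esub> (inv\<^bsub>M11\<^esub> a) \<otimes>\<^bsub>M11\<^esub> (inv\<^bsub>M11\<^esub> g \<otimes>\<^bsub>M11\<^esub> inv\<^bsub>M11\<^esub> a) \<in> E"
          using a ordc[of g "inv\<^bsub>M11\<^esub> a"] by (auto simp: E_def)
      qed
      fix g assume "g \<in> E"
      then have g: "g \<in> carrier M11" by (simp add: E_def)
      show "inv\<^bsub>M11\<^esub> (inv\<^bsub>M11\<^esub> a) \<otimes>\<^bsub>M11\<^esub> (inv\<^bsub>M11\<^esub> (inv\<^bsub>M11\<^esub> a \<otimes>\<^bsub>M11\<^esub> (inv\<^bsub>M11\<^esub> g \<otimes>\<^bsub>M11\<^esub> a)) \<otimes>\<^bsub>M11\<^esub> inv\<^bsub>M11\<^esub> a) = g"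
        by (rule inv[OF g a])
      show "inv\<^bsub>M11\<^esub> a \<otimes>\<^bsub>M11\<^esub> (inv\<^bsub>M11\<^esub> (inv\<^bsub>M11\<^esub> (inv\<^bsub>M11\<^esub> a) \<otimes>\<^bsub>M11\<^esub> (inv\<^bsub>M11\<^esub> g \<otimes>\<^bsub>M11\<^esub> inv\<^bsub>M11\<^esub> a)) \<otimes>\<^bsub>M11\<^esub> a) = g"
        using inv[OF g, of "inv\<^bsub>M11\<^esub> a"] a by simp
    qed
    then have "(\<Sum>g\<in>E. Poly_Mapping.lookup u (inv\<^bsub>M11\<^esub> a \<otimes>\<^bsub>M11\<^esub> (inv\<^bsub>M11\<^esub> g \<otimes>\<^bsub>M11\<^esub> a))) = (\<Sum>g\<in>E. Poly_Mapping.lookup u g)"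
      by (rule sum.reindex_bij_betw)
    also have "\<dots> = (\<Sum>g\<in>carrier M11. if M11.ord g = 8 then Poly_Mapping.lookup u g else 0)"
      unfolding E_def by (rule sum.inter_filter[OF M11_finite])
    also have "\<dots> = (\<Sum>g\<in>carrier M11. Poly_Mapping.lookup u g * of_bool (M11.ord g = 8))"
      by (intro sum.cong) auto
    also have "\<dots> = coeff_ord 8 u"
      unfolding coeff_ord_def using u(1) by (intro lin_superset[OF M11_finite, symmetric]) (simp add: M11.ZG_carrier)
    finally show "(\<Sum>g\<in>E. Poly_Mapping.lookup u (inv\<^bsub>M11\<^esub> a \<otimes>\<^bsub>M11\<^esub> (inv\<^bsub>M11\<^esub> g \<otimes>\<^bsub>M11\<^esub> a))) = coeff_ord 8 u" .
  qed
  also have "\<dots> = int (card (carrier M11)) * coeff_ord 8 u" by simp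
  finally have "int (card (carrier M11)) * coeff_ord 8 u = 0" by simp
  moreover have "card (carrier M11) > 0" using M11_finite M11.one_closed by (auto simp: card_gt_0_iff)
  ultimately show ?thesis by simp
qed

section \<open>Traces of units of prime order\<close>

lemma V_pow_ord_eq_1: "u \<in> carrier M11.V \<Longrightarrow> u [^]\<^bsub>M11.ZG\<^esub> M11.V.ord u = \<one>\<^bsub>M11.ZG\<^esub>"
  using M11.V.pow_ord_eq_1[of u] by (simp add: M11.V_pow M11.V_one)

lemma coeff_ord_1:
  assumes "u \<in> carrier M11.V" "M11.V.ord u > 1"
  shows "coeff_ord 1 u = 0"
proof -
  have uZ: "u \<in> carrier M11.ZG" using assms(1) by (rule M11.V_ZG)
  have "u \<noteq> \<one>\<^bsub>M11.ZG\<^esub>" using M11.V.ord_eq_1[OF assms(1)] assms(2) by (auto simp: M11.V_one)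
  then have "Poly_Mapping.lookup u \<one>\<^bsub>M11\<^esub> = 0"
    using M11.torsion_unit_coeff_one[OF assms(1) V_pow_ord_eq_1[OF assms(1)]] assms(2) by simp
  moreover have "coeff_ord 1 u = lin (\<lambda>g. of_bool (g = \<one>\<^bsub>M11\<^esub>)) u"
    unfolding coeff_ord_def using uZ M11.ord_eq_1
    by (intro lin_cong) (simp add: M11.ZG_carrier subset_iff)
  ultimately show ?thesis by (simp add: lin_of_bool)
qed

lemma coeff_ord_supported:
  assumes u: "u \<in> carrier M11.V" "M11.V.ord u > 1" and p: "prime p" "p dvd m" "\<not> p dvd M11.V.ord u"
  shows "coeff_ord m u = 0"
proof (rule coeff_ord_eq_0[OF M11.V_ZG[OF u(1)] V_pow_ord_eq_1[OF u(1)] _ p(1) _ p(2)])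
  show "coprime p (M11.V.ord u)" using p by (simp add: prime_imp_coprime)
qed (use u(2) in simp)

lemma coeff_ord_sum:
  assumes "u \<in> carrier M11.V" "M11.V.ord u > 1"
  shows "coeff_ord 2 u + coeff_ord 3 u + coeff_ord 4 u + coeff_ord 5 u + coeff_ord 6 u
      + coeff_ord 8 u + coeff_ord 11 u = 1"
    and "tr11 u = 3 * coeff_ord 2 u + 2 * coeff_ord 3 u + 3 * coeff_ord 4 u + coeff_ord 5 u + coeff_ord 8 u"
proof -
  have uZ: "u \<in> carrier M11.ZG" using assms(1) by (rule M11.V_ZG)
  have "augmentation u = 1" using assms(1) by (simp add: M11.V_carrier)
  then show "coeff_ord 2 u + coeff_ord 3 u + coeff_ord 4 u + coeff_ord 5 u + coeff_ord 6 u
      + coeff_ord 8 u + coeff_ord 11 u = 1"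
    using augmentation_expand[OF uZ] coeff_ord_1[OF assms] by (simp add: M11_orders_def)
  show "tr11 u = 3 * coeff_ord 2 u + 2 * coeff_ord 3 u + 3 * coeff_ord 4 u + coeff_ord 5 u + coeff_ord 8 u"
    using tr11_expand[OF uZ] coeff_ord_1[OF assms] by (simp add: M11_orders_def fixes_of_order_def)
qed

text \<open>Only the sums at orders 2 and 4 remain; they add up to 1, and both orders have three
  fixed points.\<close>

lemma order_2_tr11:
  assumes "u \<in> carrier M11.V" "M11.V.ord u = 2"
  shows "tr11 u = 3"
proof -
  have gt: "M11.V.ord u > 1" using assms(2) by simp
  have uZ: "u \<in> carrier M11.ZG" using assms(1) by (rule M11.V_ZG)
  have "u \<otimes>\<^bsub>M11.ZG\<^esub> u = \<one>\<^bsub>M11.ZG\<^esub>"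
    using V_pow_ord_eq_1[OF assms(1)] assms(2) uZ by (simp add: numeral_2_eq_2)
  then have "coeff_ord 8 u = 0" by (rule involution_coeff_ord_8[OF uZ])
  moreover have "coeff_ord 3 u = 0" "coeff_ord 5 u = 0" "coeff_ord 6 u = 0" "coeff_ord 11 u = 0"
    using coeff_ord_supported[OF assms(1) gt, of 3 3] coeff_ord_supported[OF assms(1) gt, of 5 5]
      coeff_ord_supported[OF assms(1) gt, of 3 6] coeff_ord_supported[OF assms(1) gt, of 11 11] assms(2)
    by simp_all
  ultimately show ?thesis using coeff_ord_sum[OF assms(1) gt] by simp
qed

lemma order_3_tr11:
  assumes "u \<in> carrier M11.V" "M11.V.ord u = 3"
  shows "tr11 u = 2"
proof -
  have gt: "M11.V.ord u > 1" using assms(2) by simp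
  have "coeff_ord 2 u = 0" "coeff_ord 4 u = 0" "coeff_ord 5 u = 0" "coeff_ord 6 u = 0" "coeff_ord 8 u = 0" "coeff_ord 11 u = 0"
    using coeff_ord_supported[OF assms(1) gt, of 2 2] coeff_ord_supported[OF assms(1) gt, of 2 4]
      coeff_ord_supported[OF assms(1) gt, of 5 5] coeff_ord_supported[OF assms(1) gt, of 2 6]
      coeff_ord_supported[OF assms(1) gt, of 2 8] coeff_ord_supported[OF assms(1) gt, of 11 11] assms(2)
    by simp_all
  then show ?thesis using coeff_ord_sum[OF assms(1) gt] by simp
qed

text \<open>The sums at orders 4 and 5 are recorded for use with the square of a unit of order
  10.\<close>

lemma order_5_coeff_ord:
  assumes "u \<in> carrier M11.V" "M11.V.ord u = 5"
  shows "coeff_ord 4 u = 0" "coeff_ord 5 u = 1" "tr11 u = 1"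
proof -
  have gt: "M11.V.ord u > 1" using assms(2) by simp
  have z: "coeff_ord 2 u = 0" "coeff_ord 3 u = 0" "coeff_ord 4 u = 0" "coeff_ord 6 u = 0" "coeff_ord 8 u = 0" "coeff_ord 11 u = 0"
    using coeff_ord_supported[OF assms(1) gt, of 2 2] coeff_ord_supported[OF assms(1) gt, of 2 4]
      coeff_ord_supported[OF assms(1) gt, of 3 3] coeff_ord_supported[OF assms(1) gt, of 2 6]
      coeff_ord_supported[OF assms(1) gt, of 2 8] coeff_ord_supported[OF assms(1) gt, of 11 11] assms(2)
    by simp_all
  then show "coeff_ord 4 u = 0" "coeff_ord 5 u = 1" "tr11 u = 1"
    using coeff_ord_sum[OF assms(1) gt] by simp_all
qed

lemma order_11_tr11:
  assumes "u \<in> carrier M11.V" "M11.V.ord u = 11"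
  shows "tr11 u = 0"
proof -
  have gt: "M11.V.ord u > 1" using assms(2) by simp
  have "coeff_ord 2 u = 0" "coeff_ord 3 u = 0" "coeff_ord 4 u = 0" "coeff_ord 5 u = 0" "coeff_ord 8 u = 0"
    using coeff_ord_supported[OF assms(1) gt, of 2 2] coeff_ord_supported[OF assms(1) gt, of 2 4]
      coeff_ord_supported[OF assms(1) gt, of 3 3] coeff_ord_supported[OF assms(1) gt, of 5 5]
      coeff_ord_supported[OF assms(1) gt, of 2 8] assms(2)
    by simp_all
  then show ?thesis using coeff_ord_sum[OF assms(1) gt] by simp
qed

section \<open>Exclusion of the mixed orders\<close>

lemma sum_dvd_lessThan:
  fixes m k :: nat assumes "m > 0"
  shows "(\<Sum>j<m * k. of_bool (m dvd j)) = int k"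
proof -
  have "(\<Sum>j<m * k. of_bool (m dvd j)) = (\<Sum>j\<in>(\<lambda>i. m * i) ` {..<k}. 1::int)"
    using assms by (intro sum.mono_neutral_cong_right) auto
  also have "\<dots> = int k" using assms by (simp add: card_image inj_on_def)
  finally show ?thesis .
qed

text \<open>
  Here \<open>a\<close> and \<open>b\<close> are the multiplicities of 1 as an eigenvalue of \<open>u\<close> and of \<open>u\<^sup>p\<close>.
\<close>

lemma trace_constraints:
  fixes p q :: nat
  assumes u: "u \<in> carrier M11.V" "M11.V.ord u = p * q" and pq: "prime p" "prime q" "p \<noteq> q"
    and \<alpha>: "tr11 (u [^]\<^bsub>M11.ZG\<^esub> q) = \<alpha>" and \<beta>: "tr11 (u [^]\<^bsub>M11.ZG\<^esub> p) = \<beta>"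
  obtains a b :: nat where
    "int (p * q) * int a = 11 + (int p - 1) * \<alpha> + (int q - 1) * \<beta> + (int p - 1) * (int q - 1) * tr11 u"
    "int q * int b = 11 + (int q - 1) * \<beta>" "a \<le> b"
    "tr11 u mod int p = \<beta> mod int p" "tr11 u mod int q = \<alpha> mod int q"
proof -
  have pos: "p > 0" "q > 0" using pq prime_gt_0_nat by auto
  have cop: "coprime p q" using pq by (simp add: primes_coprime)
  have uZ: "u \<in> carrier M11.ZG" using u(1) by (rule M11.V_ZG)
  have un: "u [^]\<^bsub>M11.ZG\<^esub> (p * q) = \<one>\<^bsub>M11.ZG\<^esub>" using V_pow_ord_eq_1[OF u(1)] u(2) by simp
  have n0: "p * q > 0" using pos by simp
  have upZ: "u [^]\<^bsub>M11.ZG\<^esub> p \<in> carrier M11.ZG" "u [^]\<^bsub>M11.ZG\<^esub> q \<in> carrier M11.ZG" using uZ by simp_all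
  have up: "(u [^]\<^bsub>M11.ZG\<^esub> p) [^]\<^bsub>M11.ZG\<^esub> q = \<one>\<^bsub>M11.ZG\<^esub>" "(u [^]\<^bsub>M11.ZG\<^esub> q) [^]\<^bsub>M11.ZG\<^esub> p = \<one>\<^bsub>M11.ZG\<^esub>"
    using un uZ by (simp_all add: M11.ZG.nat_pow_pow mult.commute)
  have tr1: "tr11 \<one>\<^bsub>M11.ZG\<^esub> = 11"
    by (simp add: tr11_def M11.lin_one fixes_of_order_def)
  \<comment> \<open>The trace of u^j depends only on the gcd of j and p q. Inclusion and exclusion
    encodes the four values 11, \<open>\<beta>\<close>, \<open>\<alpha>\<close>,
    \<open>tr11 u\<close>, so that summing over j only counts multiples.\<close>
  have trp: "tr11 (u [^]\<^bsub>M11.ZG\<^esub> j) = tr11 u + (\<beta> - tr11 u) * of_bool (p dvd j)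
      + (\<alpha> - tr11 u) * of_bool (q dvd j) + (11 - \<beta> - \<alpha> + tr11 u) * of_bool (p * q dvd j)" for j
  proof -
    have both: "p * q dvd j \<longleftrightarrow> p dvd j \<and> q dvd j"
      using cop by (meson divides_mult dvd_mult_left dvd_mult_right)
    consider "p * q dvd j" | "p dvd j" "\<not> q dvd j" | "\<not> p dvd j" "q dvd j" | "\<not> p dvd j" "\<not> q dvd j"
      using both by blast
    then show ?thesis
    proof cases
      case 1
      then obtain i where "j = p * q * i" by (elim dvdE)
      then have "u [^]\<^bsub>M11.ZG\<^esub> j = \<one>\<^bsub>M11.ZG\<^esub>" using uZ un by (simp flip: M11.ZG.nat_pow_pow)
      then show ?thesis using 1 both tr1 by simp
    next
      case 2
      then obtain i where i: "j = p * i" by (elim dvdE)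
      have "\<not> q dvd i" using 2 i by auto
      then have "coprime i q" using pq(2) prime_imp_coprime coprime_commute by blast
      then have "tr11 ((u [^]\<^bsub>M11.ZG\<^esub> p) [^]\<^bsub>M11.ZG\<^esub> i) = \<beta>"
        using tr11_pow_coprime[OF upZ(1) up(1) pos(2)] \<beta> by simp
      then show ?thesis using 2 both uZ by (simp add: i M11.ZG.nat_pow_pow)
    next
      case 3
      then obtain i where i: "j = q * i" by (elim dvdE)
      have "\<not> p dvd i" using 3 i by auto
      then have "coprime i p" using pq(1) prime_imp_coprime coprime_commute by blast
      then have "tr11 ((u [^]\<^bsub>M11.ZG\<^esub> q) [^]\<^bsub>M11.ZG\<^esub> i) = \<alpha>"
        using tr11_pow_coprime[OF upZ(2) up(2) pos(1)] \<alpha> by simp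
      then show ?thesis using 3 both uZ by (simp add: i M11.ZG.nat_pow_pow)
    next
      case 4
      then have "coprime j (p * q)"
        using pq prime_imp_coprime coprime_commute by (metis coprime_mult_right_iff)
      then show ?thesis using 4 both tr11_pow_coprime[OF uZ un n0] by simp
    qed
  qed
  obtain c :: "nat \<Rightarrow> nat" where
    c: "\<And>m k. p * q = m * k \<Longrightarrow> int (k * c m) = (\<Sum>j<k. lin R11.fix_count (u [^]\<^bsub>M11.ZG\<^esub> (m * j)))"
      "\<And>m m'. m dvd m' \<Longrightarrow> c m \<le> c m'"
    using R11.eigenvalue_counts[OF uZ un n0] by metis
  have c1: "int (p * q * c 1) = (\<Sum>j<p * q. tr11 (u [^]\<^bsub>M11.ZG\<^esub> j))"
    using c(1)[of 1 "p * q"] lin_fix_count_M11 uZ by simp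
  have c2: "int (q * c p) = (\<Sum>j<q. tr11 (u [^]\<^bsub>M11.ZG\<^esub> (p * j)))"
    using c(1)[of p q] lin_fix_count_M11 uZ by simp
  have "(\<Sum>j<p * q. tr11 (u [^]\<^bsub>M11.ZG\<^esub> j)) = int (p * q) * tr11 u + (\<beta> - tr11 u) * int q
      + (\<alpha> - tr11 u) * int p + (11 - \<beta> - \<alpha> + tr11 u)"
  proof -
    have "(\<Sum>j<p * q. of_bool (q dvd j)) = int p"
      using sum_dvd_lessThan[OF pos(2), of p] by (simp only: mult.commute[of p q])
    moreover have "(\<Sum>j<p * q. of_bool (p * q dvd j)) = (1::int)"
      using sum_dvd_lessThan[OF n0, of 1] by (simp only: mult_1_right of_nat_1)
    moreover have "(\<Sum>j<p * q. of_bool (p dvd j)) = int q" by (rule sum_dvd_lessThan[OF pos(1)])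
    ultimately show ?thesis
      unfolding trp sum.distrib sum_distrib_left[symmetric] by (simp only: sum_constant card_lessThan mult_1_right)
  qed
  then have A: "int (p * q) * int (c 1) = 11 + (int p - 1) * \<alpha> + (int q - 1) * \<beta> + (int p - 1) * (int q - 1) * tr11 u"
    using c1 by (simp add: algebra_simps)
  have "tr11 (u [^]\<^bsub>M11.ZG\<^esub> (p * j)) = \<beta> + (11 - \<beta>) * of_bool (q dvd j)" for j
    using pos cop by (simp add: trp coprime_dvd_mult_right_iff coprime_commute)
  then have "(\<Sum>j<q. tr11 (u [^]\<^bsub>M11.ZG\<^esub> (p * j))) = int q * \<beta> + (11 - \<beta>) * (\<Sum>j<q. of_bool (q dvd j))"
    by (simp only: sum.distrib sum_distrib_left[symmetric] sum_constant card_lessThan)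
  also have "(\<Sum>j<q. of_bool (q dvd j)) = (1::int)"
    using sum_dvd_lessThan[OF pos(2), of 1] by (simp only: mult_1_right of_nat_1)
  finally have B: "int q * int (c p) = 11 + (int q - 1) * \<beta>"
    using c2 by (simp add: algebra_simps)
  have "tr11 u mod int p = \<beta> mod int p" "tr11 u mod int q = \<alpha> mod int q"
    using tr11_cong[OF uZ pq(1)] tr11_cong[OF uZ pq(2)] \<alpha> \<beta> by (simp_all add: cong_def)
  then show thesis using that[OF A B] c(2)[of 1 p] by simp
qed

lemma ord_V_prime_factor:
  assumes "u \<in> carrier M11.V" "M11.V.ord u = p * q" "p > 0"
  shows "u [^]\<^bsub>M11.ZG\<^esub> p \<in> carrier M11.V" "M11.V.ord (u [^]\<^bsub>M11.ZG\<^esub> p) = q"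
  using M11.V.nat_pow_closed[OF assms(1), of p] M11.V.ord_pow[OF assms(1), of p] assms(2,3)
  by (simp_all add: M11.V_pow)

lemma no_unit_of_order_10:
  assumes u: "u \<in> carrier M11.V" "M11.V.ord u = 2 * 5"
  shows False
proof -
  have u': "M11.V.ord u = 5 * 2" using u(2) by simp
  note o5 = ord_V_prime_factor[OF u] and o2 = ord_V_prime_factor[OF u(1) u']
  have t5: "tr11 (u [^]\<^bsub>M11.ZG\<^esub> (5::nat)) = 3" and t2: "tr11 (u [^]\<^bsub>M11.ZG\<^esub> (2::nat)) = 1"
    using o2 o5 by (simp_all add: order_2_tr11 order_5_coeff_ord)
  \<comment> \<open>With t the trace, 10 a = 18 + 4 t and a \<le> b = 3 confine t to -4, ..., 3; t
    is odd and 3 modulo 5.\<close>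
  have t: "tr11 u = 3"
    by (rule trace_constraints[OF u _ _ _ t5 t2]; simp; presburger)
  have gt: "M11.V.ord u > 1" using u(2) by simp
  have uZ: "u \<in> carrier M11.ZG" using u(1) by (rule M11.V_ZG)
  have z: "coeff_ord 3 u = 0" "coeff_ord 6 u = 0" "coeff_ord 11 u = 0"
    using coeff_ord_supported[OF u(1) gt, of 3 3] coeff_ord_supported[OF u(1) gt, of 3 6]
      coeff_ord_supported[OF u(1) gt, of 11 11] u(2)
    by simp_all
  \<comment> \<open>Modulo 2 the sum at order m for the square of u is the sum of u over elements
    whose squares have order m. In M11 order 4 arises only from order 8, and order 5 only from order
    5.\<close>
  have square: "[coeff_ord m (u [^]\<^bsub>M11.ZG\<^esub> (2::nat)) = coeff_ord m' u] (mod 2)"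
    if "\<And>k. k \<in> M11_orders \<Longrightarrow> k div gcd k 2 = m \<longleftrightarrow> k = m'" for m m'
  proof -
    have "lin (\<lambda>g. of_bool (M11.ord (g [^]\<^bsub>M11\<^esub> (2::nat)) = m)) u = coeff_ord m' u"
      unfolding coeff_ord_def
    proof (rule lin_cong)
      fix g assume "g \<in> Poly_Mapping.keys u"
      then have g: "g \<in> carrier M11" using uZ by (auto simp: M11.ZG_carrier)
      then show "of_bool (M11.ord (g [^]\<^bsub>M11\<^esub> (2::nat)) = m) = (of_bool (M11.ord g = m') :: int)"
        using that[OF M11_ord_in[OF g]] M11_ord_pow[OF g, of 2] by simp
    qed
    then show ?thesis
      using M11.lin_prime_power_cong[OF uZ two_is_prime_nat M11.class_fun_ord[of "\<lambda>k. of_bool (k = m)"]]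
      by (simp add: coeff_ord_def)
  qed
  have "[coeff_ord 4 (u [^]\<^bsub>M11.ZG\<^esub> (2::nat)) = coeff_ord 8 u] (mod 2)"
    by (rule square) (auto simp: M11_orders_def)
  moreover have "[coeff_ord 5 (u [^]\<^bsub>M11.ZG\<^esub> (2::nat)) = coeff_ord 5 u] (mod 2)"
    by (rule square) (auto simp: M11_orders_def)
  moreover have "coeff_ord 4 (u [^]\<^bsub>M11.ZG\<^esub> (2::nat)) = 0" "coeff_ord 5 (u [^]\<^bsub>M11.ZG\<^esub> (2::nat)) = 1"
    using o5 by (simp_all add: order_5_coeff_ord)
  ultimately have "coeff_ord 8 u mod 2 = 0" "coeff_ord 5 u mod 2 = 1"
    by (simp_all add: cong_def)
  \<comment> \<open>Trace 3 and augmentation 1 force the sums at orders 5 and 8 to add up to 0, yet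
    the first is odd and the second even.\<close>
  then show False using coeff_ord_sum[OF u(1) gt] z t by presburger
qed

text \<open>Here 15 a = 19 + 8 t with 0 \<le> a \<le> 3 confines t to -2, ..., 3, while the
  congruences ask for t = 7 modulo 15.\<close>

lemma no_unit_of_order_15:
  assumes u: "u \<in> carrier M11.V" "M11.V.ord u = 3 * 5"
  shows False
proof -
  have u': "M11.V.ord u = 5 * 3" using u(2) by simp
  note o5 = ord_V_prime_factor[OF u] and o3 = ord_V_prime_factor[OF u(1) u']
  have t5: "tr11 (u [^]\<^bsub>M11.ZG\<^esub> (5::nat)) = 2" and t3: "tr11 (u [^]\<^bsub>M11.ZG\<^esub> (3::nat)) = 1"
    using o3 o5 by (simp_all add: order_3_tr11 order_5_coeff_ord)
  show False
    by (rule trace_constraints[OF u _ _ _ t5 t3]; simp; presburger)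
qed

text \<open>Here 22 a = 14 + 10 t with a equal to 0 or 1, so 10 t would be -14 or 8.\<close>

lemma no_unit_of_order_22:
  assumes u: "u \<in> carrier M11.V" "M11.V.ord u = 2 * 11"
  shows False
proof -
  have u': "M11.V.ord u = 11 * 2" using u(2) by simp
  note o11 = ord_V_prime_factor[OF u] and o2 = ord_V_prime_factor[OF u(1) u']
  have t11: "tr11 (u [^]\<^bsub>M11.ZG\<^esub> (11::nat)) = 3" and t2: "tr11 (u [^]\<^bsub>M11.ZG\<^esub> (2::nat)) = 0"
    using o2 o11 by (simp_all add: order_2_tr11 order_11_tr11)
  show False
  proof (rule trace_constraints[OF u _ _ _ t11 t2])
    fix a b :: nat
    assume a: "int (2 * 11) * int a = 11 + (int 2 - 1) * 3 + (int 11 - 1) * 0 + (int 2 - 1) * (int 11 - 1) * tr11 u"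
      and b: "int 11 * int b = 11 + (int 11 - 1) * 0" and ab: "a \<le> b" and t: "tr11 u mod int 2 = 0 mod int 2"
    have "b = 1" using b by simp
    then have "a = 0 \<or> a = 1" using ab by auto
    then show False
    proof
      assume "a = 0"
      then show False using a by simp presburger
    next
      assume "a = 1"
      then show False using a t by simp presburger
    qed
  qed simp_all
qed

text \<open>Here 33 a = 15 + 20 t with a equal to 0 or 1, so 20 t would be -15 or 18.\<close>

lemma no_unit_of_order_33:
  assumes u: "u \<in> carrier M11.V" "M11.V.ord u = 3 * 11"
  shows False
proof -
  have u': "M11.V.ord u = 11 * 3" using u(2) by simp
  note o11 = ord_V_prime_factor[OF u] and o3 = ord_V_prime_factor[OF u(1) u']
  have t11: "tr11 (u [^]\<^bsub>M11.ZG\<^esub> (11::nat)) = 2" and t3: "tr11 (u [^]\<^bsub>M11.ZG\<^esub> (3::nat)) = 0"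
    using o3 o11 by (simp_all add: order_3_tr11 order_11_tr11)
  show False
  proof (rule trace_constraints[OF u _ _ _ t11 t3])
    fix a b :: nat
    assume a: "int (3 * 11) * int a = 11 + (int 3 - 1) * 2 + (int 11 - 1) * 0 + (int 3 - 1) * (int 11 - 1) * tr11 u"
      and b: "int 11 * int b = 11 + (int 11 - 1) * 0" and ab: "a \<le> b" and t: "tr11 u mod int 3 = 0 mod int 3"
    have "b = 1" using b by simp
    then have "a = 0 \<or> a = 1" using ab by auto
    then show False
    proof
      assume "a = 0"
      then show False using a by simp presburger
    next
      assume "a = 1"
      then show False using a t by simp presburger
    qed
  qed simp_all
qed

text \<open>Here 55 a = 15 + 40 t with a equal to 0 or 1. Only a = 1, t = 1 is integral, and 5 must
  divide t.\<close>

lemma no_unit_of_order_55: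
  assumes u: "u \<in> carrier M11.V" "M11.V.ord u = 5 * 11"
  shows False
proof -
  have u': "M11.V.ord u = 11 * 5" using u(2) by simp
  note o11 = ord_V_prime_factor[OF u] and o5 = ord_V_prime_factor[OF u(1) u']
  have t11: "tr11 (u [^]\<^bsub>M11.ZG\<^esub> (11::nat)) = 1" and t5: "tr11 (u [^]\<^bsub>M11.ZG\<^esub> (5::nat)) = 0"
    using o5 o11 by (simp_all add: order_5_coeff_ord order_11_tr11)
  show False
  proof (rule trace_constraints[OF u _ _ _ t11 t5])
    fix a b :: nat
    assume a: "int (5 * 11) * int a = 11 + (int 5 - 1) * 1 + (int 11 - 1) * 0 + (int 5 - 1) * (int 11 - 1) * tr11 u"
      and b: "int 11 * int b = 11 + (int 11 - 1) * 0" and ab: "a \<le> b" and t: "tr11 u mod int 5 = 0 mod int 5"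
    have "b = 1" using b by simp
    then have "a = 0 \<or> a = 1" using ab by auto
    then show False
    proof
      assume "a = 0"
      then show False using a by simp presburger
    next
      assume "a = 1"
      then show False using a t by simp
    qed
  qed simp_all
qed

theorem mainTheorem2:
  shows "prime_graph M11 = prime_graph (normalized_units M11)"
proof -
  have vert: "prime_graph_vertices M11 = prime_graph_vertices M11.V"
    using M11.prime_graph_vertices_subset M11.prime_graph_vertices_V by blast
  have pr: "p \<in> {2, 3, 5, 11}" if "p \<in> prime_graph_vertices M11" for p
  proof -
    from that obtain g where "prime p" "g \<in> carrier M11" "M11.ord g = p"
      by (auto simp: prime_graph_vertices_def)
    then have "prime p" "p \<in> M11_orders" using M11_ord_in by auto
    then show ?thesis by (auto simp: M11_orders_def)
  qed
  have e23: "{2, 3} \<in> prime_graph_edges M11"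
  proof -
    have "2 \<in> prime_graph_vertices M11" "3 \<in> prime_graph_vertices M11"
      using M11_ord_exists[of 2] M11_ord_exists[of 3] by (auto simp: prime_graph_vertices_def)
    moreover have "\<exists>x\<in>carrier M11. M11.ord x = 2 * 3" using M11_ord_exists[of 6] by simp
    ultimately show ?thesis unfolding prime_graph_edges_def
      by (intro CollectI exI[of _ 2] exI[of _ 3]) simp
  qed
  have "prime_graph_edges M11.V \<subseteq> prime_graph_edges M11"
  proof
    fix E assume "E \<in> prime_graph_edges M11.V"
    then obtain p q u where E: "E = {p, q}" "p \<in> prime_graph_vertices M11" "q \<in> prime_graph_vertices M11" "p \<noteq> q"
      and u: "u \<in> carrier M11.V" "M11.V.ord u = p * q"
      by (auto simp: prime_graph_edges_def vert)
    have "M11.V.ord u = q * p" using u(2) by (simp add: mult.commute)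
    then have no: "{p, q} \<noteq> {2, 5}" "{p, q} \<noteq> {3, 5}" "{p, q} \<noteq> {2, 11}" "{p, q} \<noteq> {3, 11}" "{p, q} \<noteq> {5, 11}"
      using no_unit_of_order_10[OF u(1)] no_unit_of_order_15[OF u(1)] no_unit_of_order_22[OF u(1)]
        no_unit_of_order_33[OF u(1)] no_unit_of_order_55[OF u(1)] u(2)
      unfolding doubleton_eq_iff by auto
    have "E = {2, 3}"
      using pr[OF E(2)] pr[OF E(3)] E(4) no unfolding E(1) by auto
    then show "E \<in> prime_graph_edges M11" using e23 by simp
  qed
  then show ?thesis
    using vert M11.prime_graph_edges_subset by (simp add: prime_graph_def)
qed

end
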